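(* Let $(M,\nabla_M)$ be a compact, complete affine manifold endowed with a linear foliation ${\cal F}_M^U$ of codimension $1$. Suppose that ${\cal F}_M^U$ has a compact leaf. Then: 1. All the leaves of ${\cal F}_M^U$ are compact. 2. There exists a finite cover $(M',\nabla_{M'})$ of $(M,\nabla_M)$ and an affine map $f:(M',\nabla_{M'})\to S^1$, where $S^1$ is the quotient of $\mathbb{R}$ by a translation.
   Context: All manifolds are connected and without boundary. An $n$-dimensional affine manifold $(M,\nabla_M)$ is a smooth $n$-manifold $M$ with a flat torsion-free connection $\nabla_M$ (equivalently, an atlas whose coordinate changes are affine transformations of $\mathbb{R}^n$). An affine map between affine manifolds is a differentiable map which is affine in affine charts. A finite cover is endowed with the pulled-back connection. Let $p_M:\hat M\to M$ be the universal cover, on which $\pi_1(M)$ acts by deck transformations, $D_M:\hat M\to\mathbb{R}^n$ the developing map (a local diffeomorphism which is affine for the pulled-back connection), $h_M:\pi_1(M)\to Aff(\mathbb{R}^n)$ the holonomy, characterized by $D_M\circ\gamma=h_M(\gamma)\circ D_M$, and $L(h_M):\pi_1(M)\to Gl(\mathbb{R}^n)$ its linear part. $(M,\nabla_M)$ is complete if $\nabla_M$ is geodesically complete, equivalently if $D_M$ is a diffeomorphism. If $U\subset\mathbb{R}^n$ is a vector subspace with $L(h_M)(\gamma)(U)=U$ for all $\gamma\in\pi_1(M)$, the foliation of $\mathbb{R}^n$ by affine subspaces parallel to $U$ pulls back under $D_M$ to a $\pi_1(M)$-invariant foliation ${\cal F}^U_{\hat M}$ of $\hat M$, which is the pullback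 by $p_M$ of a foliation ${\cal F}^U_M$ of $M$; ${\cal F}^U_M$ is called a linear foliation. Its codimension is $n-\dim U$. *)

theory Defs
  imports "HOL-Analysis.Analysis"
begin

section \<open>Affine maps of Euclidean spaces\<close>

definition affine_fun :: "('e::euclidean_space \<Rightarrow> 'f::euclidean_space) \<Rightarrow> bool" where
  "affine_fun g \<longleftrightarrow> (\<exists>l b. linear l \<and> g = (\<lambda>x. l x + b))"

definition linear_part :: "('e::euclidean_space \<Rightarrow> 'f::euclidean_space) \<Rightarrow> 'e \<Rightarrow> 'f" where
  "linear_part g = (\<lambda>v. g v - g 0)"


section \<open>Affine manifolds\<close>

text \<open>
  A chart is a pair of an open domain and a coordinate function; the values of the coordinate
  function outside the domain are irrelevant. Overlaps of chart domains need not be connected, so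
  "the coordinate changes are affine" means, as usual for flat structures, that each of them is
  locally the restriction of an affine transformation.
\<close>

type_synonym ('a, 'e) atlas = "('a set \<times> ('a \<Rightarrow> 'e)) set"

definition affine_atlas :: "'a topology \<Rightarrow> ('a, 'e::euclidean_space) atlas \<Rightarrow> bool" where
  "affine_atlas M A \<longleftrightarrow>
     (\<forall>(V, \<phi>) \<in> A. openin M V \<and> open (\<phi> ` V) \<and>
        homeomorphic_map (subtopology M V) (top_of_set (\<phi> ` V)) \<phi>) \<and>
     \<Union> (fst ` A) = topspace M \<and>
     (\<forall>(V, \<phi>) \<in> A. \<forall>(W, \<psi>) \<in> A. \<forall>x \<in> V \<inter> W.
        \<exists>N g. openin M N \<and> x \<in> N \<and> N \<subseteq> V \<inter> W \<and> affine_fun g \<and> bij g \<and>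
              (\<forall>z \<in> N. \<psi> z = g (\<phi> z)))"

definition affine_manifold :: "'a topology \<Rightarrow> ('a, 'e::euclidean_space) atlas \<Rightarrow> bool" where
  "affine_manifold M A \<longleftrightarrow>
     Hausdorff_space M \<and> second_countable M \<and> connected_space M \<and> affine_atlas M A"

definition affine_map ::
  "'a topology \<Rightarrow> ('a, 'e::euclidean_space) atlas \<Rightarrow>
   'b topology \<Rightarrow> ('b, 'f::euclidean_space) atlas \<Rightarrow> ('a \<Rightarrow> 'b) \<Rightarrow> bool" where
  "affine_map M A N B f \<longleftrightarrow>
     continuous_map M N f \<and>
     (\<forall>(V, \<phi>) \<in> A. \<forall>(W, \<psi>) \<in> B. \<forall>x \<in> V. f x \<in> W \<longrightarrow>
        (\<exists>N' g. openin M N' \<and> x \<in> N' \<and> N' \<subseteq> V \<and> f ` N' \<subseteq> W \<and> affine_fun g \<and>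
                (\<forall>z \<in> N'. \<psi> (f z) = g (\<phi> z))))"

definition standard_atlas :: "'e set \<Rightarrow> ('e, 'e::euclidean_space) atlas" where
  "standard_atlas S = {(S, \<lambda>x. x)}"

text \<open>
  In affine charts the Christoffel symbols of the flat connection vanish, so the geodesics
  (with their affine parametrisation) are exactly the affine maps from open intervals.
\<close>

definition geodesic_on ::
  "'a topology \<Rightarrow> ('a, 'e::euclidean_space) atlas \<Rightarrow> real set \<Rightarrow> (real \<Rightarrow> 'a) \<Rightarrow> bool" where
  "geodesic_on M A I c \<longleftrightarrow> affine_map (top_of_set I) (standard_atlas I) M A c"

definition geodesically_complete :: "'a topology \<Rightarrow> ('a, 'e::euclidean_space) atlas \<Rightarrow> bool" where
  "geodesically_complete M A \<longleftrightarrow>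
     (\<forall>I c. open I \<and> is_interval I \<and> I \<noteq> {} \<and> geodesic_on M A I c \<longrightarrow>
        (\<exists>c'. geodesic_on M A UNIV c' \<and> (\<forall>t \<in> I. c' t = c t)))"


section \<open>Coverings, developing map and holonomy\<close>

text \<open>
  The library notions \<open>covering_space\<close> and \<open>simply_connected\<close>, transferred from sets in
  type-class topologies to abstract topologies.
\<close>

definition covering_map :: "'b topology \<Rightarrow> 'a topology \<Rightarrow> ('b \<Rightarrow> 'a) \<Rightarrow> bool" where
  "covering_map X Y p \<longleftrightarrow>
     continuous_map X Y p \<and> p ` topspace X = topspace Y \<and>
     (\<forall>y \<in> topspace Y. \<exists>T. y \<in> T \<and> openin Y T \<and>
        (\<exists>\<V>. \<Union> \<V> = {x \<in> topspace X. p x \<in> T} \<and>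
              (\<forall>V \<in> \<V>. openin X V) \<and> pairwise disjnt \<V> \<and>
              (\<forall>V \<in> \<V>. homeomorphic_map (subtopology X V) (subtopology Y T) p)))"

definition simply_connected_space :: "'a topology \<Rightarrow> bool" where
  "simply_connected_space X \<longleftrightarrow>
     (\<forall>p q. pathin X p \<and> p 1 = p 0 \<and> pathin X q \<and> q 1 = q 0 \<longrightarrow>
        homotopic_with (\<lambda>r. r 1 = r 0) (top_of_set {0..1::real}) X p q)"

definition universal_cover :: "'b topology \<Rightarrow> 'a topology \<Rightarrow> ('b \<Rightarrow> 'a) \<Rightarrow> bool" where
  "universal_cover Mh M p \<longleftrightarrow> covering_map Mh M p \<and> simply_connected_space Mh"

text \<open>The fundamental group of the base acts on the universal cover as this group.\<close>

definition deck_transformations :: "'b topology \<Rightarrow> ('b \<Rightarrow> 'a) \<Rightarrow> ('b \<Rightarrow> 'b) set" where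
  "deck_transformations Mh p =
     {\<gamma>. homeomorphic_map Mh Mh \<gamma> \<and> (\<forall>x \<in> topspace Mh. p (\<gamma> x) = p x)}"

text \<open>The atlas of the pulled-back connection, for a local homeomorphism \<open>p\<close>.\<close>

definition pullback_atlas ::
  "'b topology \<Rightarrow> 'a topology \<Rightarrow> ('b \<Rightarrow> 'a) \<Rightarrow> ('a, 'e::euclidean_space) atlas \<Rightarrow> ('b, 'e) atlas"
  where
  "pullback_atlas X M p A =
     {(V', \<lambda>x. \<phi> (p x)) | V' V \<phi>. (V, \<phi>) \<in> A \<and> openin X V' \<and> openin M (p ` V') \<and> p ` V' \<subseteq> V \<and>
        homeomorphic_map (subtopology X V') (subtopology M (p ` V')) p}"

text \<open>
  A map which is affine in charts and a local homeomorphism has invertible affine local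
  expressions, hence is a local diffeomorphism.
\<close>

definition developing_map ::
  "'b topology \<Rightarrow> ('b, 'e::euclidean_space) atlas \<Rightarrow> ('b \<Rightarrow> 'e) \<Rightarrow> bool" where
  "developing_map X B D \<longleftrightarrow>
     affine_map X B euclidean (standard_atlas UNIV) D \<and>
     (\<forall>x \<in> topspace X. \<exists>W. openin X W \<and> x \<in> W \<and> open (D ` W) \<and>
        homeomorphic_map (subtopology X W) (top_of_set (D ` W)) D)"

definition holonomy ::
  "'b topology \<Rightarrow> ('b \<Rightarrow> 'a) \<Rightarrow> ('b \<Rightarrow> 'e::euclidean_space) \<Rightarrow> (('b \<Rightarrow> 'b) \<Rightarrow> 'e \<Rightarrow> 'e) \<Rightarrow> bool"
  where
  "holonomy Mh p D h \<longleftrightarrow>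
     (\<forall>\<gamma> \<in> deck_transformations Mh p. affine_fun (h \<gamma>) \<and> bij (h \<gamma>) \<and>
        (\<forall>x \<in> topspace Mh. D (\<gamma> x) = h \<gamma> (D x)))"

text \<open>
  A finite cover is again a (connected) manifold and carries the pulled-back affine structure.
\<close>

definition finite_affine_cover ::
  "'c topology \<Rightarrow> ('c \<Rightarrow> 'a) \<Rightarrow> 'a topology \<Rightarrow> ('a, 'e::euclidean_space) atlas \<Rightarrow> bool" where
  "finite_affine_cover M' q M A \<longleftrightarrow>
     covering_map M' M q \<and>
     (\<forall>y \<in> topspace M. finite {x \<in> topspace M'. q x = y}) \<and>
     affine_manifold M' (pullback_atlas M' M q A)"


section \<open>Quotient topologies\<close>

definition quotient_topology :: "'a topology \<Rightarrow> ('a \<Rightarrow> 'b) \<Rightarrow> 'b topology" where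
  "quotient_topology X q =
     topology (\<lambda>S. S \<subseteq> q ` topspace X \<and> openin X {x \<in> topspace X. q x \<in> S})"

lemma openin_quotient_topology:
  "openin (quotient_topology X q) S \<longleftrightarrow>
     S \<subseteq> q ` topspace X \<and> openin X {x \<in> topspace X. q x \<in> S}"
proof -
  have "istopology (\<lambda>S. S \<subseteq> q ` topspace X \<and> openin X {x \<in> topspace X. q x \<in> S})"
    unfolding istopology_def
  proof (intro conjI allI impI)
    fix S T
    assume S: "S \<subseteq> q ` topspace X \<and> openin X {x \<in> topspace X. q x \<in> S}"
      and T: "T \<subseteq> q ` topspace X \<and> openin X {x \<in> topspace X. q x \<in> T}"
    show "S \<inter> T \<subseteq> q ` topspace X" using S by blast
    have "{x \<in> topspace X. q x \<in> S \<inter> T} = {x \<in> topspace X. q x \<in> S} \<inter> {x \<in> topspace X. q x \<in> T}"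
      by blast
    then show "openin X {x \<in> topspace X. q x \<in> S \<inter> T}" using S T by auto
  next
    fix \<K>
    assume K: "\<forall>S\<in>\<K>. S \<subseteq> q ` topspace X \<and> openin X {x \<in> topspace X. q x \<in> S}"
    show "\<Union>\<K> \<subseteq> q ` topspace X" using K by blast
    have "{x \<in> topspace X. q x \<in> \<Union>\<K>} = (\<Union>S\<in>\<K>. {x \<in> topspace X. q x \<in> S})"
      by blast
    then show "openin X {x \<in> topspace X. q x \<in> \<Union>\<K>}" using K by auto
  qed
  then show ?thesis by (simp add: quotient_topology_def)
qed


section \<open>Linear foliations\<close>

text \<open>
  A foliation is represented by its leaf topology: the topology on the underlying set of the
  manifold whose basic open sets are the plaques. Its connected components are the leaves, and
  the topology it induces on a leaf is the intrinsic (manifold) topology of that leaf.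
\<close>

text \<open>
  The foliation of the universal cover pulled back under \<open>D\<close> from the foliation by affine
  subspaces parallel to \<open>U\<close>; its plaque through \<open>x\<close> in \<open>W\<close> is \<open>{z \<in> W. D z - D x \<in> U}\<close>.
\<close>

definition cover_leaf_topology ::
  "'b topology \<Rightarrow> ('b \<Rightarrow> 'e::euclidean_space) \<Rightarrow> 'e set \<Rightarrow> 'b topology" where
  "cover_leaf_topology Mh D U =
     topology (\<lambda>S. S \<subseteq> topspace Mh \<and>
       (\<forall>x \<in> S. \<exists>W. openin Mh W \<and> x \<in> W \<and> {z \<in> W. D z - D x \<in> U} \<subseteq> S))"

lemma openin_cover_leaf_topology:
  "openin (cover_leaf_topology Mh D U) S \<longleftrightarrow>
     S \<subseteq> topspace Mh \<and>
     (\<forall>x \<in> S. \<exists>W. openin Mh W \<and> x \<in> W \<and> {z \<in> W. D z - D x \<in> U} \<subseteq> S)"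
proof -
  define R where
    "R = (\<lambda>x S. \<exists>W. openin Mh W \<and> x \<in> W \<and> {z \<in> W. D z - D x \<in> U} \<subseteq> S)"
  have R_Int: "R x (S \<inter> T)" if S: "R x S" and T: "R x T" for x S T
  proof -
    obtain W1 where W1: "openin Mh W1" "x \<in> W1" "{z \<in> W1. D z - D x \<in> U} \<subseteq> S"
      using S unfolding R_def by auto
    obtain W2 where W2: "openin Mh W2" "x \<in> W2" "{z \<in> W2. D z - D x \<in> U} \<subseteq> T"
      using T unfolding R_def by auto
    have "openin Mh (W1 \<inter> W2)" "x \<in> W1 \<inter> W2"
      "{z \<in> W1 \<inter> W2. D z - D x \<in> U} \<subseteq> S \<inter> T"
      using W1 W2 by auto
    then show ?thesis unfolding R_def by meson
  qed
  have R_mono: "R x T" if "R x S" "S \<subseteq> T" for x S T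
    using that unfolding R_def by (meson order_trans)
  have "istopology (\<lambda>S. S \<subseteq> topspace Mh \<and> (\<forall>x \<in> S. R x S))"
    unfolding istopology_def
  proof (rule conjI; intro allI impI)
    fix S T
    assume "S \<subseteq> topspace Mh \<and> (\<forall>x \<in> S. R x S)" "T \<subseteq> topspace Mh \<and> (\<forall>x \<in> T. R x T)"
    then show "S \<inter> T \<subseteq> topspace Mh \<and> (\<forall>x \<in> S \<inter> T. R x (S \<inter> T))"
      using R_Int by auto
  next
    fix \<K>
    assume K: "\<forall>S\<in>\<K>. S \<subseteq> topspace Mh \<and> (\<forall>x \<in> S. R x S)"
    have "R x (\<Union>\<K>)" if "x \<in> S" "S \<in> \<K>" for x S
      using R_mono[of x S "\<Union>\<K>"] K that by auto
    then show "\<Union>\<K> \<subseteq> topspace Mh \<and> (\<forall>x \<in> \<Union>\<K>. R x (\<Union>\<K>))"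
      using K by auto
  qed
  then show ?thesis by (simp add: cover_leaf_topology_def R_def)
qed

text \<open>
  The foliation of the base whose pullback by \<open>p\<close> is the foliation above. As \<open>p\<close> is a surjective
  local homeomorphism, a set is open in the leaf topology below iff its preimage is so above.
\<close>

definition leaf_topology ::
  "'b topology \<Rightarrow> ('b \<Rightarrow> 'a) \<Rightarrow> ('b \<Rightarrow> 'e::euclidean_space) \<Rightarrow> 'e set \<Rightarrow> 'a topology" where
  "leaf_topology Mh p D U = quotient_topology (cover_leaf_topology Mh D U) p"

definition leaves ::
  "'b topology \<Rightarrow> ('b \<Rightarrow> 'a) \<Rightarrow> ('b \<Rightarrow> 'e::euclidean_space) \<Rightarrow> 'e set \<Rightarrow> 'a set set" where
  "leaves Mh p D U = connected_components_of (leaf_topology Mh p D U)"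

definition compact_leaf ::
  "'b topology \<Rightarrow> ('b \<Rightarrow> 'a) \<Rightarrow> ('b \<Rightarrow> 'e::euclidean_space) \<Rightarrow> 'e set \<Rightarrow> 'a set \<Rightarrow> bool" where
  "compact_leaf Mh p D U F \<longleftrightarrow> F \<in> leaves Mh p D U \<and> compactin (leaf_topology Mh p D U) F"


section \<open>The affine circle\<close>

text \<open>
  The quotient of the real line by the group generated by the translation by \<open>\<tau>\<close>. Points are
  orbits, so a local inverse of the quotient map is a function \<open>\<phi>\<close> with \<open>\<phi> c \<in> c\<close>; these are
  the affine charts.
\<close>

definition translation_orbit :: "real \<Rightarrow> real \<Rightarrow> real set" where
  "translation_orbit \<tau> x = {x + of_int k * \<tau> | k :: int. True}"

definition circle :: "real \<Rightarrow> real set topology" where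
  "circle \<tau> = quotient_topology euclidean (translation_orbit \<tau>)"

definition circle_atlas :: "real \<Rightarrow> (real set, real) atlas" where
  "circle_atlas \<tau> =
     {(V, \<phi>). openin (circle \<tau>) V \<and> open (\<phi> ` V) \<and> (\<forall>c \<in> V. \<phi> c \<in> c) \<and>
        homeomorphic_map (subtopology (circle \<tau>) V) (top_of_set (\<phi> ` V)) \<phi>}"

end

theory Submission
  imports Defs
begin

text \<open>
  Completeness makes the developing map a homeomorphism, so \<open>M\<close> is a quotient of Euclidean space by
  a properly discontinuous cocompact group \<open>\<Gamma>\<close> of affine maps. Let \<open>x \<mapsto> a \<bullet> x\<close> be a linear form with
  kernel \<open>U\<close>; it makes \<open>\<Gamma>\<close> act on \<open>\<real>\<close> by maps \<open>t \<mapsto> \<lambda> t + \<mu>\<close>. The leaf over \<open>t\<close> is compact iff the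
  orbit of \<open>t\<close> meets every bounded interval in a finite set. By a Brouwer argument \<open>\<Gamma>\<close> preserves no
  proper affine subspace, so the action on \<open>\<real>\<close> has no fixed point. If one orbit is locally finite,
  then there are no contractions, that is, all \<open>\<lambda>\<close> are \<open>\<plusminus>1\<close>, and the translations in the image form a
  lattice \<open>\<int> \<tau>\<close> with \<open>\<tau> > 0\<close>. Hence all orbits are locally finite, and the subgroup where \<open>\<lambda> = 1\<close>,
  of index at most two, defines a cover on which \<open>x \<mapsto> a \<bullet> x\<close> descends to the circle \<open>\<real> / \<int> \<tau>\<close>.
\<close>

section \<open>Coverings and lifts\<close>

text \<open>Irreducibility carries the argument on \<real>. If some level were fixed by \<Gamma>,
  its orbit would be a single point whatever the group does elsewhere, so a compact leaf there could
  not exclude a contraction towards it, under which all other orbits accumulate. A fixed level is an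
  invariant hyperplane, hence the detour through Brouwer's theorem. The index two comes from the
  elements with \<lambda> = -1: they reflect the leaf space, and the linear form does not descend
  past them to the circle. Compactness of a leaf refers to its intrinsic topology. It is therefore
  restated as cocompactness of the stabiliser of a hyperplane, which proper discontinuity and
  cocompactness of \<Gamma> exchange for local finiteness of an orbit. Two continuation principles
  recur: lifts of one map on a connected space agree if they agree at a point, and affine maps agree
  if they agree on a nonempty open set.\<close>

lemma unique_lift:
  assumes "connected_space S" "Hausdorff_space X"
    and f: "continuous_map S X f" and g: "continuous_map S X g"
    and D: "\<And>s. s \<in> topspace S \<Longrightarrow> D (f s) = D (g s)"
    and loc: "\<And>x. x \<in> topspace X \<Longrightarrow> \<exists>W. openin X W \<and> x \<in> W \<and> inj_on D W"
    and s0: "s0 \<in> topspace S" "f s0 = g s0"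
    and s: "s \<in> topspace S"
  shows "f s = g s"
proof -
  let ?E = "{s \<in> topspace S. f s = g s}"
  have "closedin S ?E"
    using assms by (intro closedin_continuous_maps_eq)
  \<comment> \<open>Where the two lifts agree, both stay nearby in one set on which \<open>D\<close>
    is injective, so they agree nearby as well.\<close>
  moreover have "openin S ?E"
  proof (subst openin_subopen, intro ballI)
    fix s assume s: "s \<in> ?E"
    then have "f s \<in> topspace X" using continuous_map_image_subset_topspace[OF f] by blast
    then obtain W where W: "openin X W" "f s \<in> W" "inj_on D W" using loc by blast
    let ?N = "{t \<in> topspace S. f t \<in> W} \<inter> {t \<in> topspace S. g t \<in> W}"
    have "openin S ?N"
      using f g W(1) by (intro openin_Int openin_continuous_map_preimage)
    moreover have "s \<in> ?N" using s W(2) by auto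
    moreover have "?N \<subseteq> ?E" using W(3) D unfolding inj_on_def by blast
    ultimately show "\<exists>N. openin S N \<and> s \<in> N \<and> N \<subseteq> ?E" by blast
  qed
  ultimately have "?E = {} \<or> ?E = topspace S"
    using assms(1) connected_space_clopen_in by blast
  then show ?thesis using s0 s by blast
qed

text \<open>Serves coverings and charts alike: it shrinks sheets, and with
  \<open>Y = euclidean\<close> it shrinks chart domains.\<close>

lemma homeomorphic_map_onto_open_image:
  assumes hom: "homeomorphic_map (subtopology X V) (subtopology Y T) p"
    and V: "openin X V" and T: "openin Y T" and V': "openin X V'" "V' \<subseteq> V"
  shows "openin Y (p ` V')"
    and "homeomorphic_map (subtopology X V') (subtopology Y (p ` V')) p"
proof -
  have VX: "V \<subseteq> topspace X" "T \<subseteq> topspace Y"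
    using V T by (auto simp: openin_subset)
  have imV: "p ` V = T"
    using homeomorphic_imp_surjective_map[OF hom] VX by (simp add: Int_absorb1)
  have "openin (subtopology X V) V'"
    using V V' by (simp add: openin_open_subtopology)
  then have "openin (subtopology Y T) (p ` V')"
    using homeomorphic_imp_open_map[OF hom] by (auto simp: open_map_def)
  then show "openin Y (p ` V')"
    using T by (simp add: openin_open_subtopology)
  have "homeomorphic_map (subtopology (subtopology X V) V') (subtopology (subtopology Y T) (p ` V')) p"
  proof (rule homeomorphic_map_subtopologies[OF hom])
    show "p ` (topspace (subtopology X V) \<inter> V') = topspace (subtopology Y T) \<inter> p ` V'"
      using V'(2) VX imV by auto
  qed
  moreover have "T \<inter> p ` V' = p ` V'" "V \<inter> V' = V'" using V'(2) imV by auto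
  ultimately show "homeomorphic_map (subtopology X V') (subtopology Y (p ` V')) p"
    by (simp add: subtopology_subtopology)
qed

lemma homeomorphic_map_inj:
  assumes "homeomorphic_map (subtopology X V) Y p" "openin X V"
  shows "inj_on p V"
  using homeomorphic_imp_injective_map[OF assms(1)] openin_subset[OF assms(2)]
  by (simp add: Int_absorb1)

lemma covering_map_evenly:
  assumes "covering_map X Y p" "x \<in> topspace X"
  obtains T V where "openin Y T" "p x \<in> T" "openin X V" "x \<in> V"
    "homeomorphic_map (subtopology X V) (subtopology Y T) p"
proof -
  have "p x \<in> topspace Y" using assms by (auto simp: covering_map_def)
  then obtain T \<V> where T: "p x \<in> T" "openin Y T" and
    V: "\<Union> \<V> = {x \<in> topspace X. p x \<in> T}" "\<forall>V \<in> \<V>. openin X V"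
       "\<forall>V \<in> \<V>. homeomorphic_map (subtopology X V) (subtopology Y T) p"
    using assms(1) unfolding covering_map_def by meson
  have "x \<in> \<Union> \<V>" using V(1) T assms by auto
  then show thesis using that T V by blast
qed

lemma covering_map_local_homeo:
  assumes "covering_map X Y p" "x \<in> topspace X"
  obtains V where "openin X V" "x \<in> V" "openin Y (p ` V)"
    "homeomorphic_map (subtopology X V) (subtopology Y (p ` V)) p"
proof -
  obtain T V where "openin Y T" "p x \<in> T" "openin X V" "x \<in> V"
    "homeomorphic_map (subtopology X V) (subtopology Y T) p"
    using covering_map_evenly[OF assms] by blast
  then show thesis
    using that homeomorphic_map_onto_open_image[of X V Y T p V] by blast
qed

lemma covering_map_open:
  assumes "covering_map X Y p"
  shows "open_map X Y p"
  unfolding open_map_def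
proof (intro allI impI)
  fix U assume U: "openin X U"
  show "openin Y (p ` U)"
  proof (subst openin_subopen, intro ballI)
    fix y assume "y \<in> p ` U"
    then obtain x where x: "x \<in> U" "y = p x" by blast
    then have "x \<in> topspace X" using U openin_subset by blast
    then obtain V where V: "openin X V" "x \<in> V" "openin Y (p ` V)"
      "homeomorphic_map (subtopology X V) (subtopology Y (p ` V)) p"
      using covering_map_local_homeo[OF assms] by blast
    have "openin Y (p ` (V \<inter> U))"
      using homeomorphic_map_onto_open_image(1)[OF V(4) V(1) V(3), of "V \<inter> U"] V(1) U by blast
    then show "\<exists>T. openin Y T \<and> y \<in> T \<and> T \<subseteq> p ` U"
      using x V(2) by (intro exI[of _ "p ` (V \<inter> U)"]) auto
  qed
qed

text \<open>Points over different base points are separated below. Two points of one fibre lie in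
  different sheets, as \<open>p\<close> is injective on each sheet, and sheets are disjoint.\<close>

lemma covering_map_Hausdorff:
  assumes cov: "covering_map X Y p" and "Hausdorff_space Y"
  shows "Hausdorff_space X"
  unfolding Hausdorff_space_def
proof (intro allI impI, elim conjE)
  fix x y assume x: "x \<in> topspace X" and y: "y \<in> topspace X" and "x \<noteq> y"
  have cont: "continuous_map X Y p" and im: "p ` topspace X = topspace Y"
    using cov by (auto simp: covering_map_def)
  show "\<exists>U V. openin X U \<and> openin X V \<and> x \<in> U \<and> y \<in> V \<and> disjnt U V"
  proof (cases "p x = p y")
    case False
    have "p x \<in> topspace Y" "p y \<in> topspace Y" using im x y by auto
    then obtain U V where "openin Y U" "openin Y V" "p x \<in> U" "p y \<in> V" "disjnt U V"
      using \<open>Hausdorff_space Y\<close> False unfolding Hausdorff_space_def by meson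
    then show ?thesis using x y cont
      by (intro exI[of _ "{z \<in> topspace X. p z \<in> U}"] exI[of _ "{z \<in> topspace X. p z \<in> V}"])
        (auto simp: disjnt_def intro: openin_continuous_map_preimage)
  next
    case True
    have "p x \<in> topspace Y" using im x by auto
    then obtain T \<V> where T: "p x \<in> T" "openin Y T" and
      V: "\<Union> \<V> = {x \<in> topspace X. p x \<in> T}" "\<forall>V \<in> \<V>. openin X V" "pairwise disjnt \<V>"
        "\<forall>V \<in> \<V>. homeomorphic_map (subtopology X V) (subtopology Y T) p"
      using cov unfolding covering_map_def by meson
    have "x \<in> \<Union> \<V>" "y \<in> \<Union> \<V>" using V(1) T x y True by auto
    then obtain V1 V2 where V12: "V1 \<in> \<V>" "V2 \<in> \<V>" "x \<in> V1" "y \<in> V2" by blast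
    have "V1 \<noteq> V2"
      using homeomorphic_map_inj[of X V1] V V12 True \<open>x \<noteq> y\<close> by (metis inj_onD)
    then show ?thesis using V V12 by (metis pairwiseD)
  qed
qed

text \<open>By bisection: being liftable passes to adjoining intervals and holds on short ones.
  \<open>P\<close> quantifies over all starting points above \<open>c s\<close>, so that the second
  piece can start where the first one ends.\<close>

lemma covering_map_lift_interval:
  fixes a b :: real
  assumes cov: "covering_map X Y p" and "a \<le> b"
    and c: "continuous_map (top_of_set {a..b}) Y c"
    and x: "x \<in> topspace X" "p x = c a"
  obtains k where "continuous_map (top_of_set {a..b}) X k" "k a = x"
    "\<And>t. t \<in> {a..b} \<Longrightarrow> p (k t) = c t"
proof -
  define P where "P s t \<longleftrightarrow> (a \<le> s \<and> s \<le> t \<and> t \<le> b \<longrightarrow>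
     (\<forall>x\<in>topspace X. p x = c s \<longrightarrow>
        (\<exists>k. continuous_map (top_of_set {s..t}) X k \<and> k s = x \<and> (\<forall>r\<in>{s..t}. p (k r) = c r))))"
    for s t
  have "P a b"
    using \<open>a \<le> b\<close>
  proof (induction rule: Bolzano)
    case (trans s t u)
    show ?case unfolding P_def
    proof (intro impI ballI)
      fix x assume st: "a \<le> s \<and> s \<le> u \<and> u \<le> b" and x: "x \<in> topspace X" "p x = c s"
      obtain k1 where k1: "continuous_map (top_of_set {s..t}) X k1" "k1 s = x"
        "\<forall>r\<in>{s..t}. p (k1 r) = c r"
        using trans x st unfolding P_def by force
      have "k1 t \<in> topspace X" "p (k1 t) = c t"
        using k1 trans by (auto simp: continuous_map_def Pi_iff)
      then obtain k2 where k2: "continuous_map (top_of_set {t..u}) X k2" "k2 t = k1 t"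
        "\<forall>r\<in>{t..u}. p (k2 r) = c r"
        using trans st unfolding P_def by force
      have "continuous_map (top_of_set {s..u}) X (\<lambda>r. if r \<le> t then k1 r else k2 r)"
      proof (rule continuous_map_cases_le)
        have "{s..u} \<inter> {x \<in> topspace (top_of_set {s..u}). x \<le> t} = {s..t}" 
          "{s..u} \<inter> {x \<in> topspace (top_of_set {s..u}). t \<le> x} = {t..u}"
          using trans by auto
        then show "continuous_map (subtopology (top_of_set {s..u})
           {x \<in> topspace (top_of_set {s..u}). x \<le> t}) X k1"
          and "continuous_map (subtopology (top_of_set {s..u})
           {x \<in> topspace (top_of_set {s..u}). t \<le> x}) X k2"
          using k1 k2 by (auto simp: subtopology_subtopology)
      qed (use k2 in auto)
      moreover have "(if s \<le> t then k1 s else k2 s) = x" using k1 trans by auto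
      moreover have "\<forall>r\<in>{s..u}. p (if r \<le> t then k1 r else k2 r) = c r"
        using k1 k2 by auto
      ultimately show "\<exists>k. continuous_map (top_of_set {s..u}) X k \<and> k s = x \<and>
          (\<forall>r\<in>{s..u}. p (k r) = c r)" by blast
    qed
  next
    \<comment> \<open>Near \<open>r0\<close> the curve stays in an evenly covered set, and the
      inverse of the sheet through the starting point lifts it.\<close>
    case (local r0)
    have "c r0 \<in> topspace Y" using c local by (auto simp: continuous_map_def Pi_iff)
    then obtain T \<V> where T: "c r0 \<in> T" "openin Y T" and
      V: "\<Union> \<V> = {x \<in> topspace X. p x \<in> T}" "\<forall>V \<in> \<V>. openin X V"
        "\<forall>V \<in> \<V>. homeomorphic_map (subtopology X V) (subtopology Y T) p"
      using cov unfolding covering_map_def by meson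
    have "openin (top_of_set {a..b}) {r \<in> {a..b}. c r \<in> T}"
      using openin_continuous_map_preimage[OF c T(2)] by simp
    moreover have "r0 \<in> {r \<in> {a..b}. c r \<in> T}" using local T(1) by auto
    ultimately obtain d where "d > 0"
      and d': "\<forall>r\<in>{a..b}. dist r r0 < d \<longrightarrow> r \<in> {r \<in> {a..b}. c r \<in> T}"
      unfolding openin_euclidean_subtopology_iff by blast
    then have d: "d > 0" "\<And>r. r \<in> {a..b} \<Longrightarrow> dist r r0 < d \<Longrightarrow> c r \<in> T" by auto
    have "P s t" if st: "s \<le> r0 \<and> r0 \<le> t \<and> t - s < d" for s t
      unfolding P_def
    proof (intro impI ballI)
      fix x assume s: "a \<le> s \<and> s \<le> t \<and> t \<le> b" and x: "x \<in> topspace X" "p x = c s"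
      have cT: "c r \<in> T" if "r \<in> {s..t}" for r
      proof (rule d)
        show "r \<in> {a..b}" using that s by auto
        show "dist r r0 < d" using that st unfolding dist_real_def abs_less_iff by auto
      qed
      have "x \<in> \<Union> \<V>" using x cT[of s] s V(1) by auto
      then obtain V where V': "x \<in> V" "openin X V" 
        "homeomorphic_map (subtopology X V) (subtopology Y T) p" using V by blast
      then obtain g where g: "homeomorphic_maps (subtopology X V) (subtopology Y T) p g"
        by (auto simp: homeomorphic_map_maps)
      have VX: "V \<subseteq> topspace X" "T \<subseteq> topspace Y" using V' T by (auto simp: openin_subset)
      have gp: "g (p z) = z" if "z \<in> V" for z
        using g that VX by (auto simp: homeomorphic_maps_def)
      have pg: "p (g z) = z" if "z \<in> T" for z
        using g that VX by (auto simp: homeomorphic_maps_def)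
      have "continuous_map (top_of_set {s..t}) (subtopology Y T) c"
        unfolding continuous_map_in_subtopology
      proof
        show "continuous_map (top_of_set {s..t}) Y c"
          by (rule continuous_map_from_subtopology_mono[OF c]) (use s in auto)
      qed (use cT in auto)
      moreover have "continuous_map (subtopology Y T) X g"
        using g by (auto simp: homeomorphic_maps_def intro: continuous_map_into_fulltopology)
      ultimately have "continuous_map (top_of_set {s..t}) X (g \<circ> c)"
        by (rule continuous_map_compose)
      then show "\<exists>k. continuous_map (top_of_set {s..t}) X k \<and> k s = x \<and> (\<forall>r\<in>{s..t}. p (k r) = c r)"
        using gp[OF V'(1)] x(2) pg cT by (intro exI[of _ "g \<circ> c"]) auto
    qed
    then show ?case using d(1) by blast
  qed
  then show thesis using that assms x unfolding P_def by auto
qed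

text \<open>The definition compares any two loops, with no common base point. Applied to two
  constant loops it yields a homotopy, and the track of a single parameter under it is a path
  between the two points.\<close>

lemma simply_connected_imp_connected_space:
  assumes "simply_connected_space X"
  shows "connected_space X"
proof -
  have "path_component_of X x y" if "x \<in> topspace X" "y \<in> topspace X" for x y
  proof -
    have "homotopic_with (\<lambda>r. r 1 = r 0) (top_of_set {0..1::real}) X (\<lambda>_. x) (\<lambda>_. y)"
      using assms that unfolding simply_connected_space_def
      by (elim allE[of _ "\<lambda>_. x"] allE[of _ "\<lambda>_. y"]) (auto simp: pathin_def)
    then obtain H :: "real \<times> real \<Rightarrow> 'a" where
      H: "continuous_map (prod_topology (top_of_set {0..1}) (top_of_set {0..1})) X H"
      "\<And>t. H (0, t) = x" "\<And>t. H (1, t) = y"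
      unfolding homotopic_with_def by auto
    have "pathin X (H \<circ> (\<lambda>s. (s, 0)))"
      unfolding pathin_def
      by (rule continuous_map_compose[OF _ H(1)]) (auto simp: continuous_map_in_subtopology continuous_map_pairwise o_def intro!: continuous_intros)
    then show ?thesis
      unfolding path_component_of_def using H by fastforce
  qed
  then show ?thesis
    by (intro path_connected_imp_connected_space) (simp add: path_connected_space_iff_path_component)
qed

section \<open>Affine maps and developing maps\<close>

lemma affine_fun_compose:
  assumes "affine_fun f" "affine_fun g"
  shows "affine_fun (\<lambda>x. f (g x))"
proof -
  obtain l b m c where "linear l" "f = (\<lambda>x. l x + b)" "linear m" "g = (\<lambda>x. m x + c)"
    using assms unfolding affine_fun_def by auto
  then have "linear (l \<circ> m)" "(\<lambda>x. f (g x)) = (\<lambda>x. (l \<circ> m) x + (l c + b))"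
    by (auto simp: linear_compose linear_add add.assoc)
  then show ?thesis unfolding affine_fun_def by blast
qed

lemma affine_fun_ident [simp]: "affine_fun (\<lambda>x. x)"
  unfolding affine_fun_def by (intro exI[of _ "\<lambda>x. x"] exI[of _ 0]) (auto simp: linear_id[unfolded id_def])

lemma affine_fun_line: "affine_fun (\<lambda>t::real. a + t *\<^sub>R v)"
  unfolding affine_fun_def
  by (intro exI[of _ "\<lambda>t. t *\<^sub>R v"] exI[of _ a]) (auto intro!: linearI simp: algebra_simps)

lemma linear_linear_part:
  assumes "affine_fun g"
  shows "linear (linear_part g)"
  using assms unfolding affine_fun_def linear_part_def by (auto simp: linear_0)

lemma affine_fun_eq: "g x = linear_part g x + g 0"
  by (simp add: linear_part_def)

lemma affine_fun_add:
  assumes "affine_fun g"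
  shows "g (x + y) = g x + linear_part g y"
  using linear_add[OF linear_linear_part[OF assms], of x y]
  by (simp add: linear_part_def algebra_simps)

lemma affine_fun_diff:
  assumes "affine_fun g"
  shows "g x - g y = linear_part g (x - y)"
  using affine_fun_add[OF assms, of y "x - y"] by simp

lemma affine_fun_imp_continuous_on:
  assumes "affine_fun g"
  shows "continuous_on S g"
proof -
  obtain l b where l: "linear l" "g = (\<lambda>x. l x + b)"
    using assms(1) unfolding affine_fun_def by auto
  have "continuous_on S l"
    using l(1) by (rule linear_continuous_on[OF linear_conv_bounded_linear[THEN iffD1]])
  then show ?thesis unfolding l(2) by (intro continuous_intros)
qed

lemma affine_fun_inv:
  assumes "affine_fun g" "bij g"
  shows "affine_fun (inv g)"
proof -
  let ?l = "linear_part g"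
  have lin: "linear ?l" using assms(1) by (rule linear_linear_part)
  have g: "g x = ?l x + g 0" for x by (rule affine_fun_eq)
  have bl: "bij ?l"
    unfolding bij_def inj_def surj_def
  proof (intro conjI allI impI)
    fix x y assume "?l x = ?l y"
    then show "x = y" using assms(2) g by (metis bij_is_inj injD)
  next
    fix y
    obtain x where "g x = y + g 0" using assms(2) by (metis bij_is_surj surjD)
    then show "\<exists>x. y = ?l x" using g[of x] by auto
  qed
  have li: "linear (inv ?l)"
    by (rule linearI; rule bij_is_inj[OF bl, THEN injD])
      (simp_all add: linear_add[OF lin] linear_scale[OF lin] surj_f_inv_f[OF bij_is_surj[OF bl]])
  have inv: "inv g y = inv ?l y + (- inv ?l (g 0))" for y
  proof -
    have "g (inv ?l (y - g 0)) = y" using g[of "inv ?l (y - g 0)"] bl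
      by (simp add: bij_is_surj surj_f_inv_f)
    then have "inv g y = inv ?l (y - g 0)" using assms(2) by (metis bij_inv_eq_iff)
    then show ?thesis using li by (simp add: linear_diff)
  qed
  show ?thesis unfolding affine_fun_def using li inv by blast
qed

text \<open>The identity principle for affine maps: the direction \<open>x - a\<close> can be scaled
  into a ball inside \<open>S\<close>, where the linear parts are compared.\<close>

lemma affine_fun_eq_on_open:
  assumes f: "affine_fun f" and g: "affine_fun g" and "open S" "S \<noteq> {}"
    and eq: "\<And>x. x \<in> S \<Longrightarrow> f x = g x"
  shows "f = g"
proof
  fix x
  obtain a where a: "a \<in> S" using assms by blast
  obtain e where e: "e > 0" "ball a e \<subseteq> S" using \<open>open S\<close> a openE by blast
  have lin: "linear (linear_part f)" "linear (linear_part g)"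
    using f g by (auto intro: linear_linear_part)
  \<comment> \<open>The summand 1 keeps the scale positive when \<open>x = a\<close> and the scaled
    vector strictly shorter than \<open>e\<close>.\<close>
  define c where "c = e / (norm (x - a) + 1)"
  have c: "c > 0" using e by (auto simp: c_def add_nonneg_pos)
  have "norm (c *\<^sub>R (x - a)) < e"
  proof -
    have n: "norm (x - a) + 1 > 0" by (simp add: add_nonneg_pos)
    have "norm (c *\<^sub>R (x - a)) = c * norm (x - a)" using c by simp
    also have "\<dots> < c * (norm (x - a) + 1)"
      by (rule mult_strict_left_mono) (use n c in auto)
    also have "\<dots> = e" using n unfolding c_def by simp
    finally show ?thesis .
  qed
  then have "a + c *\<^sub>R (x - a) \<in> S" using e by (auto simp: dist_norm subset_iff)
  then have "f (a + c *\<^sub>R (x - a)) = g (a + c *\<^sub>R (x - a))" "f a = g a"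
    using eq a by auto
  then have "linear_part f (c *\<^sub>R (x - a)) = linear_part g (c *\<^sub>R (x - a))"
    by (simp add: affine_fun_add[OF f] affine_fun_add[OF g])
  then have "linear_part f (x - a) = linear_part g (x - a)"
    using c by (simp add: linear_scale[OF lin(1)] linear_scale[OF lin(2)])
  then show "f x = g x"
    using affine_fun_add[OF f, of a "x - a"] affine_fun_add[OF g, of a "x - a"] \<open>f a = g a\<close>
    by simp
qed

text \<open>A nonzero kernel vector of the linear part could be scaled until it moves a point within
  \<open>S\<close>, against injectivity. Between spaces of equal dimension an injective linear map
  is onto.\<close>

lemma affine_fun_bij_if_inj_on_open:
  fixes g :: "'e::euclidean_space \<Rightarrow> 'e"
  assumes g: "affine_fun g" and "open S" "S \<noteq> {}" and inj: "inj_on g S"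
  shows "bij g"
proof -
  let ?l = "linear_part g"
  have lin: "linear ?l" using g by (rule linear_linear_part)
  obtain a where a: "a \<in> S" using assms by blast
  obtain e where e: "e > 0" "ball a e \<subseteq> S" using \<open>open S\<close> a openE by blast
  have inj_l: "inj ?l"
    unfolding linear_injective_0[OF lin]
  proof (intro allI impI)
    fix v assume v: "?l v = 0"
    show "v = 0"
    proof (rule ccontr)
      assume "v \<noteq> 0"
      define c where "c = e / (2 * norm v)"
      have c: "c > 0" "norm (c *\<^sub>R v) < e" using e \<open>v \<noteq> 0\<close> by (auto simp: c_def)
      then have "a + c *\<^sub>R v \<in> S" using e by (auto simp: dist_norm subset_iff)
      moreover have "g (a + c *\<^sub>R v) = g a"
        by (simp add: affine_fun_add[OF g] linear_scale[OF lin] v)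
      ultimately have "a + c *\<^sub>R v = a" using inj a by (meson inj_onD)
      then show False using c \<open>v \<noteq> 0\<close> by simp
    qed
  qed
  then have "surj ?l" using lin by (simp add: linear_injective_imp_surjective)
  have eq: "g x = ?l x + g 0" for x by (rule affine_fun_eq)
  show ?thesis unfolding bij_def
  proof
    show "inj g" using inj_l unfolding inj_def by (metis eq add_right_cancel)
    show "surj g" unfolding surj_def
    proof
      fix y
      obtain x where "?l x = y - g 0" using \<open>surj ?l\<close> by (metis surjD)
      then show "\<exists>x. y = g x" by (metis eq diff_add_cancel)
    qed
  qed
qed

section \<open>Local expressions in charts\<close>

lemma affine_mapD:
  assumes "affine_map M A N B f" "(V, \<phi>) \<in> A" "(W, \<psi>) \<in> B" "x \<in> V" "f x \<in> W"
  shows "\<exists>N' g. openin M N' \<and> x \<in> N' \<and> N' \<subseteq> V \<and> f ` N' \<subseteq> W \<and> affine_fun g \<and>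
                (\<forall>z \<in> N'. \<psi> (f z) = g (\<phi> z))"
  using assms unfolding affine_map_def by blast

lemma affine_atlasD:
  assumes "affine_atlas M A" "(V, \<phi>) \<in> A"
  shows "openin M V" "open (\<phi> ` V)" "homeomorphic_map (subtopology M V) (top_of_set (\<phi> ` V)) \<phi>"
    "inj_on \<phi> V" "\<And>S. openin M S \<Longrightarrow> S \<subseteq> V \<Longrightarrow> open (\<phi> ` S)"
proof -
  show *: "openin M V" "open (\<phi> ` V)" "homeomorphic_map (subtopology M V) (top_of_set (\<phi> ` V)) \<phi>"
    using assms unfolding affine_atlas_def by auto
  show "inj_on \<phi> V" using homeomorphic_map_inj * by blast
  show "open (\<phi> ` S)" if "openin M S" "S \<subseteq> V" for S
    using homeomorphic_map_onto_open_image(1)[of M V euclidean "\<phi> ` V" \<phi> S] * that by simp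
qed

lemma affine_atlas_chart:
  assumes "affine_atlas M A" "x \<in> topspace M"
  obtains V \<phi> where "(V, \<phi>) \<in> A" "x \<in> V"
proof -
  have "x \<in> \<Union> (fst ` A)" using assms unfolding affine_atlas_def by blast
  then show thesis using that by auto
qed

lemma developing_map_local_homeo:
  assumes "developing_map X B D" "x \<in> topspace X"
  obtains W where "openin X W" "x \<in> W" "open (D ` W)"
    "homeomorphic_map (subtopology X W) (top_of_set (D ` W)) D" "inj_on D W"
proof -
  obtain W where "openin X W" "x \<in> W" "open (D ` W)"
    "homeomorphic_map (subtopology X W) (top_of_set (D ` W)) D"
    using assms unfolding developing_map_def by meson
  moreover have "inj_on D W" using calculation homeomorphic_map_inj by blast
  ultimately show thesis using that by blast
qed

text \<open>A chart of the pulled-back atlas must live on an open set that \<open>p\<close> maps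
  homeomorphically onto an open set, so a sheet around \<open>x\<close> is cut down to its part over
  \<open>V\<close>.\<close>

lemma covering_map_pullback_chart:
  assumes at: "affine_atlas M A" and cov: "covering_map X M p"
    and x: "x \<in> topspace X" and V: "(V, \<phi>) \<in> A" "p x \<in> V"
  obtains V' where "(V', \<lambda>z. \<phi> (p z)) \<in> pullback_atlas X M p A" "openin X V'" "x \<in> V'"
    "p ` V' \<subseteq> V" "inj_on p V'"
proof -
  have pc: "continuous_map X M p" using cov by (auto simp: covering_map_def)
  obtain V1 where V1: "openin X V1" "x \<in> V1" "openin M (p ` V1)"
    "homeomorphic_map (subtopology X V1) (subtopology M (p ` V1)) p"
    using covering_map_local_homeo[OF cov x] by blast
  define V' where "V' = V1 \<inter> {z \<in> topspace X. p z \<in> V}"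
  have V'o: "openin X V'"
    unfolding V'_def using V1(1) pc affine_atlasD(1)[OF at V(1)]
    by (intro openin_Int openin_continuous_map_preimage)
  have xV': "x \<in> V'" using V1 x V by (auto simp: V'_def)
  note h = homeomorphic_map_onto_open_image[OF V1(4) V1(1) V1(3) V'o]
  have V'1: "V' \<subseteq> V1" "p ` V' \<subseteq> V" by (auto simp: V'_def)
  have "(V', \<lambda>z. \<phi> (p z)) \<in> pullback_atlas X M p A"
    unfolding pullback_atlas_def using V(1) V'o h V'1 by blast
  then show thesis
    using that[of V'] V'o xV' V'1(2) homeomorphic_map_inj[OF h(2)[OF V'1(1)] V'o] by blast
qed

text \<open>Affinity of \<open>D\<close> expresses \<open>D\<close> through the chart; here the
  relation is inverted. This is possible because \<open>D\<close> is injective near \<open>x\<close>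
  and the chart image is open, which makes the affine expression bijective.\<close>

lemma developing_map_in_chart:
  assumes at: "affine_atlas M A" and cov: "covering_map Mh M p"
    and dev: "developing_map Mh (pullback_atlas Mh M p A) D"
    and x: "x \<in> topspace Mh" and V: "(V, \<phi>) \<in> A" "p x \<in> V"
  obtains N g where "openin Mh N" "x \<in> N" "p ` N \<subseteq> V" "affine_fun g" "bij g"
    "\<And>z. z \<in> N \<Longrightarrow> \<phi> (p z) = g (D z)"
proof -
  note ch = affine_atlasD[OF at V(1)]
  obtain V' where "(V', \<lambda>z. \<phi> (p z)) \<in> pullback_atlas Mh M p A" "openin Mh V'" and xV': "x \<in> V'"
    and V'1: "p ` V' \<subseteq> V" and "inj_on p V'"
    by (rule covering_map_pullback_chart[OF at cov x V])
  then have "\<exists>N' g. openin Mh N' \<and> x \<in> N' \<and> N' \<subseteq> V' \<and> D ` N' \<subseteq> UNIV \<and> affine_fun g \<and>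
     (\<forall>z\<in>N'. D z = g (\<phi> (p z)))"
    using affine_mapD[of Mh "pullback_atlas Mh M p A" euclidean "standard_atlas UNIV" D
        V' "\<lambda>z. \<phi> (p z)" UNIV "\<lambda>z. z" x] dev xV'
    by (simp add: developing_map_def standard_atlas_def)
  then obtain N' g where N': "openin Mh N'" "x \<in> N'" "N' \<subseteq> V'" "affine_fun g"
    "\<And>z. z \<in> N' \<Longrightarrow> D z = g (\<phi> (p z))" by blast
  obtain W where W: "openin Mh W" "x \<in> W" "inj_on D W"
    using developing_map_local_homeo[OF dev x] by blast
  define N where "N = N' \<inter> W"
  have N: "openin Mh N" "x \<in> N" "N \<subseteq> V'" using N' W by (auto simp: N_def)
  have "openin M (p ` N)"
    using covering_map_open[OF cov] N(1) by (auto simp: open_map_def)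
  then have o: "open (\<phi> ` p ` N)" using ch(5) N(3) V'1 by blast
  have "inj_on g (\<phi> ` p ` N)"
  proof (rule inj_onI)
    fix a b assume "a \<in> \<phi> ` p ` N" "b \<in> \<phi> ` p ` N" and g: "g a = g b"
    then obtain z w where zw: "z \<in> N" "w \<in> N" "a = \<phi> (p z)" "b = \<phi> (p w)" by auto
    then have "D z = D w" using N'(5) g by (auto simp: N_def)
    then have "z = w" using W(3) zw by (auto simp: N_def inj_on_def)
    then show "a = b" using zw by simp
  qed
  then have bg: "bij g"
    using affine_fun_bij_if_inj_on_open[OF N'(4) o] N(2) by blast
  show thesis
  proof (rule that[of N "inv g"])
    show "p ` N \<subseteq> V" using N V'1 by auto
    show "affine_fun (inv g)" "bij (inv g)" using bg N'(4) by (auto intro: affine_fun_inv bij_imp_bij_inv)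
    show "\<phi> (p z) = inv g (D z)" if "z \<in> N" for z
      using N'(5)[of z] that bg by (simp add: N_def bij_is_inj inv_f_f)
  qed (use N in auto)
qed

text \<open>A local inverse of \<open>D\<close> at \<open>x\<close> carries the beginning of the
  straight line to a curve whose projection is a geodesic of \<open>M\<close>. Completeness prolongs
  this geodesic, the covering lifts it from \<open>x\<close>, and the lift must develop onto the
  whole segment, since it stays locally affine and starts along the line.\<close>

lemma geodesic_lift:
  fixes D :: "'b \<Rightarrow> 'e::euclidean_space"
  assumes at: "affine_atlas M A" and compl: "geodesically_complete M A"
    and cov: "covering_map Mh M p"
    and dev: "developing_map Mh (pullback_atlas Mh M p A) D"
    and x: "x \<in> topspace Mh"
  obtains k where "continuous_map (top_of_set {0..1::real}) Mh k" "k 0 = x"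
    "\<And>t. t \<in> {0..1} \<Longrightarrow> D (k t) = D x + t *\<^sub>R w"
proof -
  have pc: "continuous_map Mh M p" and pim: "p ` topspace Mh = topspace M"
    using cov by (auto simp: covering_map_def)
  obtain W where W: "openin Mh W" "x \<in> W" "open (D ` W)"
    "homeomorphic_map (subtopology Mh W) (top_of_set (D ` W)) D" "inj_on D W"
    using developing_map_local_homeo[OF dev x] by blast
  have WM: "W \<subseteq> topspace Mh" using W(1) openin_subset by blast
  obtain \<sigma> where \<sigma>: "homeomorphic_maps (subtopology Mh W) (top_of_set (D ` W)) D \<sigma>"
    using W(4) homeomorphic_map_maps by blast
  have \<sigma>D: "\<sigma> (D z) = z" if "z \<in> W" for z
    using \<sigma> that WM by (auto simp: homeomorphic_maps_def)
  have \<sigma>c: "continuous_map (top_of_set (D ` W)) Mh \<sigma>"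
    using \<sigma> by (auto simp: homeomorphic_maps_def intro: continuous_map_into_fulltopology)
  let ?\<gamma> = "\<lambda>t::real. D x + t *\<^sub>R w"
  have "open (?\<gamma> -` (D ` W))"
    using W(3) by (intro open_vimage continuous_intros)
  moreover have "0 \<in> ?\<gamma> -` (D ` W)" using W(2) by auto
  ultimately obtain \<epsilon> where \<epsilon>: "\<epsilon> > 0" "ball 0 \<epsilon> \<subseteq> ?\<gamma> -` (D ` W)"
    using openE by blast
  define I where "I = ball (0::real) \<epsilon>"
  define c0 where "c0 t = p (\<sigma> (?\<gamma> t))" for t
  have \<gamma>c: "continuous_map (top_of_set I) (top_of_set (D ` W)) ?\<gamma>"
    unfolding continuous_map_in_subtopology
  proof
    show "continuous_map (top_of_set I) euclidean ?\<gamma>" 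
      by (simp, intro continuous_intros)
  qed (use \<epsilon>(2) in \<open>auto simp: I_def\<close>)
  have \<sigma>\<gamma>: "continuous_map (top_of_set I) Mh (\<lambda>t. \<sigma> (?\<gamma> t))"
    using continuous_map_compose[OF \<gamma>c \<sigma>c] by (simp add: o_def)
  have \<sigma>W: "\<sigma> (?\<gamma> t) \<in> W" "D (\<sigma> (?\<gamma> t)) = ?\<gamma> t" if "t \<in> I" for t
    using \<epsilon>(2) that \<sigma>D by (force simp: I_def)+
  have "geodesic_on M A I c0"
    unfolding geodesic_on_def affine_map_def
  proof (intro conjI)
    show "continuous_map (top_of_set I) M c0"
      using continuous_map_compose[OF \<sigma>\<gamma> pc] by (simp add: o_def c0_def[abs_def])
    show "\<forall>(V, \<phi>)\<in>standard_atlas I. \<forall>(W, \<psi>)\<in>A. \<forall>x\<in>V. c0 x \<in> W \<longrightarrow>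
      (\<exists>N' g. openin (top_of_set I) N' \<and> x \<in> N' \<and> N' \<subseteq> V \<and> c0 ` N' \<subseteq> W \<and> affine_fun g \<and>
        (\<forall>z\<in>N'. \<psi> (c0 z) = g (\<phi> z)))"
      unfolding standard_atlas_def
    proof (clarsimp)
      fix V \<psi> t assume V: "(V, \<psi>) \<in> A" and t: "t \<in> I" "c0 t \<in> V"
      have "\<sigma> (?\<gamma> t) \<in> topspace Mh" using \<sigma>W(1) t(1) WM by blast
      moreover have "p (\<sigma> (?\<gamma> t)) \<in> V" using t by (simp add: c0_def)
      ultimately obtain N g where N: "openin Mh N" "\<sigma> (?\<gamma> t) \<in> N" "p ` N \<subseteq> V" "affine_fun g" "bij g"
        "\<And>z. z \<in> N \<Longrightarrow> \<psi> (p z) = g (D z)"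
        using developing_map_in_chart[OF at cov dev _ V] by metis
      have "openin (top_of_set I) {s \<in> I. \<sigma> (?\<gamma> s) \<in> N}"
        using openin_continuous_map_preimage[OF \<sigma>\<gamma> N(1)] by simp
      moreover have "affine_fun (\<lambda>s. g (?\<gamma> s))"
        using N(4) affine_fun_line by (rule affine_fun_compose)
      ultimately show "\<exists>N'. openin (top_of_set I) N' \<and> t \<in> N' \<and> N' \<subseteq> I \<and> c0 ` N' \<subseteq> V \<and>
          (\<exists>g. affine_fun g \<and> (\<forall>z\<in>N'. \<psi> (c0 z) = g z))"
        using t N \<sigma>W by (intro exI[of _ "{s \<in> I. \<sigma> (?\<gamma> s) \<in> N}"] conjI exI[of _ "\<lambda>s. g (?\<gamma> s)"])
          (auto simp: c0_def)
    qed
  qed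
  moreover have "open I" "is_interval I" "I \<noteq> {}"
    using \<epsilon> by (auto simp: I_def is_interval_ball_real)
  ultimately obtain c' where c': "geodesic_on M A UNIV c'" "\<And>t. t \<in> I \<Longrightarrow> c' t = c0 t"
    using compl unfolding geodesically_complete_def by meson
  have c'c: "continuous_map euclidean M c'"
    using c'(1) by (simp add: geodesic_on_def affine_map_def)
  have 0: "0 \<in> I" using \<epsilon> by (simp add: I_def)
  have "c' 0 = p x" using c'(2)[OF 0] \<sigma>D[OF W(2)] by (simp add: c0_def)
  moreover have "continuous_map (top_of_set {0..1}) M c'"
    using c'c continuous_map_from_subtopology by blast
  ultimately obtain k where k: "continuous_map (top_of_set {0..1}) Mh k" "k 0 = x"
    "\<And>t. t \<in> {0..1} \<Longrightarrow> p (k t) = c' t"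
    using covering_map_lift_interval[OF cov zero_le_one _ x, of c'] by metis
  have kM: "k t \<in> topspace Mh" if "t \<in> {0..1}" for t
    using k(1) that by (auto simp: continuous_map_def Pi_iff)
  \<comment> \<open>Equality is demanded on a neighbourhood of \<open>t\<close>, because the
    identity principle needs an open set to continue from.\<close>
  define P where "P t \<longleftrightarrow> (\<exists>T. open T \<and> t \<in> T \<and> (\<forall>s\<in>T \<inter> {0..1}. D (k s) = ?\<gamma> s))" for t
  have "P t" if t: "t \<in> {0..1}" for t
  proof (rule connected_induction_simple[where S = "{0..1::real}" and a = 0 and P = P])
    show "P 0"
    proof -
      \<comment> \<open>Near 0 both \<open>k\<close> and the local inverse of \<open>D\<close> along
        the line lift the same curve into the sheet \<open>V1\<close>, so they coincide.\<close>
      obtain V1 where V1: "openin Mh V1" "x \<in> V1" 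
        "homeomorphic_map (subtopology Mh V1) (subtopology M (p ` V1)) p"
        using covering_map_local_homeo[OF cov x] by blast
      have inj: "inj_on p V1" using homeomorphic_map_inj[OF V1(3) V1(1)] .
      obtain T1 where T1: "open T1" "{s \<in> I. \<sigma> (?\<gamma> s) \<in> V1} = I \<inter> T1"
        using openin_continuous_map_preimage[OF \<sigma>\<gamma> V1(1)] by (auto simp: openin_open)
      obtain T2 where T2: "open T2" "{s \<in> {0..1}. k s \<in> V1} = {0..1} \<inter> T2"
        using openin_continuous_map_preimage[OF k(1) V1(1)] by (auto simp: openin_open)
      have "D (k s) = ?\<gamma> s" if s: "s \<in> I \<inter> T1 \<inter> T2 \<inter> {0..1}" for s
      proof -
        have "\<sigma> (?\<gamma> s) \<in> V1" "k s \<in> V1" using T1(2) T2(2) s by blast+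
        moreover have "p (k s) = p (\<sigma> (?\<gamma> s))" using s k(3) c'(2) by (simp add: c0_def)
        ultimately have "k s = \<sigma> (?\<gamma> s)" using inj by (auto dest: inj_onD)
        then show ?thesis using \<sigma>W s by auto
      qed
      moreover have "0 \<in> {s \<in> I. \<sigma> (?\<gamma> s) \<in> V1}" using 0 \<sigma>D[OF W(2)] V1(2) by simp
      then have "0 \<in> I \<inter> T1" unfolding T1(2) .
      moreover have "0 \<in> {s \<in> {0..1}. k s \<in> V1}" using k(2) V1(2) by simp
      then have "0 \<in> T2" unfolding T2(2) by simp
      moreover have "open (I \<inter> T1 \<inter> T2)" using T1 T2 by (auto simp: I_def)
      ultimately show "P 0" unfolding P_def by (intro exI[of _ "I \<inter> T1 \<inter> T2"]) auto
    qed
  next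
    fix a :: real assume a: "a \<in> {0..1}"
    have "c' a \<in> topspace M" using kM[OF a] k(3)[OF a] pim by (metis imageI)
    then obtain V \<phi> where V: "(V, \<phi>) \<in> A" "c' a \<in> V"
      using affine_atlas_chart[OF at] by blast
    obtain N g where N: "openin Mh N" "k a \<in> N" "p ` N \<subseteq> V" "affine_fun g" "bij g"
        "\<And>z. z \<in> N \<Longrightarrow> \<phi> (p z) = g (D z)"
      using developing_map_in_chart[OF at cov dev kM[OF a] V(1)] k(3)[OF a] V(2) by metis
    have "\<exists>N' l. open N' \<and> a \<in> N' \<and> N' \<subseteq> UNIV \<and> c' ` N' \<subseteq> V \<and> affine_fun l \<and>
        (\<forall>s\<in>N'. \<phi> (c' s) = l s)"
      using affine_mapD[of "top_of_set UNIV" "standard_atlas UNIV" M A c' UNIV "\<lambda>s. s" V \<phi> a] c'(1) V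
      by (simp add: geodesic_on_def standard_atlas_def)
    then obtain N' l where N': "open N'" "a \<in> N'" "affine_fun l" "\<And>s. s \<in> N' \<Longrightarrow> \<phi> (c' s) = l s"
      by blast
    obtain T2 where T2: "open T2" "{s \<in> {0..1}. k s \<in> N} = {0..1} \<inter> T2"
      using openin_continuous_map_preimage[OF k(1) N(1)] by (auto simp: openin_open)
    let ?l = "\<lambda>s. inv g (l s)"
    have al: "affine_fun ?l"
      using affine_fun_inv[OF N(4,5)] N'(3) by (rule affine_fun_compose)
    have eq: "D (k s) = ?l s" if "s \<in> N' \<inter> T2 \<inter> {0..1}" for s
    proof -
      have "k s \<in> N" using that T2(2) by blast
      then have "g (D (k s)) = l s" using N(6)[of "k s"] N'(4)[of s] k(3)[of s] that by auto
      then show ?thesis using N(5) by (metis bij_inv_eq_iff)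
    qed
    have "a \<in> {s \<in> {0..1}. k s \<in> N}" using N(2) a by simp
    then have aT: "a \<in> T2" unfolding T2(2) by simp
    show "\<exists>T. openin (top_of_set {0..1}) T \<and> a \<in> T \<and> (\<forall>x\<in>T. \<forall>y\<in>T. P x \<longrightarrow> P y)"
    proof (intro exI[of _ "{0..1} \<inter> (N' \<inter> T2)"] conjI ballI impI)
      show "openin (top_of_set {0..1}) ({0..1} \<inter> (N' \<inter> T2))"
        using N' T2 by (intro openin_open_Int open_Int)
      show "a \<in> {0..1} \<inter> (N' \<inter> T2)" using a aT N' by auto
      fix u v assume u: "u \<in> {0..1} \<inter> (N' \<inter> T2)" and v: "v \<in> {0..1} \<inter> (N' \<inter> T2)" and "P u"
      then obtain T where T: "open T" "u \<in> T" "\<And>s. s \<in> T \<inter> {0..1} \<Longrightarrow> D (k s) = ?\<gamma> s"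
        unfolding P_def by blast
      have "open (T \<inter> N' \<inter> T2)" using T N' T2 by auto
      \<comment> \<open>At an endpoint \<open>u\<close> of the interval equality is known on one
        side only; meeting the open interval provides an open set for the identity
        principle.\<close>
      moreover have "u \<in> closure {0<..<1}" using u by simp
      ultimately have "T \<inter> N' \<inter> T2 \<inter> {0<..<1} \<noteq> {}"
        using T(2) u open_Int_closure_eq_empty[of "T \<inter> N' \<inter> T2" "{0<..<1}"] by blast
      have "?l = ?\<gamma>"
      proof (rule affine_fun_eq_on_open[OF al affine_fun_line])
        show "open (T \<inter> N' \<inter> T2 \<inter> {0<..<1})" using T(1) N'(1) T2(1) by (intro open_Int) auto
        show "T \<inter> N' \<inter> T2 \<inter> {0<..<1} \<noteq> {}" by fact
        fix s assume s: "s \<in> T \<inter> N' \<inter> T2 \<inter> {0<..<1}"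
        then have "s \<in> N' \<inter> T2 \<inter> {0..1}" "s \<in> T \<inter> {0..1}" by auto
        then show "?l s = ?\<gamma> s" using eq T(3) by metis
      qed
      then have "\<forall>s\<in>(N' \<inter> T2) \<inter> {0..1}. D (k s) = ?\<gamma> s" using eq by metis
      then show "P v" unfolding P_def using v N' T2 by (intro exI[of _ "N' \<inter> T2"]) auto
    qed
  qed (use t in auto)
  then have "D (k t) = ?\<gamma> t" if "t \<in> {0..1}" for t
    using that unfolding P_def by blast
  then show thesis using that k by blast
qed

section \<open>The developing map of a complete manifold\<close>

text \<open>The tube is the Minkowski sum of a segment and a ball.\<close>

lemma convex_tube:
  fixes a w :: "'e::real_normed_vector"
  shows "convex (\<Union>t\<in>{s..u::real}. ball (a + t *\<^sub>R w) \<delta>)"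
proof -
  have "(\<Union>t\<in>{s..u}. ball (a + t *\<^sub>R w) \<delta>) = (\<Union>x\<in>(\<lambda>t. a + t *\<^sub>R w) ` {s..u}. \<Union>y\<in>ball 0 \<delta>. {x + y})"
  proof (intro equalityI subsetI)
    fix y assume "y \<in> (\<Union>t\<in>{s..u}. ball (a + t *\<^sub>R w) \<delta>)"
    then obtain t where "t \<in> {s..u}" "dist (a + t *\<^sub>R w) y < \<delta>" by auto
    then show "y \<in> (\<Union>x\<in>(\<lambda>t. a + t *\<^sub>R w) ` {s..u}. \<Union>y\<in>ball 0 \<delta>. {x + y})"
      by (auto intro!: bexI[of _ t] bexI[of _ "y - (a + t *\<^sub>R w)"] simp: dist_norm norm_minus_commute)
  next
    fix z assume "z \<in> (\<Union>x\<in>(\<lambda>t. a + t *\<^sub>R w) ` {s..u}. \<Union>y\<in>ball 0 \<delta>. {x + y})"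
    then obtain t y where "t \<in> {s..u}" "norm y < \<delta>" "z = a + t *\<^sub>R w + y" by auto
    then show "z \<in> (\<Union>t\<in>{s..u}. ball (a + t *\<^sub>R w) \<delta>)"
      by (auto intro!: bexI[of _ t] simp: dist_norm)
  qed
  moreover have "convex ((\<lambda>t. a + t *\<^sub>R w) ` {s..u})"
  proof -
    have "(\<lambda>t. a + t *\<^sub>R w) ` {s..u} = (+) a ` (\<lambda>t. t *\<^sub>R w) ` {s..u}" by (simp add: image_image)
    moreover have "linear (\<lambda>t::real. t *\<^sub>R w)" by (auto intro!: linearI simp: algebra_simps)
    ultimately show ?thesis using convex_real_interval(5)[of s u]
      by (simp only: convex_translation_eq convex_linear_image)
  qed
  ultimately show ?thesis
    using convex_sums[OF _ convex_ball, of "(\<lambda>t. a + t *\<^sub>R w) ` {s..u}" 0 \<delta>] by simp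
qed

text \<open>Bisection again, now for sections of \<open>D\<close> over tubes around a piece of the
  segment. Two tubes that share a point of the segment meet in a convex, hence connected set, on
  which the sections agree by uniqueness of lifts; after shrinking both to a common radius they can
  be pasted.\<close>

lemma developing_map_section_on_tube:
  fixes D :: "'b \<Rightarrow> 'e::euclidean_space"
  assumes haus: "Hausdorff_space X" and dev: "developing_map X B D"
    and k: "continuous_map (top_of_set {0..1::real}) X k"
    and Dk: "\<And>t. t \<in> {0..1} \<Longrightarrow> D (k t) = a + t *\<^sub>R w"
  obtains O' \<sigma> where "open O'" "convex O'" "a \<in> O'" "a + w \<in> O'"
    "continuous_map (top_of_set O') X \<sigma>" "\<And>y. y \<in> O' \<Longrightarrow> D (\<sigma> y) = y" "\<sigma> a = k 0"
proof -
  let ?\<gamma> = "\<lambda>t::real. a + t *\<^sub>R w"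
  define tube where "tube s u \<delta> = (\<Union>t\<in>{s..u}. ball (?\<gamma> t) \<delta>)" for s u \<delta>
  have tube_open: "open (tube s u \<delta>)" and tube_convex: "convex (tube s u \<delta>)" for s u \<delta>
    unfolding tube_def by (auto simp: convex_tube)
  have tube_mono: "tube s u \<delta> \<subseteq> tube s u \<delta>'" if "\<delta> \<le> \<delta>'" for s u \<delta> \<delta>'
    unfolding tube_def using that by fastforce
  have tube_mem: "?\<gamma> t \<in> tube s u \<delta>" if "t \<in> {s..u}" "\<delta> > 0" for s t u \<delta>
    unfolding tube_def using that by force
  have kX: "k t \<in> topspace X" if "t \<in> {0..1}" for t
    using k that by (auto simp: continuous_map_def Pi_iff)
  \<comment> \<open>Prescribing \<open>k\<close> along the axis fixes the branch of the section, so
    that adjoining sections agree at the common axis point.\<close>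
  define P where "P s u \<longleftrightarrow> (0 \<le> s \<and> s \<le> u \<and> u \<le> 1 \<longrightarrow>
     (\<exists>\<delta>>0. \<exists>\<sigma>. continuous_map (top_of_set (tube s u \<delta>)) X \<sigma> \<and>
        (\<forall>y\<in>tube s u \<delta>. D (\<sigma> y) = y) \<and> (\<forall>t\<in>{s..u}. \<sigma> (?\<gamma> t) = k t)))" for s u
  have "P 0 1"
    using zero_le_one
  proof (induction rule: Bolzano)
    case (trans s t u)
    show ?case unfolding P_def
    proof (intro impI)
      assume su: "0 \<le> s \<and> s \<le> u \<and> u \<le> 1"
      obtain \<delta>1 \<sigma>1 where 1: "\<delta>1 > 0" "continuous_map (top_of_set (tube s t \<delta>1)) X \<sigma>1"
        "\<forall>y\<in>tube s t \<delta>1. D (\<sigma>1 y) = y" "\<forall>r\<in>{s..t}. \<sigma>1 (?\<gamma> r) = k r"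
        using trans su unfolding P_def by auto
      obtain \<delta>2 \<sigma>2 where 2: "\<delta>2 > 0" "continuous_map (top_of_set (tube t u \<delta>2)) X \<sigma>2"
        "\<forall>y\<in>tube t u \<delta>2. D (\<sigma>2 y) = y" "\<forall>r\<in>{t..u}. \<sigma>2 (?\<gamma> r) = k r"
        using trans su unfolding P_def by auto
      define \<delta> where "\<delta> = min \<delta>1 \<delta>2"
      have \<delta>: "\<delta> > 0" "\<delta> \<le> \<delta>1" "\<delta> \<le> \<delta>2" using 1 2 by (auto simp: \<delta>_def)
      define T1 T2 where "T1 = tube s t \<delta>" and "T2 = tube t u \<delta>"
      have T: "T1 \<subseteq> tube s t \<delta>1" "T2 \<subseteq> tube t u \<delta>2"
        unfolding T1_def T2_def using \<delta> by (auto intro!: tube_mono)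
      have c1: "continuous_map (top_of_set T1) X \<sigma>1" and c2: "continuous_map (top_of_set T2) X \<sigma>2"
        using continuous_map_from_subtopology_mono[OF 1(2) T(1)]
          continuous_map_from_subtopology_mono[OF 2(2) T(2)] by auto
      have \<gamma>t: "?\<gamma> t \<in> T1 \<inter> T2" unfolding T1_def T2_def using trans \<delta> by (auto intro!: tube_mem)
      have agree: "\<sigma>1 y = \<sigma>2 y" if "y \<in> T1 \<inter> T2" for y
      proof (rule unique_lift[where S = "top_of_set (T1 \<inter> T2)" and X = X and D = D and ?s0.0 = "?\<gamma> t"])
        show "connected_space (top_of_set (T1 \<inter> T2))"
          using tube_convex unfolding T1_def T2_def
          by (intro connected_space_subtopology) (simp add: connectedin_iff_connected convex_connected convex_Int)
        show "continuous_map (top_of_set (T1 \<inter> T2)) X \<sigma>1" "continuous_map (top_of_set (T1 \<inter> T2)) X \<sigma>2"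
          using continuous_map_from_subtopology_mono[OF c1] continuous_map_from_subtopology_mono[OF c2]
          by auto
        show "\<exists>W. openin X W \<and> x \<in> W \<and> inj_on D W" if "x \<in> topspace X" for x
          using developing_map_local_homeo[OF dev that] by metis
        show "\<sigma>1 (?\<gamma> t) = \<sigma>2 (?\<gamma> t)" using 1(4) 2(4) trans by auto
        show "D (\<sigma>1 z) = D (\<sigma>2 z)" if "z \<in> topspace (top_of_set (T1 \<inter> T2))" for z
          using that T 1(3) 2(3) by (metis IntD1 IntD2 subsetD topspace_euclidean_subtopology)
      qed (use that \<gamma>t haus in auto)
      define \<sigma> where "\<sigma> y = (if y \<in> T1 then \<sigma>1 y else \<sigma>2 y)" for y
      have \<sigma>2: "\<sigma> y = \<sigma>2 y" if "y \<in> T2" for y using agree[of y] that by (auto simp: \<sigma>_def)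
      have Tun: "tube s u \<delta> = T1 \<union> T2"
        unfolding tube_def T1_def T2_def using trans ivl_disj_un_two_touch(4)[of s t u]
        by (metis UN_Un)
      have "continuous_map (top_of_set (T1 \<union> T2)) X \<sigma>"
      proof (rule pasting_lemma[where I = UNIV and T = "\<lambda>b. if b then T1 else T2"
              and f = "\<lambda>b. if b then \<sigma>1 else \<sigma>2"])
        fix b
        show "openin (top_of_set (T1 \<union> T2)) (if b then T1 else T2)"
          using tube_open by (auto simp: T1_def T2_def openin_open intro: exI[of _ T1] exI[of _ T2])
        show "continuous_map (subtopology (top_of_set (T1 \<union> T2)) (if b then T1 else T2)) X
           (if b then \<sigma>1 else \<sigma>2)"
          using c1 c2 by (auto simp: subtopology_subtopology Int_absorb1)
      next
        fix x assume "x \<in> topspace (top_of_set (T1 \<union> T2))"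
        then show "\<exists>j. j \<in> UNIV \<and> x \<in> (if j then T1 else T2) \<and> \<sigma> x = (if j then \<sigma>1 else \<sigma>2) x"
          using \<sigma>2 by (cases "x \<in> T1") (auto simp: \<sigma>_def intro: exI[of _ True] exI[of _ False])
      qed (use agree in \<open>auto split: if_splits\<close>)
      moreover have "\<forall>y\<in>T1 \<union> T2. D (\<sigma> y) = y" using 1(3) 2(3) T by (auto simp: \<sigma>_def)
      moreover have "\<sigma> (?\<gamma> r) = k r" if r: "r \<in> {s..u}" for r
      proof (cases "r \<le> t")
        case True
        then have "?\<gamma> r \<in> T1" unfolding T1_def using r \<delta>(1) by (intro tube_mem) auto
        moreover have "\<sigma>1 (?\<gamma> r) = k r" using True r 1(4) by simp
        ultimately show ?thesis by (simp add: \<sigma>_def)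
      next
        case False
        then have "?\<gamma> r \<in> T2" unfolding T2_def using r \<delta>(1) by (intro tube_mem) auto
        moreover have "\<sigma>2 (?\<gamma> r) = k r" using False r 2(4) by simp
        ultimately show ?thesis using \<sigma>2 by simp
      qed
      ultimately show "\<exists>\<delta>>0. \<exists>\<sigma>. continuous_map (top_of_set (tube s u \<delta>)) X \<sigma> \<and>
          (\<forall>y\<in>tube s u \<delta>. D (\<sigma> y) = y) \<and> (\<forall>t\<in>{s..u}. \<sigma> (?\<gamma> t) = k t)"
        using \<delta>(1) by (intro exI[of _ \<delta>] conjI exI[of _ \<sigma>]) (simp_all add: Tun)
    qed
  next
    case (local t0)
    then have t0: "t0 \<in> {0..1}" by auto
    obtain W where W: "openin X W" "k t0 \<in> W" "open (D ` W)"
      "homeomorphic_map (subtopology X W) (top_of_set (D ` W)) D"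
      using developing_map_local_homeo[OF dev kX[OF t0]] by blast
    have WX: "W \<subseteq> topspace X" using W(1) openin_subset by blast
    obtain \<tau> where \<tau>: "homeomorphic_maps (subtopology X W) (top_of_set (D ` W)) D \<tau>"
      using W(4) homeomorphic_map_maps by blast
    have \<tau>D: "\<tau> (D z) = z" if "z \<in> W" for z
      using \<tau> that WX by (auto simp: homeomorphic_maps_def)
    have \<tau>c: "continuous_map (top_of_set (D ` W)) X \<tau>"
      using \<tau> by (auto simp: homeomorphic_maps_def intro: continuous_map_into_fulltopology)
    have "?\<gamma> t0 \<in> D ` W" using W(2) Dk[OF t0] by (metis imageI)
    then obtain e where e: "e > 0" "ball (?\<gamma> t0) e \<subseteq> D ` W" using W(3) openE by blast
    obtain T2 where T2: "open T2" "{s \<in> {0..1}. k s \<in> W} = {0..1} \<inter> T2"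
      using openin_continuous_map_preimage[OF k W(1)] by (auto simp: openin_open)
    have "t0 \<in> {s \<in> {0..1}. k s \<in> W}" using t0 W(2) by simp
    then have "t0 \<in> T2" unfolding T2(2) by simp
    moreover have "open (?\<gamma> -` ball (?\<gamma> t0) (e/2))" by (intro open_vimage continuous_intros) auto
    ultimately have "open (T2 \<inter> ?\<gamma> -` ball (?\<gamma> t0) (e/2))" "t0 \<in> T2 \<inter> ?\<gamma> -` ball (?\<gamma> t0) (e/2)"
      using T2(1) e(1) by auto
    then obtain d where d: "d > 0" "ball t0 d \<subseteq> T2 \<inter> ?\<gamma> -` ball (?\<gamma> t0) (e/2)"
      using openE by blast
    have "P s u" if su: "s \<le> t0 \<and> t0 \<le> u \<and> u - s < d" for s u
      unfolding P_def
    proof (intro impI)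
      assume s: "0 \<le> s \<and> s \<le> u \<and> u \<le> 1"
      have near: "r \<in> ball t0 d" if "r \<in> {s..u}" for r
        using that su unfolding mem_ball dist_real_def abs_less_iff by auto
      \<comment> \<open>One half of \<open>e\<close> is spent on moving along the axis away from
        \<open>t0\<close>, the other on the radius of the tube.\<close>
      have tsub: "tube s u (e/2) \<subseteq> D ` W"
      proof
        fix y assume "y \<in> tube s u (e/2)"
        then obtain r where r: "r \<in> {s..u}" "dist (?\<gamma> r) y < e/2" unfolding tube_def by auto
        then have "dist (?\<gamma> t0) (?\<gamma> r) < e/2" using d(2) near[OF r(1)] by auto
        then have "dist (?\<gamma> t0) y < e" using r(2) dist_triangle_half_r[of "?\<gamma> r" "?\<gamma> t0" e y]
          by (simp add: dist_commute)
        then show "y \<in> D ` W" using e(2) by auto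
      qed
      have "\<tau> (?\<gamma> r) = k r" if r: "r \<in> {s..u}" for r
      proof -
        have r01: "r \<in> {0..1}" using s r by auto
        have "r \<in> {0..1} \<inter> T2" using d(2) near[OF r] r01 by auto
        then have "k r \<in> W" unfolding T2(2)[symmetric] by simp
        then show ?thesis using \<tau>D[of "k r"] Dk[OF r01] by simp
      qed
      moreover have "D (\<tau> y) = y" if "y \<in> tube s u (e/2)" for y
        using that tsub \<tau>D by auto
      ultimately show "\<exists>\<delta>>0. \<exists>\<sigma>. continuous_map (top_of_set (tube s u \<delta>)) X \<sigma> \<and>
          (\<forall>y\<in>tube s u \<delta>. D (\<sigma> y) = y) \<and> (\<forall>t\<in>{s..u}. \<sigma> (?\<gamma> t) = k t)"
        using continuous_map_from_subtopology_mono[OF \<tau>c tsub] e(1)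
        by (intro exI[of _ "e/2"] conjI exI[of _ \<tau>]) auto
    qed
    then show ?case using d(1) by blast
  qed
  then obtain \<delta> \<sigma> where \<sigma>: "\<delta> > 0" "continuous_map (top_of_set (tube 0 1 \<delta>)) X \<sigma>"
      "\<forall>y\<in>tube 0 1 \<delta>. D (\<sigma> y) = y" "\<forall>t\<in>{0..1}. \<sigma> (?\<gamma> t) = k t"
    unfolding P_def by auto
  show thesis
  proof (rule that[of "tube 0 1 \<delta>" \<sigma>])
    show "a \<in> tube 0 1 \<delta>" "a + w \<in> tube 0 1 \<delta>"
      using tube_mem[of 0 0 1 \<delta>] tube_mem[of 1 0 1 \<delta>] \<sigma>(1) by auto
    show "\<sigma> a = k 0" using \<sigma>(4) by (auto dest: bspec[of _ _ 0])
  qed (use \<sigma> tube_open tube_convex in auto)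
qed

text \<open>Each \<open>w\<close> lies with \<open>D x0\<close> in a convex open set carrying a
  section of \<open>D\<close> through \<open>x0\<close>. Any two of these sets meet in a connected
  set containing \<open>D x0\<close>, so the sections paste to a global section \<open>s\<close>. On
  the connected space \<open>Mh\<close>, both \<open>s \<circ> D\<close> and the identity lift
  \<open>D\<close> and fix \<open>x0\<close>, hence they coincide.\<close>

theorem developing_map_homeomorphism:
  fixes D :: "'b \<Rightarrow> 'e::euclidean_space"
  assumes at: "affine_atlas M A" and haus: "Hausdorff_space M" and compl: "geodesically_complete M A"
    and cov: "covering_map Mh M p" and conn: "connected_space Mh" and ne: "topspace Mh \<noteq> {}"
    and dev: "developing_map Mh (pullback_atlas Mh M p A) D"
  obtains s where "homeomorphic_maps Mh euclidean D s"
proof -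
  have hMh: "Hausdorff_space Mh" using covering_map_Hausdorff[OF cov haus] .
  have Dc: "continuous_map Mh euclidean D"
    using dev by (simp add: developing_map_def affine_map_def)
  have loc: "\<exists>W. openin Mh W \<and> x \<in> W \<and> inj_on D W" if "x \<in> topspace Mh" for x
    using developing_map_local_homeo[OF dev that] by metis
  obtain x0 where x0: "x0 \<in> topspace Mh" using ne by blast
  have "\<exists>O' \<sigma>. open O' \<and> convex O' \<and> D x0 \<in> O' \<and> w \<in> O' \<and>
    continuous_map (top_of_set O') Mh \<sigma> \<and> (\<forall>y\<in>O'. D (\<sigma> y) = y) \<and> \<sigma> (D x0) = x0" for w
  proof -
    obtain k where k: "continuous_map (top_of_set {0..1::real}) Mh k" "k 0 = x0"
      "\<And>t. t \<in> {0..1} \<Longrightarrow> D (k t) = D x0 + t *\<^sub>R (w - D x0)"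
      using geodesic_lift[OF at compl cov dev x0] by metis
    obtain O' \<sigma> where "open O'" "convex O'" "D x0 \<in> O'" "D x0 + (w - D x0) \<in> O'"
      "continuous_map (top_of_set O') Mh \<sigma>" "\<And>y. y \<in> O' \<Longrightarrow> D (\<sigma> y) = y" "\<sigma> (D x0) = k 0"
      using developing_map_section_on_tube[OF hMh dev k(1) k(3)] by metis
    then show ?thesis using k(2) by (intro exI[of _ O'] exI[of _ \<sigma>]) auto
  qed
  then obtain O' \<sigma> where O': "\<And>w. open (O' w)" "\<And>w. convex (O' w)" "\<And>w. D x0 \<in> O' w" "\<And>w. w \<in> O' w"
    and \<sigma>: "\<And>w. continuous_map (top_of_set (O' w)) Mh (\<sigma> w)"
      "\<And>w y. y \<in> O' w \<Longrightarrow> D (\<sigma> w y) = y" "\<And>w. \<sigma> w (D x0) = x0"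
    by metis
  have "\<sigma> u y = \<sigma> v y" if "y \<in> O' u \<inter> O' v" for u v y
  proof (rule unique_lift[where S = "top_of_set (O' u \<inter> O' v)" and X = Mh and D = D and ?s0.0 = "D x0"])
    show "connected_space (top_of_set (O' u \<inter> O' v))"
      using O'(2) by (intro connected_space_subtopology) (simp add: connectedin_iff_connected convex_connected convex_Int)
    show "continuous_map (top_of_set (O' u \<inter> O' v)) Mh (\<sigma> u)" "continuous_map (top_of_set (O' u \<inter> O' v)) Mh (\<sigma> v)"
      using continuous_map_from_subtopology_mono[OF \<sigma>(1)] by auto
  qed (use that hMh O' \<sigma> loc in auto)
  then have agree: "\<sigma> u y = \<sigma> v y" if "y \<in> topspace euclidean \<inter> O' u \<inter> O' v" for u v y
    using that by simp
  have cover: "topspace euclidean \<subseteq> (\<Union>w\<in>UNIV. O' w)" using O'(4) by auto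
  obtain s where "continuous_map euclidean Mh s"
    "\<And>x w. w \<in> UNIV \<Longrightarrow> x \<in> topspace euclidean \<inter> O' w \<Longrightarrow> s x = \<sigma> w x"
    by (rule pasting_lemma_exists[OF cover _ \<sigma>(1) agree]) (use O'(1) in auto)
  then have s: "continuous_map euclidean Mh s" "\<And>x w. x \<in> O' w \<Longrightarrow> s x = \<sigma> w x" by auto
  have Ds: "D (s y) = y" for y using s(2)[OF O'(4)] \<sigma>(2)[OF O'(4)] by simp
  have "s (D x) = x" if x: "x \<in> topspace Mh" for x
  proof (rule unique_lift[where S = Mh and X = Mh and D = D and ?s0.0 = x0 and g = "\<lambda>x. x"])
    show "continuous_map Mh Mh (\<lambda>x. s (D x))"
      using continuous_map_compose[OF Dc s(1)] by (simp add: o_def)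
    show "s (D x0) = x0" using s(2)[OF O'(3)] \<sigma>(3) by simp
  qed (use x x0 conn hMh loc Ds in \<open>auto simp: continuous_map_id[unfolded id_def]\<close>)
  then have "homeomorphic_maps Mh euclidean D s"
    unfolding homeomorphic_maps_def using Dc s(1) Ds by simp
  then show thesis by (rule that)
qed

section \<open>The deck group\<close>

lemma affine_fun_convex_comb:
  assumes "affine_fun g" "u + v = 1"
  shows "g (u *\<^sub>R x + v *\<^sub>R y) = u *\<^sub>R g x + v *\<^sub>R g y"
proof -
  have u: "u = 1 - v" using assms(2) by simp
  have "u *\<^sub>R x + v *\<^sub>R y = x + v *\<^sub>R (y - x)" by (simp add: u algebra_simps)
  then have "g (u *\<^sub>R x + v *\<^sub>R y) = g x + v *\<^sub>R linear_part g (y - x)"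
    by (simp add: affine_fun_add[OF assms(1)] linear_scale[OF linear_linear_part[OF assms(1)]])
  also have "\<dots> = u *\<^sub>R g x + v *\<^sub>R g y"
    by (simp add: affine_fun_diff[OF assms(1), symmetric] u algebra_simps)
  finally show ?thesis .
qed

lemma convex_affine_fun_vimage:
  assumes "affine_fun g" "convex B"
  shows "convex (g -` B)"
  using assms unfolding convex_def by (auto simp: affine_fun_convex_comb)

text \<open>Keeps of the covering and the development only their composite \<open>Q\<close> from
  Euclidean space to \<open>M\<close>, which will be \<open>p \<circ> s\<close> for the inverse
  \<open>s\<close> of the developing map. No group is given: it is recovered from
  \<open>Q\<close>.\<close>

locale affine_quotient =
  fixes M :: "'a topology" and A :: "('a, 'e::euclidean_space) atlas" and Q :: "'e \<Rightarrow> 'a"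
  assumes atlas: "affine_atlas M A"
    and haus: "Hausdorff_space M"
    and compact: "compact_space M"
    and Q_cont: "continuous_map euclidean M Q"
    and Q_onto: "range Q = topspace M"
    and Q_open: "\<And>S. open S \<Longrightarrow> openin M (Q ` S)"
    and Q_chart: "\<And>V \<phi> x. (V, \<phi>) \<in> A \<Longrightarrow> Q x \<in> V \<Longrightarrow>
      \<exists>N g. open N \<and> x \<in> N \<and> Q ` N \<subseteq> V \<and> affine_fun g \<and> bij g \<and> (\<forall>z\<in>N. \<phi> (Q z) = g z)"
begin

text \<open>The group \<Gamma> in Euclidean coordinates. Affinity is part of the definition, so the
  work lies in showing that there are enough elements to relate all points of a fibre.\<close>

definition deck :: "('e \<Rightarrow> 'e) set" where
  "deck = {g. affine_fun g \<and> bij g \<and> (\<forall>z. Q (g z) = Q z)}"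

lemma deckD:
  assumes "g \<in> deck"
  shows "affine_fun g" "bij g" "Q (g z) = Q z" "inv g (g z) = z" "g (inv g z) = z"
proof -
  show *: "affine_fun g" "bij g" "Q (g z) = Q z" using assms by (auto simp: deck_def)
  show "inv g (g z) = z" "g (inv g z) = z"
    using * by (auto simp: bij_is_inj bij_is_surj surj_f_inv_f)
qed

lemma deck_id: "(\<lambda>x. x) \<in> deck"
  using bij_id by (auto simp: deck_def id_def)

lemma deck_compose:
  assumes "g \<in> deck" "h \<in> deck"
  shows "(\<lambda>x. g (h x)) \<in> deck"
  using assms bij_comp[of h g] by (auto simp: deck_def o_def intro: affine_fun_compose)

lemma deck_inv:
  assumes "g \<in> deck"
  shows "inv g \<in> deck"
proof -
  have "Q (inv g z) = Q z" for z
    using deckD(3)[OF assms, of "inv g z"] deckD(5)[OF assms, of z] by simp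
  then show ?thesis
    using assms deckD(1,2)[OF assms] by (auto simp: deck_def intro: affine_fun_inv bij_imp_bij_inv)
qed

lemma Q_mem [simp]: "Q x \<in> topspace M"
  using Q_onto by blast

lemma Q_inj_local:
  obtains N where "open N" "x \<in> N" "inj_on Q N"
proof -
  obtain V \<phi> where V: "(V, \<phi>) \<in> A" "Q x \<in> V"
    using affine_atlas_chart[OF atlas Q_mem] by blast
  obtain N g where N: "open N" "x \<in> N" "bij g" "\<forall>z\<in>N. \<phi> (Q z) = g z"
    using Q_chart[OF V] by blast
  have "inj_on Q N"
    using N(3,4) by (metis bij_is_inj injD inj_onI)
  then show thesis using that N by blast
qed

text \<open>Near \<open>x\<close> both images stay in a neighbourhood of the common value on which
  \<open>Q\<close> is injective, and there \<open>Q\<close> does not distinguish them; the identity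
  principle does the rest.\<close>

lemma deck_free:
  assumes "g \<in> deck" "h \<in> deck" "g x = h x"
  shows "g = h"
proof -
  obtain N where N: "open N" "g x \<in> N" "inj_on Q N" using Q_inj_local by blast
  have c: "continuous_on UNIV g" "continuous_on UNIV h"
    using deckD(1) assms(1,2) by (auto intro: affine_fun_imp_continuous_on)
  show ?thesis
  proof (rule affine_fun_eq_on_open)
    show "open (g -` N \<inter> h -` N)"
      using N(1) c by (intro open_Int open_vimage)
    show "g -` N \<inter> h -` N \<noteq> {}" using N(2) assms(3) by auto
    fix z assume "z \<in> g -` N \<inter> h -` N"
    then show "g z = h z"
      using inj_onD[OF N(3), of "g z" "h z"] deckD(3)[OF assms(1), of z] deckD(3)[OF assms(2), of z] by auto
  qed (use assms deckD(1) in auto)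
qed

text \<open>
  Two points of a fibre are related by an affine map near one of them, and this relation
  continues along all of the Euclidean space because both sides are affine into \<open>M\<close>.
\<close>

lemma deck_transitive:
  assumes "Q x = Q y"
  obtains g where "g \<in> deck" "g x = y"
proof -
  obtain V \<phi> where V: "(V, \<phi>) \<in> A" "Q x \<in> V"
    using affine_atlas_chart[OF atlas Q_mem] by blast
  obtain N g1 where N: "open N" "x \<in> N" "Q ` N \<subseteq> V" "affine_fun g1" "bij g1" "\<forall>z\<in>N. \<phi> (Q z) = g1 z"
    using Q_chart[OF V] by blast
  obtain N' g2 where N': "open N'" "y \<in> N'" "Q ` N' \<subseteq> V" "affine_fun g2" "bij g2" "\<forall>z\<in>N'. \<phi> (Q z) = g2 z"
    using Q_chart[OF V(1), of y] V(2) assms by metis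
  \<comment> \<open>Both \<open>g1\<close> near \<open>x\<close> and \<open>g2\<close> near
    \<open>y\<close> develop the same chart, so this is the only affine candidate.\<close>
  define g where "g z = inv g2 (g1 z)" for z
  have ag: "affine_fun g" unfolding g_def
    using affine_fun_inv[OF N'(4,5)] N(4) by (rule affine_fun_compose)
  have bg: "bij g" using bij_comp[OF N(5) bij_imp_bij_inv[OF N'(5)]] by (simp add: g_def[abs_def] o_def)
  have g2g: "g2 (g z) = g1 z" for z using N'(5) by (simp add: g_def bij_is_surj surj_f_inv_f)
  have "g2 y = g1 x" using N(2,6) N'(2,6) assms by metis
  then have gx: "g x = y" using N'(5) by (metis g_def bij_inv_eq_iff)
  have gc: "continuous_on UNIV g" using ag by (rule affine_fun_imp_continuous_on)
  define P where "P z \<longleftrightarrow> (\<exists>T. open T \<and> z \<in> T \<and> (\<forall>s\<in>T. Q (g s) = Q s))" for z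
  have "P z" for z
  proof (rule connected_induction_simple[where S = UNIV and a = x and P = P])
    have "Q (g s) = Q s" if s: "s \<in> N \<inter> g -` N'" for s
    proof -
      have "\<phi> (Q (g s)) = g2 (g s)" using N'(6) s by blast
      also have "\<dots> = \<phi> (Q s)" using N(6) s g2g by auto
      finally show ?thesis
        using inj_onD[OF affine_atlasD(4)[OF atlas V(1)], of "Q (g s)" "Q s"] N(3) N'(3) s
        by (auto simp: image_subset_iff)
    qed
    moreover have "open (N \<inter> g -` N')" using N N' gc by (intro open_Int open_vimage)
    ultimately show "P x" unfolding P_def using N(2) N'(2) gx by (intro exI[of _ "N \<inter> g -` N'"]) auto
  next
    fix a :: 'e
    show "\<exists>T. openin (top_of_set UNIV) T \<and> a \<in> T \<and> (\<forall>x\<in>T. \<forall>y\<in>T. P x \<longrightarrow> P y)"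
    proof (cases "Q (g a) = Q a")
      case True
      obtain V \<phi> where V: "(V, \<phi>) \<in> A" "Q a \<in> V"
        using affine_atlas_chart[OF atlas Q_mem] by blast
      obtain N g1 where N: "open N" "a \<in> N" "Q ` N \<subseteq> V" "affine_fun g1" "\<forall>z\<in>N. \<phi> (Q z) = g1 z"
        using Q_chart[OF V] by blast
      obtain N' g2 where N': "open N'" "g a \<in> N'" "Q ` N' \<subseteq> V" "affine_fun g2" "\<forall>z\<in>N'. \<phi> (Q z) = g2 z"
        using Q_chart[OF V(1), of "g a"] V(2) True by metis
      define T where "T = N \<inter> g -` N'"
      have T: "open T" "a \<in> T" unfolding T_def using N N' gc by (auto intro!: open_Int open_vimage)
      have "P v" if uv: "u \<in> T" "v \<in> T" "P u" for u v
      proof -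
        obtain T' where T': "open T'" "u \<in> T'" "\<forall>s\<in>T'. Q (g s) = Q s"
          using uv(3) unfolding P_def by blast
        have "(\<lambda>s. g2 (g s)) = g1"
        proof (rule affine_fun_eq_on_open)
          show "affine_fun (\<lambda>s. g2 (g s))" using N'(4) ag by (rule affine_fun_compose)
          show "open (T \<inter> T')" "T \<inter> T' \<noteq> {}" using T T' uv by auto
          fix s assume s: "s \<in> T \<inter> T'"
          then have "g2 (g s) = \<phi> (Q (g s))" using N'(5) by (auto simp: T_def)
          also have "\<dots> = g1 s" using s T'(3) N(5) by (auto simp: T_def)
          finally show "g2 (g s) = g1 s" .
        qed fact
        then have eq: "g2 (g s) = g1 s" for s by metis
        have "Q (g s) = Q s" if s: "s \<in> T" for s
        proof -
          have "\<phi> (Q (g s)) = \<phi> (Q s)" using N(5) N'(5) s eq[of s] by (auto simp: T_def)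
          moreover have "Q (g s) \<in> V" "Q s \<in> V" using N(3) N'(3) s by (auto simp: T_def)
          ultimately show ?thesis by (rule inj_onD[OF affine_atlasD(4)[OF atlas V(1)]])
        qed
        then show "P v" unfolding P_def using T uv by blast
      qed
      then show ?thesis using T by auto
    next
      \<comment> \<open>Since \<open>M\<close> is Hausdorff, inequality persists near
        \<open>a\<close>; there \<open>P\<close> fails everywhere and the implication is
        vacuous.\<close>
      case False
      have "closedin euclidean {s \<in> topspace euclidean. Q (g s) = Q s}"
      proof (rule closedin_continuous_maps_eq[OF haus _ Q_cont])
        show "continuous_map euclidean M (\<lambda>s. Q (g s))"
          using continuous_map_compose[of euclidean euclidean g M Q] gc Q_cont by (simp add: o_def)
      qed
      then have "open {s. Q (g s) \<noteq> Q s}"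
        by (simp add: closed_def Compl_eq Collect_neg_eq[symmetric])
      then show ?thesis using False unfolding P_def
        by (intro exI[of _ "{s. Q (g s) \<noteq> Q s}"]) auto
    qed
  qed auto
  then have "Q (g z) = Q z" for z unfolding P_def by blast
  then have "g \<in> deck" using ag bg by (auto simp: deck_def)
  then show thesis using that gx by blast
qed

text \<open>By compactness of \<open>C \<times> K\<close> it suffices to give each pair of points a
  neighbourhood realised by finitely many elements as argument and value. If the pair lies in one
  fibre, local injectivity of \<open>Q\<close> and freeness leave a single element; otherwise
  disjoint neighbourhoods in \<open>M\<close> leave none.\<close>

lemma deck_proper:
  assumes C: "compact C" and K: "compact K"
  shows "finite {g \<in> deck. g ` C \<inter> K \<noteq> {}}"
proof -
  define few where "few B \<longleftrightarrow> finite {g \<in> deck. \<exists>u v. (u, v) \<in> B \<and> g u = v}" for B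
  have ex: "\<exists>B. open B \<and> z \<in> B \<and> few B" for z :: "'e \<times> 'e"
  proof -
    obtain c k where z: "z = (c, k)" by fastforce
    show ?thesis
    proof (cases "Q c = Q k")
      case True
      then obtain g0 where g0: "g0 \<in> deck" "g0 c = k" using deck_transitive by metis
      obtain N where N: "open N" "c \<in> N" "inj_on Q N" using Q_inj_local by blast
      let ?N' = "inv g0 -` N"
      have "open ?N'" using N(1) deckD(1)[OF deck_inv[OF g0(1)]]
        by (intro open_vimage affine_fun_imp_continuous_on)
      moreover have "k \<in> ?N'" using g0 N(2) deckD(4)[OF g0(1)] by auto
      moreover have "g = g0" if g: "g \<in> deck" "u \<in> N" "g u \<in> ?N'" for g u
      proof -
        have "Q (inv g0 (g u)) = Q u" using deckD(3)[OF deck_inv[OF g0(1)]] deckD(3)[OF g(1)] by simp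
        then have "inv g0 (g u) = u" using inj_onD[OF N(3)] g by auto
        then have "g u = g0 u" using deckD(5)[OF g0(1)] by metis
        then show ?thesis using deck_free g(1) g0(1) by blast
      qed
      then have "{g \<in> deck. \<exists>u v. (u, v) \<in> N \<times> ?N' \<and> g u = v} \<subseteq> {g0}" by auto
      then have "few (N \<times> ?N')" unfolding few_def by (rule finite_subset) simp
      ultimately show ?thesis using N(1,2) z
        by (intro exI[of _ "N \<times> ?N'"]) (auto intro: open_Times)
    next
      case False
      then obtain S T where ST: "openin M S" "openin M T" "Q c \<in> S" "Q k \<in> T" "disjnt S T"
        using haus Q_mem unfolding Hausdorff_space_def by metis
      have o: "open (Q -` S)" "open (Q -` T)"
        using openin_continuous_map_preimage[OF Q_cont] ST(1,2) by (auto simp: vimage_def)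
      have "{g \<in> deck. \<exists>u v. (u, v) \<in> (Q -` S) \<times> (Q -` T) \<and> g u = v} = {}"
        using ST(5) deckD(3) by (auto simp: disjnt_def)
      then have "few ((Q -` S) \<times> (Q -` T))" unfolding few_def by (metis finite.emptyI)
      then show ?thesis using o ST(3,4) z
        by (intro exI[of _ "(Q -` S) \<times> (Q -` T)"]) (auto intro: open_Times)
    qed
  qed
  obtain B where B: "\<And>z. open (B z)" "\<And>z. z \<in> B z" "\<And>z. few (B z)" using ex by metis
  have "C \<times> K \<subseteq> (\<Union>z\<in>C \<times> K. B z)" using B(2) by blast
  then obtain F where F: "finite F" "C \<times> K \<subseteq> (\<Union>z\<in>F. B z)"
    by (rule compactE_image[OF compact_Times[OF C K] B(1)])
  have "{g \<in> deck. g ` C \<inter> K \<noteq> {}} \<subseteq> (\<Union>z\<in>F. {g \<in> deck. \<exists>u v. (u, v) \<in> B z \<and> g u = v})"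
  proof
    fix g assume g: "g \<in> {g \<in> deck. g ` C \<inter> K \<noteq> {}}"
    then obtain c where "c \<in> C" "g c \<in> K" by blast
    then obtain z where "z \<in> F" "(c, g c) \<in> B z" using F(2) by blast
    then show "g \<in> (\<Union>z\<in>F. {g \<in> deck. \<exists>u v. (u, v) \<in> B z \<and> g u = v})" using g by blast
  qed
  moreover have "finite (\<Union>z\<in>F. {g \<in> deck. \<exists>u v. (u, v) \<in> B z \<and> g u = v})"
    using F(1) B(3) unfolding few_def by blast
  ultimately show ?thesis by (rule finite_subset)
qed

lemma deck_cocompact:
  obtains R where "R > 0" "\<And>x. \<exists>g\<in>deck. norm (g x) \<le> R"
proof -
  have "compactin M (topspace M)" using compact by (simp add: compact_space_def)
  moreover have "topspace M \<subseteq> (\<Union>n::nat. Q ` ball 0 (real n))"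
  proof
    fix y assume "y \<in> topspace M"
    then obtain x where "y = Q x" using Q_onto by auto
    moreover obtain n where "norm x < real n" using reals_Archimedean2 by blast
    ultimately show "y \<in> (\<Union>n. Q ` ball 0 (real n))" by (auto intro!: exI[of _ n])
  qed
  ultimately obtain \<F> where \<F>: "finite \<F>" "\<F> \<subseteq> range (\<lambda>n::nat. Q ` ball 0 (real n))" "topspace M \<subseteq> \<Union>\<F>"
    using Q_open unfolding compactin_def by (metis (no_types, lifting) imageE open_ball)
  then obtain F where F: "finite F" "\<F> = (\<lambda>n::nat. Q ` ball 0 (real n)) ` F"
    by (metis finite_subset_image)
  \<comment> \<open>Inserting 1 makes the set nonempty and the radius positive.\<close>
  define R where "R = real (Max (insert 1 F))"
  have "\<exists>g\<in>deck. norm (g x) \<le> R" for x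
  proof -
    have "Q x \<in> \<Union>\<F>" using \<F>(3) Q_mem by blast
    then obtain n y where "n \<in> F" "norm y < real n" "Q y = Q x" using F(2) by auto
    moreover have "real n \<le> R" if "n \<in> F" for n using F(1) that by (auto simp: R_def)
    ultimately have "Q x = Q y" "norm y \<le> R" by force+
    then show ?thesis using deck_transitive by metis
  qed
  moreover have "1 \<le> Max (insert 1 F)" using F(1) by (intro Max_ge) auto
  then have "R > 0" by (simp add: R_def)
  ultimately show thesis using that by blast
qed

end

section \<open>Irreducibility\<close>

context affine_quotient
begin

text \<open>The index set varies with \<open>x\<close>, but over a unit ball properness provides one
  finite index set, and the added terms vanish by the support of \<phi>.\<close>

lemma continuous_on_deck_sum:
  fixes \<phi> :: "'e \<Rightarrow> real" and c :: "('e \<Rightarrow> 'e) \<Rightarrow> 'v::real_normed_vector"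
  assumes \<phi>: "continuous_on UNIV \<phi>" "\<And>y. norm y > R \<Longrightarrow> \<phi> y = 0"
  shows "continuous_on UNIV (\<lambda>x. \<Sum>g | g \<in> deck \<and> norm (g x) \<le> R. \<phi> (g x) *\<^sub>R c g)"
proof -
  let ?s = "\<lambda>x. \<Sum>g | g \<in> deck \<and> norm (g x) \<le> R. \<phi> (g x) *\<^sub>R c g"
  have "continuous (at x) ?s" for x
  proof -
    let ?F = "{g \<in> deck. g ` cball x 1 \<inter> cball 0 R \<noteq> {}}"
    have fin: "finite ?F" by (intro deck_proper compact_cball)
    have "?s y = (\<Sum>g\<in>?F. \<phi> (g y) *\<^sub>R c g)" if y: "y \<in> ball x 1" for y
    proof (rule sum.mono_neutral_left[OF fin])
      show "{g \<in> deck. norm (g y) \<le> R} \<subseteq> ?F" using y by force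
      show "\<forall>g\<in>?F - {g \<in> deck. norm (g y) \<le> R}. \<phi> (g y) *\<^sub>R c g = 0" using \<phi>(2) by (auto simp: not_le)
    qed
    moreover have "continuous_on (ball x 1) (\<lambda>y. \<Sum>g\<in>?F. \<phi> (g y) *\<^sub>R c g)"
    proof (intro continuous_on_sum continuous_on_scaleR continuous_on_const)
      fix g assume "g \<in> ?F"
      then have "continuous_on (ball x 1) g" using deckD(1) by (auto intro: affine_fun_imp_continuous_on)
      then show "continuous_on (ball x 1) (\<lambda>y. \<phi> (g y))"
        using continuous_on_compose2[OF \<phi>(1)] by blast
    qed
    ultimately have "continuous_on (ball x 1) ?s"
      using continuous_on_cong[OF refl, of "ball x 1" ?s "\<lambda>y. \<Sum>g\<in>?F. \<phi> (g y) *\<^sub>R c g"] by simp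
    then show ?thesis by (simp add: continuous_on_eq_continuous_at)
  qed
  then show ?thesis by (simp add: continuous_at_imp_continuous_on)
qed

text \<open>
  Otherwise averaging an orbit in \<open>H\<close> with a partition of unity gives a map into \<open>H\<close> which is
  properly homotopic to the identity by straight lines; near a point outside \<open>H\<close> this contradicts
  Brouwer's theorem.
\<close>

theorem deck_no_invariant_affine_subspace:
  assumes H: "affine H" "H \<noteq> {}" and inv: "\<And>g. g \<in> deck \<Longrightarrow> g ` H \<subseteq> H"
  shows "H = UNIV"
proof (rule ccontr)
  assume "H \<noteq> UNIV"
  then obtain z where z: "z \<notin> H" by blast
  obtain y0 where y0: "y0 \<in> H" using H by blast
  obtain R where R: "R > 0" "\<And>x. \<exists>g\<in>deck. norm (g x) \<le> R" using deck_cocompact by blast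
  \<comment> \<open>Positive on the ball of radius \<open>R\<close>, which meets every orbit, and
    zero beyond \<open>R + 1\<close>: the translates of \<phi> form a locally finite family with
    positive sum.\<close>
  define \<phi> where "\<phi> y = max 0 (R + 1 - norm y)" for y :: 'e
  have \<phi>: "continuous_on UNIV \<phi>" "\<And>y. norm y > R + 1 \<Longrightarrow> \<phi> y = 0" "\<And>y. \<phi> y \<ge> 0"
    "\<And>y. norm y \<le> R \<Longrightarrow> \<phi> y > 0"
    unfolding \<phi>_def by (auto intro!: continuous_intros)
  define G where "G x = {g. g \<in> deck \<and> norm (g x) \<le> R + 1}" for x
  have Gfin: "finite (G x)" for x
  proof -
    have "G x = {g \<in> deck. g ` {x} \<inter> cball 0 (R + 1) \<noteq> {}}" by (auto simp: G_def)
    then show ?thesis by (simp only:) (intro deck_proper compact_cball compact_sing)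
  qed
  define \<Phi> where "\<Phi> x = (\<Sum>g\<in>G x. \<phi> (g x))" for x
  have \<Phi>pos: "\<Phi> x > 0" for x
  proof -
    obtain g where "g \<in> deck" "norm (g x) \<le> R" using R by blast
    then show ?thesis unfolding \<Phi>_def
      by (intro sum_pos2[OF Gfin, of g]) (auto simp: G_def \<phi>)
  qed
  \<comment> \<open>The weights add up to 1 and the points \<open>inv g y0\<close> lie in the
    invariant set \<open>H\<close>, so \<open>r\<close> is a continuous map into \<open>H\<close>.
    It moves points by an amount that is controlled up to the action.\<close>
  define r where "r x = (\<Sum>g\<in>G x. (\<phi> (g x) / \<Phi> x) *\<^sub>R inv g y0)" for x
  have r_convex: "r x \<in> C" if "convex C" "\<And>g. g \<in> G x \<Longrightarrow> inv g y0 \<in> C" for x C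
    unfolding r_def
  proof (rule convex_sum[OF Gfin \<open>convex C\<close>])
    show "(\<Sum>g\<in>G x. \<phi> (g x) / \<Phi> x) = 1"
      using \<Phi>pos[of x] by (simp add: sum_divide_distrib[symmetric] \<Phi>_def[symmetric])
    show "\<phi> (g x) / \<Phi> x \<ge> 0" for g using \<Phi>pos[of x] \<phi>(3) by simp
  qed (use that in auto)
  have rH: "r x \<in> H" for x
    by (rule r_convex[OF affine_imp_convex[OF H(1)]]) (use inv[OF deck_inv] y0 in \<open>auto simp: G_def\<close>)
  have rc: "continuous_on UNIV r"
  proof -
    have "continuous_on UNIV \<Phi>"
      using continuous_on_deck_sum[OF \<phi>(1,2), where c = "\<lambda>_. 1::real"] by (simp add: \<Phi>_def[abs_def] G_def)
    moreover have "continuous_on UNIV (\<lambda>x. \<Sum>g\<in>G x. \<phi> (g x) *\<^sub>R inv g y0)"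
      using continuous_on_deck_sum[OF \<phi>(1,2), where c = "\<lambda>g. inv g y0"] by (simp add: G_def)
    moreover have "r = (\<lambda>x. (1 / \<Phi> x) *\<^sub>R (\<Sum>g\<in>G x. \<phi> (g x) *\<^sub>R inv g y0))"
      by (auto simp: r_def scaleR_sum_right fun_eq_iff)
    ultimately show ?thesis
      using \<Phi>pos by (auto intro!: continuous_intros simp: less_imp_neq[symmetric])
  qed
  define F where "F s x = (1 - s) *\<^sub>R x + s *\<^sub>R r x" for s x
  \<comment> \<open>If \<open>g0\<close> brings \<open>x\<close> into the ball of radius
    \<open>R\<close>, it carries each averaged point \<open>inv g y0\<close> to
    \<open>inv h y0\<close> with \<open>h = g \<circ> inv g0\<close> in the finite set
    \<open>J\<close>. Hence \<open>g0\<close> carries the whole segment from \<open>x\<close> to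
    \<open>r x\<close> into the compact convex set \<open>B\<close>.\<close>
  define J where "J = {h \<in> deck. h ` cball 0 (R + 1) \<inter> cball 0 (R + 1) \<noteq> {}}"
  have Jfin: "finite J" unfolding J_def by (intro deck_proper compact_cball)
  define B where "B = convex hull (cball 0 R \<union> (\<lambda>h. inv h y0) ` J)"
  have Bc: "compact B" unfolding B_def
    using Jfin by (intro compact_convex_hull compact_Un compact_cball finite_imp_compact) auto
  have Bconv: "convex B" by (simp add: B_def)
  have near: "\<exists>g\<in>deck. norm (g x) \<le> R \<and> g (F s x) \<in> B" if s: "0 \<le> s" "s \<le> 1" for s x
  proof -
    obtain g0 where g0: "g0 \<in> deck" "norm (g0 x) \<le> R" using R by blast
    have conv: "convex (g0 -` B)" by (rule convex_affine_fun_vimage[OF deckD(1)[OF g0(1)] Bconv])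
    have "x \<in> g0 -` B" using g0(2) by (auto simp: B_def intro!: hull_inc)
    moreover have "r x \<in> g0 -` B"
    proof (rule r_convex[OF conv])
      fix g assume g: "g \<in> G x"
      then have gd: "g \<in> deck" "norm (g x) \<le> R + 1" by (auto simp: G_def)
      define h where "h y = g (inv g0 y)" for y
      have h: "h \<in> deck" unfolding h_def using gd(1) deck_inv[OF g0(1)] by (rule deck_compose)
      have "h (g0 x) = g x" using deckD(4)[OF g0(1)] by (simp add: h_def)
      moreover have "g0 x \<in> cball 0 (R + 1)" "g x \<in> cball 0 (R + 1)" using g0 gd by auto
      ultimately have "h \<in> J" unfolding J_def using h by force
      moreover have "inv h y0 = g0 (inv g y0)"
      proof -
        have "h (g0 (inv g y0)) = y0" using deckD(4)[OF g0(1)] deckD(5)[OF gd(1)] by (simp add: h_def)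
        then show ?thesis using deckD(4)[OF h] by metis
      qed
      ultimately have "g0 (inv g y0) \<in> (\<lambda>h. inv h y0) ` J" by (metis image_eqI)
      then show "inv g y0 \<in> g0 -` B" unfolding B_def by (simp add: hull_inc)
    qed
    ultimately have "F s x \<in> g0 -` B"
      unfolding F_def using conv s by (intro convexD) auto
    then show ?thesis using g0 by auto
  qed
  \<comment> \<open>Properness of the homotopy over the point \<open>z\<close>: an element that
    brings \<open>F s x = z\<close> into \<open>B\<close> is one of finitely many, and then
    \<open>x\<close> lies in one of finitely many compact images of a ball.\<close>
  obtain R' where R': "R' > 0" "\<And>s x. 0 \<le> s \<Longrightarrow> s \<le> 1 \<Longrightarrow> F s x = z \<Longrightarrow> dist z x < R'"
  proof -
    define Z where "Z = {g \<in> deck. g ` {z} \<inter> B \<noteq> {}}"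
    have "finite Z" unfolding Z_def using Bc by (intro deck_proper) auto
    then have "compact (\<Union>g\<in>Z. inv g ` cball 0 R)"
    proof (rule compact_UN)
      fix g assume "g \<in> Z"
      then have "affine_fun (inv g)" using deckD(1)[OF deck_inv] by (auto simp: Z_def)
      then show "compact (inv g ` cball 0 R)"
        by (intro compact_continuous_image affine_fun_imp_continuous_on compact_cball)
    qed
    then obtain K where K: "K > 0" "(\<Union>g\<in>Z. inv g ` cball 0 R) \<subseteq> ball z K"
      using bounded_subset_ballD[OF compact_imp_bounded] by blast
    have "dist z x < K" if sx: "0 \<le> s" "s \<le> 1" "F s x = z" for s x
    proof -
      obtain g where g: "g \<in> deck" "norm (g x) \<le> R" "g z \<in> B" using near[OF sx(1,2), of x] sx(3) by auto
      then have "g \<in> Z" by (auto simp: Z_def)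
      moreover have "x = inv g (g x)" using deckD(4)[OF g(1)] by simp
      then have "x \<in> inv g ` cball 0 R" using g(2) by (metis image_eqI mem_cball_0)
      ultimately have "x \<in> ball z K" using K(2) by blast
      then show ?thesis by simp
    qed
    then show thesis using that K(1) by blast
  qed
  \<comment> \<open>A cutoff equal to 1 up to distance \<open>R'\<close> from \<open>z\<close> and
    to 0 from \<open>2 * R'\<close> on. Within \<open>R'\<close> the map \<open>f\<close> is
    \<open>r\<close>, with values in \<open>H\<close>; farther out the homotopy misses
    \<open>z\<close>; at distance \<open>2 * R'\<close> it is the identity.\<close>
  define \<sigma> where "\<sigma> x = max 0 (min 1 (2 - dist z x / R'))" for x
  have \<sigma>: "0 \<le> \<sigma> x" "\<sigma> x \<le> 1" for x by (auto simp: \<sigma>_def)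
  define f where "f x = F (\<sigma> x) x" for x
  have fz: "f x \<noteq> z" for x
  proof
    assume "f x = z"
    then have "dist z x < R'" using R'(2)[OF \<sigma>, of x x] by (simp add: f_def)
    then have "\<sigma> x = 1" using R'(1) by (auto simp: \<sigma>_def field_simps)
    then have "f x = r x" by (simp add: f_def F_def)
    then show False using \<open>f x = z\<close> rH z by metis
  qed
  have fc: "continuous_on UNIV f"
    unfolding f_def F_def \<sigma>_def by (intro continuous_intros rc) (use R' in auto)
  \<comment> \<open>Radial projection of \<open>f x\<close> from \<open>z\<close> to the sphere,
    followed by the antipodal map. A fixed point would lie on the sphere, where \<open>f\<close> is
    the identity, and be its own antipode.\<close>
  define k where "k x = z - (2 * R') *\<^sub>R sgn (f x - z)" for x
  have dk: "dist z (k x) = 2 * R'" for x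
    using fz[of x] R'(1) by (simp add: k_def dist_norm norm_sgn)
  obtain x where x: "x \<in> cball z (2 * R')" "k x = x"
  proof (rule brouwer_ball[of "2 * R'" z k])
    show "continuous_on (cball z (2 * R')) k"
      unfolding k_def using fz by (intro continuous_intros continuous_on_subset[OF fc]) auto
  qed (use R' dk in auto)
  have "dist z x = 2 * R'" using dk[of x] x(2) by simp
  then have "\<sigma> x = 0" using R'(1) by (simp add: \<sigma>_def)
  then have "f x = x" by (simp add: f_def F_def)
  then have "x - z = - ((2 * R') *\<^sub>R sgn (x - z))" using x(2) by (simp add: k_def algebra_simps)
  moreover have "(2 * R') *\<^sub>R sgn (x - z) = x - z"
  proof -
    have "2 * R' = norm (x - z)" using \<open>dist z x = 2 * R'\<close> by (simp add: dist_norm norm_minus_commute)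
    then show ?thesis by (cases "x = z") (simp_all add: sgn_div_norm)
  qed
  ultimately have "x - z = - (x - z)" by (simp only:)
  then have "2 *\<^sub>R (x - z) = 0" unfolding scaleR_2 eq_neg_iff_add_eq_0 .
  then show False using \<open>f x = x\<close> fz[of x] by simp
qed

end

section \<open>The action on the leaf space\<close>

lemma finite_arithmetic_progression_Icc:
  fixes c \<tau> r :: real
  assumes "\<tau> > 0"
  shows "finite ({c + of_int k * \<tau> | k :: int. True} \<inter> {-r..r})"
proof -
  have "{c + of_int k * \<tau> | k :: int. True} \<inter> {-r..r} \<subseteq>
      (\<lambda>k. c + of_int k * \<tau>) ` {\<lfloor>(-r - c) / \<tau>\<rfloor>..\<lceil>(r - c) / \<tau>\<rceil>}"
  proof
    fix x assume "x \<in> {c + of_int k * \<tau> | k :: int. True} \<inter> {-r..r}"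
    then obtain k :: int where k: "x = c + of_int k * \<tau>" "-r \<le> x" "x \<le> r" by auto
    then have "(-r - c) / \<tau> \<le> of_int k" "of_int k \<le> (r - c) / \<tau>"
      using assms by (auto simp: field_simps)
    then have "k \<in> {\<lfloor>(-r - c) / \<tau>\<rfloor>..\<lceil>(r - c) / \<tau>\<rceil>}"
      by (auto simp: floor_le_iff le_ceiling_iff)
    then show "x \<in> (\<lambda>k. c + of_int k * \<tau>) ` {\<lfloor>(-r - c) / \<tau>\<rfloor>..\<lceil>(r - c) / \<tau>\<rceil>}"
      using k(1) by blast
  qed
  then show ?thesis by (rule finite_subset) simp
qed

text \<open>The least positive element generates, by division with remainder. It exists because the
  window up to \<open>\<bar>x0\<bar>\<close> contains a positive element of \<open>T\<close>, but
  only finitely many.\<close>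

lemma discrete_real_subgroup_cyclic:
  fixes T :: "real set"
  assumes diff: "\<And>x y. x \<in> T \<Longrightarrow> y \<in> T \<Longrightarrow> x - y \<in> T"
    and fin: "\<And>r. finite (T \<inter> {-r..r})" and x0: "x0 \<in> T" "x0 \<noteq> 0"
  obtains \<tau> where "\<tau> > 0" "T = {of_int k * \<tau> | k :: int. True}"
proof -
  have 0: "0 \<in> T" using diff[OF x0(1) x0(1)] by simp
  have neg: "- x \<in> T" if "x \<in> T" for x using diff[OF 0 that] by simp
  have add: "x + y \<in> T" if "x \<in> T" "y \<in> T" for x y using diff[OF that(1) neg[OF that(2)]] by simp
  define P where "P = {x \<in> T. 0 < x \<and> x \<le> \<bar>x0\<bar>}"
  have "P \<subseteq> T \<inter> {-\<bar>x0\<bar>..\<bar>x0\<bar>}" by (auto simp: P_def)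
  then have P: "finite P" using fin finite_subset by blast
  have "\<bar>x0\<bar> \<in> P" using x0 neg by (auto simp: P_def abs_if)
  then have ne: "P \<noteq> {}" by blast
  define \<tau> where "\<tau> = Min P"
  have "\<tau> \<in> P" unfolding \<tau>_def using P ne by (rule Min_in)
  then have \<tau>: "\<tau> \<in> T" "\<tau> > 0" by (auto simp: P_def)
  have min: "\<tau> \<le> x" if "x \<in> T" "x > 0" for x
  proof (cases "x \<le> \<bar>x0\<bar>")
    case True
    then show ?thesis unfolding \<tau>_def using that P by (intro Min_le) (auto simp: P_def)
  next
    case False
    then show ?thesis using \<open>\<tau> \<in> P\<close> by (auto simp: P_def)
  qed
  have natmult: "of_nat n * \<tau> \<in> T" for n
    by (induction n) (auto simp: 0 \<tau> add distrib_right)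
  have mult: "of_int k * \<tau> \<in> T" for k :: int
    using natmult[of "nat k"] neg[OF natmult[of "nat (-k)"]] by (cases "k \<ge> 0") auto
  have "x \<in> {of_int k * \<tau> | k :: int. True}" if x: "x \<in> T" for x
  proof -
    define k where "k = \<lfloor>x / \<tau>\<rfloor>"
    have "of_int k \<le> x / \<tau>" "x / \<tau> < of_int k + 1" unfolding k_def by linarith+
    then have "0 \<le> x - of_int k * \<tau>" "x - of_int k * \<tau> < \<tau>" using \<tau>(2) by (auto simp: field_simps)
    moreover have "x - of_int k * \<tau> \<in> T" using x mult by (rule diff)
    ultimately have "x - of_int k * \<tau> = 0" using min[of "x - of_int k * \<tau>"] by linarith
    then show ?thesis by (auto intro!: exI[of _ k])
  qed
  then have "T = {of_int k * \<tau> | k :: int. True}" using mult by blast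
  then show thesis using that \<tau>(2) by blast
qed

text \<open>A unit normal \<open>a\<close> stands for the hyperplane \<open>U\<close>: the leaves
  above are the level sets of \<open>a \<bullet> x\<close>, and \<open>t *\<^sub>R a\<close> is a
  handy point of level \<open>t\<close>.\<close>

locale affine_foliation = affine_quotient M A Q
  for M :: "'a topology" and A :: "('a, 'e::euclidean_space) atlas" and Q :: "'e \<Rightarrow> 'a" +
  fixes a :: 'e
  assumes norm_a: "norm a = 1"
    and invariant: "\<And>g x. g \<in> deck \<Longrightarrow> a \<bullet> x = 0 \<Longrightarrow> a \<bullet> linear_part g x = 0"
begin

text \<open>The action \<open>t \<mapsto> \<lambda> t + \<mu>\<close> of the deck group on the leaf space \<open>\<real>\<close> of the foliation above.\<close>

definition lam :: "('e \<Rightarrow> 'e) \<Rightarrow> real" where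
  "lam g = a \<bullet> linear_part g a"

definition mu :: "('e \<Rightarrow> 'e) \<Rightarrow> real" where
  "mu g = a \<bullet> g 0"

definition rho :: "('e \<Rightarrow> 'e) \<Rightarrow> real \<Rightarrow> real" where
  "rho g t = lam g * t + mu g"

definition orbit :: "real \<Rightarrow> real set" where
  "orbit t = (\<lambda>g. rho g t) ` deck"

text \<open>Cocompactness of the stabiliser of the hyperplane at level \<open>t\<close>: an element
  that keeps one point on this level keeps all of it, since it permutes the levels.\<close>

definition cocompact_level :: "real \<Rightarrow> bool" where
  "cocompact_level t \<longleftrightarrow>
     (\<exists>R. \<forall>x. a \<bullet> x = t \<longrightarrow> (\<exists>g\<in>deck. norm (g x) \<le> R \<and> a \<bullet> g x = t))"

lemma aa [simp]: "a \<bullet> a = 1"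
  using norm_a by (simp add: dot_square_norm)

lemma inner_deck:
  assumes "g \<in> deck"
  shows "a \<bullet> g x = rho g (a \<bullet> x)"
proof -
  have lin: "linear (linear_part g)" using deckD(1)[OF assms] by (rule linear_linear_part)
  define u where "u = x - (a \<bullet> x) *\<^sub>R a"
  have "a \<bullet> u = 0" by (simp add: u_def inner_diff_right)
  then have "a \<bullet> linear_part g u = 0" using invariant assms by blast
  moreover have "x = (a \<bullet> x) *\<^sub>R a + u" by (simp add: u_def)
  then have "linear_part g x = (a \<bullet> x) *\<^sub>R linear_part g a + linear_part g u"
    by (metis lin linear_add linear_scale)
  ultimately have "a \<bullet> linear_part g x = (a \<bullet> x) * lam g" by (simp add: inner_add_right lam_def)
  then show ?thesis using affine_fun_eq[of g x] by (simp add: inner_add_right rho_def mu_def mult.commute)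
qed

lemma rho_compose:
  assumes "g \<in> deck" "h \<in> deck"
  shows "rho (\<lambda>x. g (h x)) t = rho g (rho h t)"
  using inner_deck[OF deck_compose[OF assms], of "t *\<^sub>R a"] inner_deck[OF assms(1)]
    inner_deck[OF assms(2), of "t *\<^sub>R a"] by simp

lemma rho_inv:
  assumes "g \<in> deck"
  shows "rho (inv g) (rho g t) = t" "rho g (rho (inv g) t) = t"
  using inner_deck[OF assms, of "t *\<^sub>R a"] inner_deck[OF deck_inv[OF assms], of "g (t *\<^sub>R a)"]
    inner_deck[OF deck_inv[OF assms], of "t *\<^sub>R a"] inner_deck[OF assms, of "inv g (t *\<^sub>R a)"]
    deckD(4,5)[OF assms] by simp_all

lemma lam_eq: "lam g = rho g 1 - rho g 0" and mu_eq: "mu g = rho g 0"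
  by (simp_all add: rho_def)

lemma lam_compose:
  assumes "g \<in> deck" "h \<in> deck"
  shows "lam (\<lambda>x. g (h x)) = lam g * lam h"
  unfolding lam_eq[of "\<lambda>x. g (h x)"] rho_compose[OF assms] by (simp add: rho_def algebra_simps)

lemma mu_compose:
  assumes "g \<in> deck" "h \<in> deck"
  shows "mu (\<lambda>x. g (h x)) = lam g * mu h + mu g"
  unfolding mu_eq[of "\<lambda>x. g (h x)"] rho_compose[OF assms] by (simp add: rho_def)

lemma lam_inv:
  assumes "g \<in> deck"
  shows "lam g * lam (inv g) = 1"
  using rho_inv(2)[OF assms, of 1] rho_inv(2)[OF assms, of 0] by (simp add: rho_def algebra_simps)

lemma orbit_rho:
  assumes "g \<in> deck" "s \<in> orbit t"
  shows "rho g s \<in> orbit t"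
proof -
  obtain h where h: "h \<in> deck" "s = rho h t" using assms(2) by (auto simp: orbit_def)
  then have "rho g s = rho (\<lambda>x. g (h x)) t" using rho_compose assms(1) by simp
  then show ?thesis using deck_compose[OF assms(1) h(1)] by (auto simp: orbit_def)
qed

lemma orbit_self: "t \<in> orbit t"
proof -
  have "rho (\<lambda>x. x) t = t" using inner_deck[OF deck_id, of "t *\<^sub>R a"] by simp
  then show ?thesis using deck_id by (force simp: orbit_def)
qed

text \<open>A fixed level would be an invariant hyperplane, against irreducibility.\<close>

lemma no_fixed_level: "\<exists>g\<in>deck. rho g t \<noteq> t"
proof (rule ccontr)
  assume "\<not> ?thesis"
  then have "g ` {x. a \<bullet> x = t} \<subseteq> {x. a \<bullet> x = t}" if "g \<in> deck" for g
    using that inner_deck by auto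
  moreover have "t *\<^sub>R a \<in> {x. a \<bullet> x = t}" "(t + 1) *\<^sub>R a \<notin> {x. a \<bullet> x = t}" by auto
  ultimately show False
    using deck_no_invariant_affine_subspace[OF affine_hyperplane, of a t] by blast
qed

text \<open>The point \<open>t' *\<^sub>R a\<close> of a level \<open>t'\<close> in the orbit is
  carried to level \<open>t\<close> and then, by the stabiliser, into a fixed ball. Reversing this,
  \<open>t'\<close> is the image of \<open>t\<close> under an element moving a point of that ball
  into the ball of radius \<open>r\<close>, and there are finitely many such elements.\<close>

lemma cocompact_level_orbit_finite:
  assumes "cocompact_level t"
  shows "finite (orbit t \<inter> {-r..r})"
proof -
  obtain R where R: "\<And>x. a \<bullet> x = t \<Longrightarrow> \<exists>g\<in>deck. norm (g x) \<le> R \<and> a \<bullet> g x = t"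
    using assms unfolding cocompact_level_def by blast
  let ?F = "{k \<in> deck. k ` cball 0 R \<inter> cball 0 r \<noteq> {}}"
  have "orbit t \<inter> {-r..r} \<subseteq> (\<lambda>k. rho k t) ` ?F"
  proof
    fix t' assume t': "t' \<in> orbit t \<inter> {-r..r}"
    then obtain g where g: "g \<in> deck" "t' = rho g t" by (auto simp: orbit_def)
    define y where "y = t' *\<^sub>R a"
    have y: "a \<bullet> y = t'" "norm y \<le> r" using t' norm_a by (auto simp: y_def)
    have "a \<bullet> inv g y = t" using inner_deck[OF deck_inv[OF g(1)], of y] y(1) g rho_inv by simp
    then obtain h where h: "h \<in> deck" "norm (h (inv g y)) \<le> R" "a \<bullet> h (inv g y) = t" using R by blast
    define k where "k x = g (inv h x)" for x
    have k: "k \<in> deck" unfolding k_def using g(1) deck_inv[OF h(1)] by (rule deck_compose)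
    have ky: "k (h (inv g y)) = y" using deckD(4)[OF h(1)] deckD(5)[OF g(1)] by (simp add: k_def)
    then have "k \<in> ?F" using k h(2) y(2) by force
    moreover have "t' = rho k t" using inner_deck[OF k, of "h (inv g y)"] ky y(1) h(3) by simp
    ultimately show "t' \<in> (\<lambda>k. rho k t) ` ?F" by blast
  qed
  moreover have "finite ?F" by (intro deck_proper compact_cball)
  ultimately show ?thesis by (meson finite_imageI finite_subset)
qed

text \<open>Bringing a point of level \<open>t\<close> into the ball of radius \<open>R\<close> may
  change its level, but only to one of the finitely many orbit levels in \<open>{-R..R}\<close>. One
  chosen element for each of them leads back to \<open>t\<close>, and finitely many images of the
  ball are bounded.\<close>

lemma orbit_finite_cocompact_level:
  assumes "\<And>r. finite (orbit t \<inter> {-r..r})"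
  shows "cocompact_level t"
proof -
  obtain R where R: "R > 0" "\<And>x. \<exists>g\<in>deck. norm (g x) \<le> R" using deck_cocompact by blast
  have "\<exists>g\<in>deck. rho g t' = t" if "t' \<in> orbit t" for t'
    using that rho_inv deck_inv by (force simp: orbit_def)
  then obtain f where f: "\<And>t'. t' \<in> orbit t \<Longrightarrow> f t' \<in> deck" "\<And>t'. t' \<in> orbit t \<Longrightarrow> rho (f t') t' = t"
    by metis
  let ?K = "\<Union>t'\<in>orbit t \<inter> {-R..R}. f t' ` cball 0 R"
  have "compact ?K"
    using assms f(1) deckD(1)
    by (intro compact_UN compact_continuous_image affine_fun_imp_continuous_on compact_cball) auto
  then obtain R' where R': "?K \<subseteq> ball 0 R'"
    using bounded_subset_ballD[OF compact_imp_bounded] by blast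
  have "\<exists>g\<in>deck. norm (g x) \<le> R' \<and> a \<bullet> g x = t" if x: "a \<bullet> x = t" for x
  proof -
    obtain g where g: "g \<in> deck" "norm (g x) \<le> R" using R by blast
    define t' where "t' = a \<bullet> g x"
    have "t' = rho g t" using inner_deck[OF g(1), of x] x by (simp add: t'_def)
    then have t': "t' \<in> orbit t" using g(1) by (auto simp: orbit_def)
    have "\<bar>t'\<bar> \<le> norm (g x)" using Cauchy_Schwarz_ineq2[of a "g x"] norm_a by (simp add: t'_def)
    then have "t' \<in> {-R..R}" using g(2) by auto
    then have "t' \<in> orbit t \<inter> {-R..R}" "f t' (g x) \<in> f t' ` cball 0 R" using t' g(2) by auto
    then have "f t' (g x) \<in> ?K" by blast
    then have "f t' (g x) \<in> ball 0 R'" using R' by blast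
    then have "norm (f t' (g x)) \<le> R'" by simp
    moreover have "a \<bullet> f t' (g x) = t" using inner_deck[OF f(1)[OF t'], of "g x"] f(2)[OF t'] by (simp add: t'_def)
    ultimately show ?thesis using deck_compose[OF f(1)[OF t'] g(1)] by auto
  qed
  then show ?thesis unfolding cocompact_level_def by blast
qed

text \<open>
  A contraction of the leaf space would make any orbit accumulate at its fixed point, unless the
  orbit is that point.
\<close>

lemma lam_unit:
  assumes fin: "\<And>r. finite (orbit t \<inter> {-r..r})" and "g \<in> deck"
  shows "\<bar>lam g\<bar> = 1"
proof -
  have no_contraction: "\<not> \<bar>lam g\<bar> < 1" if g: "g \<in> deck" for g
  proof
    assume lt: "\<bar>lam g\<bar> < 1"
    define c where "c = mu g / (1 - lam g)"
    have "1 - lam g \<noteq> 0" using lt by auto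
    then have gc: "lam g * c + mu g = c" by (simp add: c_def field_simps)
    \<comment> \<open>If \<open>t\<close> is itself the fixed point \<open>c\<close>, irreducibility
      supplies another point of its orbit.\<close>
    obtain t1 where t1: "t1 \<in> orbit t" "t1 \<noteq> c"
      using no_fixed_level[of t] orbit_self[of t] by (metis imageI orbit_def)
    define s where "s n = c + lam g ^ n * (t1 - c)" for n
    have s: "s n \<in> orbit t" for n
    proof (induction n)
      case (Suc n)
      have "rho g (s n) = s (Suc n)" using gc by (simp add: rho_def s_def algebra_simps)
      then show ?case using orbit_rho[OF g Suc] by simp
    qed (use t1 in \<open>simp add: s_def\<close>)
    have "lam g \<noteq> 0" using lam_inv[OF g] by auto
    have "inj s"
    proof (rule injI)
      fix m n assume "s m = s n"
      then have "lam g ^ m = lam g ^ n" using t1(2) by (simp add: s_def)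
      then have "\<bar>lam g\<bar> ^ m = \<bar>lam g\<bar> ^ n" by (metis power_abs)
      moreover have "0 < \<bar>lam g\<bar>" using \<open>lam g \<noteq> 0\<close> by simp
      ultimately show "m = n"
        using lt by (metis power_strict_decreasing_iff less_irrefl linorder_neqE_nat)
    qed
    moreover have "range s \<subseteq> orbit t \<inter> {-(\<bar>c\<bar> + \<bar>t1 - c\<bar>)..\<bar>c\<bar> + \<bar>t1 - c\<bar>}"
    proof -
      have "\<bar>s n\<bar> \<le> \<bar>c\<bar> + \<bar>t1 - c\<bar>" for n
      proof -
        have "\<bar>lam g\<bar> ^ n * \<bar>t1 - c\<bar> \<le> 1 * \<bar>t1 - c\<bar>"
          using lt by (intro mult_right_mono power_le_one) auto
        then show ?thesis
          using abs_triangle_ineq[of c "lam g ^ n * (t1 - c)"] by (simp add: s_def abs_mult power_abs)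
      qed
      then have "s n \<in> {-(\<bar>c\<bar> + \<bar>t1 - c\<bar>)..\<bar>c\<bar> + \<bar>t1 - c\<bar>}" for n
        by (metis abs_le_iff atLeastAtMost_iff minus_le_iff)
      then show ?thesis using s by blast
    qed
    ultimately show False using fin finite_subset range_inj_infinite by blast
  qed
  \<comment> \<open>An expansion has a contraction as its inverse, so excluding contractions
    excludes both.\<close>
  have "\<bar>lam g\<bar> * \<bar>lam (inv g)\<bar> = 1" using lam_inv[OF \<open>g \<in> deck\<close>] by (metis abs_mult abs_one)
  moreover have "\<bar>lam g\<bar> \<ge> 1" "\<bar>lam (inv g)\<bar> \<ge> 1"
    using no_contraction[OF \<open>g \<in> deck\<close>] no_contraction[OF deck_inv[OF \<open>g \<in> deck\<close>]] by linarith+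
  ultimately show ?thesis
    by (metis mult_left_mono mult.right_neutral order.antisym abs_ge_zero)
qed

text \<open>The kernel of the character \<open>lam\<close>, that is, the elements acting on the leaf
  space by translations.\<close>

definition deck1 :: "('e \<Rightarrow> 'e) set" where
  "deck1 = {g \<in> deck. lam g = 1}"

lemma deck1_compose: "g \<in> deck1 \<Longrightarrow> h \<in> deck1 \<Longrightarrow> (\<lambda>x. g (h x)) \<in> deck1"
  by (auto simp: deck1_def deck_compose lam_compose)

lemma deck1_inv: "g \<in> deck1 \<Longrightarrow> inv g \<in> deck1"
  using lam_inv by (force simp: deck1_def deck_inv)

lemma deck1_id: "(\<lambda>x. x) \<in> deck1"
  using deck_id by (simp add: deck1_def lam_def linear_part_def)

text \<open>On \<open>deck1\<close> the map \<open>mu\<close> is a homomorphism into the additive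
  reals. Its image, shifted by \<open>t\<close>, lies in the orbit of \<open>t\<close> and so is
  locally finite; it is nonzero because the action on the leaf space has no fixed point.\<close>

lemma mu_deck1_cyclic:
  assumes fin: "\<And>r. finite (orbit t \<inter> {-r..r})"
  obtains \<tau> where "\<tau> > 0" "mu ` deck1 = {of_int k * \<tau> | k :: int. True}"
proof -
  have minus: "lam g = -1" if "g \<in> deck" "g \<notin> deck1" for g
    using lam_unit[OF fin that(1)] that by (auto simp: deck1_def abs_if split: if_splits)
  have "\<exists>g\<in>deck1. mu g \<noteq> 0"
  proof (rule ccontr)
    assume "\<not> ?thesis"
    then have 0: "mu g = 0" if "g \<in> deck1" for g using that by blast
    have fix1: "rho g t = t" if "g \<in> deck1" for g t using 0[OF that] that by (simp add: rho_def deck1_def)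
    show False
    proof (cases "deck \<subseteq> deck1")
      case True
      then show ?thesis using fix1 no_fixed_level[of 0] by blast
    next
      case False
      then obtain s where s: "s \<in> deck" "s \<notin> deck1" by blast
      \<comment> \<open>If \<open>deck1\<close> acted trivially, every other element would act as
        the same reflection as \<open>s\<close>, whose centre is \<open>mu s / 2\<close>.\<close>
      have "rho g (mu s / 2) = mu s / 2" if g: "g \<in> deck" for g
      proof (cases "g \<in> deck1")
        case False
        have "(\<lambda>x. g (s x)) \<in> deck1"
          using deck_compose[OF g s(1)] lam_compose[OF g s(1)] minus[OF g False] minus[OF s] by (simp add: deck1_def)
        then have "lam g * mu s + mu g = 0" using 0 mu_compose[OF g s(1)] by simp
        then show ?thesis using minus[OF g False] by (simp add: rho_def)
      qed (rule fix1)
      then show ?thesis using no_fixed_level[of "mu s / 2"] by blast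
    qed
  qed
  then obtain x0 where x0: "x0 \<in> mu ` deck1" "x0 \<noteq> 0" by blast
  have diff: "x - y \<in> mu ` deck1" if xy: "x \<in> mu ` deck1" "y \<in> mu ` deck1" for x y
  proof -
    obtain g h where gh: "g \<in> deck1" "h \<in> deck1" "x = mu g" "y = mu h" using xy by blast
    have d: "g \<in> deck" "h \<in> deck" "lam g = 1" "lam h = 1" using gh by (auto simp: deck1_def)
    have "rho h (rho (inv h) 0) = 0" using rho_inv(2)[OF d(2)] .
    then have "mu (inv h) = - mu h" using d(4) by (simp add: rho_def)
    then have "mu (\<lambda>x. g (inv h x)) = x - y"
      using mu_compose[OF d(1) deck_inv[OF d(2)]] gh d by simp
    then show ?thesis using deck1_compose[OF gh(1) deck1_inv[OF gh(2)]] by (metis imageI)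
  qed
  have "finite (mu ` deck1 \<inter> {-r..r})" for r
  proof -
    have "(+) t ` (mu ` deck1 \<inter> {-r..r}) \<subseteq> orbit t \<inter> {-(r + \<bar>t\<bar>)..r + \<bar>t\<bar>}"
    proof clarify
      fix g assume g: "g \<in> deck1" "mu g \<in> {-r..r}"
      then have "t + mu g = rho g t" "g \<in> deck" by (auto simp: deck1_def rho_def)
      moreover have "t + mu g \<in> {-(r + \<bar>t\<bar>)..r + \<bar>t\<bar>}" using g(2) by auto
      ultimately show "t + mu g \<in> orbit t \<inter> {-(r + \<bar>t\<bar>)..r + \<bar>t\<bar>}" by (auto simp: orbit_def)
    qed
    then have "finite ((+) t ` (mu ` deck1 \<inter> {-r..r}))" using fin finite_subset by blast
    then show ?thesis by (rule finite_imageD) auto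
  qed
  then show thesis using discrete_real_subgroup_cyclic[OF diff _ x0] that by blast
qed

text \<open>Each coset of \<open>deck1\<close> contributes a subset of one arithmetic progression of
  step \<tau>, and there are at most two cosets.\<close>

lemma orbit_finite_all:
  assumes fin: "\<And>r. finite (orbit t \<inter> {-r..r})"
  shows "finite (orbit t' \<inter> {-r..r})"
proof -
  obtain \<tau> where \<tau>: "\<tau> > 0" "mu ` deck1 = {of_int k * \<tau> | k :: int. True}"
    using mu_deck1_cyclic[OF fin] by blast
  define L where "L c = {c + of_int k * \<tau> | k :: int. True}" for c
  have L1: "rho g c \<in> L c" if "g \<in> deck1" for g c
  proof -
    have "mu g \<in> mu ` deck1" using that by blast
    then have "mu g \<in> {of_int k * \<tau> | k :: int. True}" unfolding \<tau>(2) .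
    then show ?thesis using that by (auto simp: L_def rho_def deck1_def)
  qed
  have "\<exists>c. orbit t' \<subseteq> L t' \<union> L c"
  proof (cases "deck \<subseteq> deck1")
    case True
    then show ?thesis using L1 by (auto simp: orbit_def)
  next
    case False
    then obtain s where s: "s \<in> deck" "s \<notin> deck1" by blast
    have minus: "lam g = -1" if "g \<in> deck" "g \<notin> deck1" for g
      using lam_unit[OF fin that(1)] that by (auto simp: deck1_def abs_if split: if_splits)
    have "rho g t' \<in> L t' \<union> L (rho s t')" if g: "g \<in> deck" for g
    proof (cases "g \<in> deck1")
      case False
      let ?k = "\<lambda>x. g (inv s x)"
      have si: "inv s \<in> deck" "lam (inv s) = -1" using deck_inv[OF s(1)] lam_inv[OF s(1)] minus[OF s] by auto
      have "?k \<in> deck1"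
        using deck_compose[OF g si(1)] lam_compose[OF g si(1)] minus[OF g False] si(2) by (simp add: deck1_def)
      moreover have "rho g t' = rho ?k (rho s t')"
        using rho_compose[OF g si(1)] rho_inv(1)[OF s(1)] by simp
      ultimately show ?thesis using L1 by simp
    qed (use L1 in blast)
    then show ?thesis by (auto simp: orbit_def)
  qed
  then obtain c where "orbit t' \<subseteq> L t' \<union> L c" by blast
  then have "orbit t' \<inter> {-r..r} \<subseteq> (L t' \<inter> {-r..r}) \<union> (L c \<inter> {-r..r})" by blast
  then show ?thesis
    unfolding L_def using finite_arithmetic_progression_Icc[OF \<tau>(1)] finite_subset by (metis (no_types, lifting) finite_UnI)
qed

end

section \<open>Leaves\<close>

context affine_foliation
begin

text \<open>\<open>L\<close> stands for the leaf topology of \<open>M\<close>. Only this description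
  of its open sets in Euclidean coordinates is used, with plaques cut out of balls by the
  levels.\<close>

context
  fixes L :: "'a topology"
  assumes openin_L: "\<And>S. openin L S \<longleftrightarrow> S \<subseteq> topspace M \<and>
    (\<forall>x. Q x \<in> S \<longrightarrow> (\<exists>e>0. \<forall>z\<in>ball x e. a \<bullet> z = a \<bullet> x \<longrightarrow> Q z \<in> S))"
begin

lemma topspace_L: "topspace L = topspace M"
proof
  show "topspace L \<subseteq> topspace M" using openin_L[of "topspace L"] by simp
  have "openin L (topspace M)" unfolding openin_L using zero_less_one by (auto intro!: exI[of _ 1])
  then show "topspace M \<subseteq> topspace L" by (rule openin_subset)
qed

lemma continuous_map_level_L: "continuous_map (top_of_set {x. a \<bullet> x = t}) L Q"
  unfolding continuous_map_def
proof (intro conjI allI impI)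
  show "Q \<in> topspace (top_of_set {x. a \<bullet> x = t}) \<rightarrow> topspace L" by (simp add: topspace_L)
  fix S assume S: "openin L S"
  show "openin (top_of_set {x. a \<bullet> x = t}) {x \<in> topspace (top_of_set {x. a \<bullet> x = t}). Q x \<in> S}"
    unfolding openin_euclidean_subtopology_iff
  proof (intro conjI ballI)
    fix x assume "x \<in> {x \<in> topspace (top_of_set {x. a \<bullet> x = t}). Q x \<in> S}"
    then have x: "a \<bullet> x = t" "Q x \<in> S" by auto
    then obtain e where "e > 0" "\<forall>z\<in>ball x e. a \<bullet> z = a \<bullet> x \<longrightarrow> Q z \<in> S"
      using S unfolding openin_L by blast
    then show "\<exists>e>0. \<forall>z\<in>{x. a \<bullet> x = t}. dist z x < e \<longrightarrow>
        z \<in> {x \<in> topspace (top_of_set {x. a \<bullet> x = t}). Q x \<in> S}"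
      using x by (intro exI[of _ e]) (auto simp: dist_commute)
  qed auto
qed

text \<open>A point over this set need not lie on level \<open>t\<close>; an element of
  \<open>deck\<close> moves it there and maps its plaque to a plaque. With growing \<open>r\<close>
  these sets exhaust a leaf, which is how compactness of a leaf is tested.\<close>

lemma openin_L_leaf_ball: "openin L (Q ` ({x. a \<bullet> x = t} \<inter> ball 0 r))"
  unfolding openin_L
proof (intro conjI allI impI)
  show "Q ` ({x. a \<bullet> x = t} \<inter> ball 0 r) \<subseteq> topspace M" by auto
  fix x assume "Q x \<in> Q ` ({x. a \<bullet> x = t} \<inter> ball 0 r)"
  then obtain y where y: "Q x = Q y" "a \<bullet> y = t" "norm y < r" by auto
  obtain g where g: "g \<in> deck" "g x = y" using deck_transitive[OF y(1)] by blast
  have "open (g -` ball 0 r)"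
    using deckD(1)[OF g(1)] by (intro open_vimage affine_fun_imp_continuous_on open_ball)
  then obtain e where e: "e > 0" "ball x e \<subseteq> g -` ball 0 r"
    using g(2) y(3) openE[of "g -` ball 0 r" x] by auto
  have "Q z \<in> Q ` ({x. a \<bullet> x = t} \<inter> ball 0 r)" if z: "z \<in> ball x e" "a \<bullet> z = a \<bullet> x" for z
  proof -
    have "a \<bullet> g z = a \<bullet> g x" using z(2) inner_deck[OF g(1)] by simp
    then have "g z \<in> {x. a \<bullet> x = t} \<inter> ball 0 r" using e(2) z(1) g(2) y(2) by auto
    then show ?thesis using deckD(3)[OF g(1), of z] by (metis imageI)
  qed
  then show "\<exists>e>0. \<forall>z\<in>ball x e. a \<bullet> z = a \<bullet> x \<longrightarrow> Q z \<in> Q ` ({x. a \<bullet> x = t} \<inter> ball 0 r)"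
    using e(1) by blast
qed

lemma openin_L_leaf: "openin L (Q ` {x. a \<bullet> x = t})"
proof -
  have "{x. a \<bullet> x = t} = (\<Union>n. {x. a \<bullet> x = t} \<inter> ball 0 (real n))"
    using reals_Archimedean2 by auto
  then have "Q ` {x. a \<bullet> x = t} = (\<Union>n. Q ` ({x. a \<bullet> x = t} \<inter> ball 0 (real n)))" by blast
  then show ?thesis using openin_L_leaf_ball by (auto intro!: openin_Union)
qed

lemma leaf_eq:
  assumes "Q x = Q y"
  shows "Q ` {z. a \<bullet> z = a \<bullet> x} \<subseteq> Q ` {z. a \<bullet> z = a \<bullet> y}"
proof clarify
  fix z assume z: "a \<bullet> z = a \<bullet> x"
  obtain g where g: "g \<in> deck" "g x = y" using deck_transitive[OF assms] by blast
  have "a \<bullet> g z = a \<bullet> y" using z g inner_deck[OF g(1)] by metis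
  then show "Q z \<in> Q ` {z. a \<bullet> z = a \<bullet> y}" using deckD(3)[OF g(1), of z] by (auto intro!: rev_image_eqI[of "g z"])
qed

text \<open>The image of a level is connected as the image of a hyperplane. It is open, and also
  closed, because its complement is a union of other such images.\<close>

lemma connected_component_L: "connected_component_of_set L (Q x) = Q ` {z. a \<bullet> z = a \<bullet> x}"
proof
  let ?F = "Q ` {z. a \<bullet> z = a \<bullet> x}"
  have "connectedin (top_of_set {z. a \<bullet> z = a \<bullet> x}) {z. a \<bullet> z = a \<bullet> x}"
    by (simp add: connectedin_subtopology convex_connected convex_hyperplane)
  then have "connectedin L ?F" by (rule connectedin_continuous_map_image[OF continuous_map_level_L])
  then show "?F \<subseteq> connected_component_of_set L (Q x)"
    by (intro connected_component_of_maximal) auto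
  have "topspace L - ?F = (\<Union>y\<in>{y. Q y \<notin> ?F}. Q ` {z. a \<bullet> z = a \<bullet> y})"
  proof (intro equalityI subsetI)
    fix w assume w: "w \<in> topspace L - ?F"
    then have "w \<in> range Q" using topspace_L Q_onto by simp
    then obtain y where "w = Q y" by blast
    then show "w \<in> (\<Union>y\<in>{y. Q y \<notin> ?F}. Q ` {z. a \<bullet> z = a \<bullet> y})" using w by blast
  next
    fix w assume "w \<in> (\<Union>y\<in>{y. Q y \<notin> ?F}. Q ` {z. a \<bullet> z = a \<bullet> y})"
    then obtain y z where yz: "Q y \<notin> ?F" "w = Q z" "a \<bullet> z = a \<bullet> y" by blast
    have "w \<notin> ?F"
    proof
      assume "w \<in> ?F"
      then obtain v where v: "Q z = Q v" "a \<bullet> v = a \<bullet> x" using yz(2) by auto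
      have "Q y \<in> Q ` {u. a \<bullet> u = a \<bullet> z}" using yz(3) by auto
      then have "Q y \<in> ?F" using leaf_eq[OF v(1)] v(2) by auto
      then show False using yz(1) by blast
    qed
    then show "w \<in> topspace L - ?F" using yz(2) topspace_L by simp
  qed
  then have "openin L (topspace L - ?F)" using openin_L_leaf by (auto intro!: openin_Union)
  then have "closedin L ?F" by (simp add: closedin_def topspace_L image_subset_iff)
  then have "connected_component_of_set L (Q x) \<subseteq> ?F \<or> disjnt (connected_component_of_set L (Q x)) ?F"
    by (rule connectedin_clopen_cases[OF connectedin_connected_component_of _ openin_L_leaf])
  moreover have "Q x \<in> connected_component_of_set L (Q x)" "Q x \<in> ?F"
    using topspace_L by (auto simp: connected_component_of_refl)
  ultimately show "connected_component_of_set L (Q x) \<subseteq> ?F" by (auto simp: disjnt_iff)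
qed

lemma connected_components_L: "connected_components_of L = range (\<lambda>t. Q ` {z. a \<bullet> z = t})"
proof -
  have "connected_components_of L = (\<lambda>x. Q ` {z. a \<bullet> z = a \<bullet> x}) ` UNIV"
    unfolding connected_components_of_def topspace_L Q_onto[symmetric]
    by (simp add: image_image connected_component_L)
  also have "\<dots> = (\<lambda>t. Q ` {z. a \<bullet> z = t}) ` range (\<lambda>x. a \<bullet> x)" by (simp add: image_image)
  also have "range (\<lambda>x. a \<bullet> x) = UNIV"
  proof -
    have "t \<in> range (\<lambda>x. a \<bullet> x)" for t by (rule range_eqI[of _ _ "t *\<^sub>R a"]) simp
    then show ?thesis by blast
  qed
  finally show ?thesis .
qed

text \<open>A finite subcover by images of balls bounds the representatives that each point has on
  level \<open>t\<close>. Conversely, a bound makes the leaf the image of a compact part of the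
  hyperplane.\<close>

lemma compactin_L_leaf: "compactin L (Q ` {x. a \<bullet> x = t}) \<longleftrightarrow> cocompact_level t"
proof
  assume "compactin L (Q ` {x. a \<bullet> x = t})"
  moreover have "Q ` {x. a \<bullet> x = t} \<subseteq> (\<Union>n::nat. Q ` ({x. a \<bullet> x = t} \<inter> ball 0 (real n)))"
  proof clarify
    fix x assume "t = a \<bullet> x"
    moreover obtain n where "norm x < real n" using reals_Archimedean2 by blast
    ultimately show "Q x \<in> (\<Union>n. Q ` ({z. a \<bullet> z = a \<bullet> x} \<inter> ball 0 (real n)))"
      by (intro UN_I[of n] imageI) auto
  qed
  ultimately obtain \<F> where \<F>: "finite \<F>" "\<F> \<subseteq> range (\<lambda>n::nat. Q ` ({x. a \<bullet> x = t} \<inter> ball 0 (real n)))"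
    "Q ` {x. a \<bullet> x = t} \<subseteq> \<Union>\<F>"
    using compactinD[of L "Q ` {x. a \<bullet> x = t}" "range (\<lambda>n::nat. Q ` ({x. a \<bullet> x = t} \<inter> ball 0 (real n)))"]
      openin_L_leaf_ball by (metis (no_types, lifting) imageE)
  then obtain F where F: "finite F" "\<F> = (\<lambda>n::nat. Q ` ({x. a \<bullet> x = t} \<inter> ball 0 (real n))) ` F"
    by (metis finite_subset_image)
  have "\<exists>g\<in>deck. norm (g x) \<le> real (Max F) \<and> a \<bullet> g x = t" if x: "a \<bullet> x = t" for x
  proof -
    have "Q x \<in> \<Union>\<F>" using \<F>(3) x by blast
    then obtain n y where n: "n \<in> F" "norm y < real n" "Q x = Q y" "a \<bullet> y = t" using F(2) by auto
    have "n \<le> Max F" using F(1) n(1) by simp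
    then have "norm y \<le> real (Max F)" using n(2) by linarith
    then show ?thesis using deck_transitive[OF n(3)] n(4) by metis
  qed
  then show "cocompact_level t" unfolding cocompact_level_def by blast
next
  assume "cocompact_level t"
  then obtain R where R: "\<And>x. a \<bullet> x = t \<Longrightarrow> \<exists>g\<in>deck. norm (g x) \<le> R \<and> a \<bullet> g x = t"
    unfolding cocompact_level_def by blast
  have "Q x \<in> Q ` ({x. a \<bullet> x = t} \<inter> cball 0 R)" if x: "a \<bullet> x = t" for x
  proof -
    obtain g where g: "g \<in> deck" "norm (g x) \<le> R" "a \<bullet> g x = t" using R[OF x] by blast
    then have "g x \<in> {x. a \<bullet> x = t} \<inter> cball 0 R" by simp
    then show ?thesis using deckD(3)[OF g(1), of x] by (metis imageI)
  qed
  then have "Q ` {x. a \<bullet> x = t} = Q ` ({x. a \<bullet> x = t} \<inter> cball 0 R)" by blast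
  moreover have "compact ({x. a \<bullet> x = t} \<inter> cball 0 R)"
    by (intro closed_Int_compact closed_hyperplane compact_cball)
  then have "compactin (top_of_set {x. a \<bullet> x = t}) ({x. a \<bullet> x = t} \<inter> cball 0 R)"
    by (simp add: compactin_subtopology)
  ultimately show "compactin L (Q ` {x. a \<bullet> x = t})"
    using image_compactin[OF _ continuous_map_level_L] by metis
qed

end

end

section \<open>The finite cover and the map to the circle\<close>

lemma affine_atlas_transition:
  assumes "affine_atlas M A" "(V, \<phi>) \<in> A" "(W, \<psi>) \<in> A" "x \<in> V" "x \<in> W"
  shows "\<exists>N g. openin M N \<and> x \<in> N \<and> N \<subseteq> V \<inter> W \<and> affine_fun g \<and> bij g \<and> (\<forall>z\<in>N. \<psi> z = g (\<phi> z))"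
proof -
  have *: "\<forall>(V, \<phi>)\<in>A. \<forall>(W, \<psi>)\<in>A. \<forall>x\<in>V \<inter> W. \<exists>N g. openin M N \<and> x \<in> N \<and> N \<subseteq> V \<inter> W \<and>
      affine_fun g \<and> bij g \<and> (\<forall>z\<in>N. \<psi> z = g (\<phi> z))"
    using assms(1) unfolding affine_atlas_def by (elim conjE)
  note 1 = bspec[OF * assms(2), unfolded prod.case]
  note 2 = bspec[OF 1 assms(3), unfolded prod.case]
  show ?thesis using bspec[OF 2] assms(4,5) by (simp only: Int_iff)
qed

text \<open>The transitions upstairs are those of \<open>A\<close>, restricted to preimages under
  \<open>p\<close>.\<close>

lemma affine_atlas_pullback:
  assumes at: "affine_atlas M A" and cov: "covering_map X M p"
  shows "affine_atlas X (pullback_atlas X M p A)"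
proof -
  have pc: "continuous_map X M p" using cov by (auto simp: covering_map_def)
  have charts: "openin X V \<and> open (\<phi> ` V) \<and> homeomorphic_map (subtopology X V) (top_of_set (\<phi> ` V)) \<phi>"
    if V: "(V, \<phi>) \<in> pullback_atlas X M p A" for V \<phi>
  proof -
    obtain W \<psi> where W: "\<phi> = (\<lambda>x. \<psi> (p x))" "(W, \<psi>) \<in> A" "openin X V" "openin M (p ` V)" "p ` V \<subseteq> W"
      "homeomorphic_map (subtopology X V) (subtopology M (p ` V)) p"
      using V unfolding pullback_atlas_def by auto
    note ch = affine_atlasD[OF at W(2)]
    have "open (\<psi> ` (p ` V))" using ch(5) W(4,5) by blast
    moreover have "homeomorphic_map (subtopology M (p ` V)) (top_of_set (\<psi> ` (p ` V))) \<psi>"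
      using homeomorphic_map_onto_open_image(2)[OF ch(3) ch(1) _ W(4,5)] ch(2) by simp
    then have "homeomorphic_map (subtopology X V) (top_of_set (\<psi> ` (p ` V))) (\<psi> \<circ> p)"
      by (rule homeomorphic_map_compose[OF W(6)])
    ultimately show ?thesis using W(1,3) by (simp add: o_def image_image)
  qed
  moreover have "\<Union> (fst ` pullback_atlas X M p A) = topspace X"
  proof
    show "\<Union> (fst ` pullback_atlas X M p A) \<subseteq> topspace X"
      unfolding pullback_atlas_def using openin_subset by fastforce
    show "topspace X \<subseteq> \<Union> (fst ` pullback_atlas X M p A)"
    proof
      fix x assume x: "x \<in> topspace X"
      then have "p x \<in> topspace M" using continuous_map_image_subset_topspace[OF pc] by blast
      then obtain V \<phi> where V: "(V, \<phi>) \<in> A" "p x \<in> V" using affine_atlas_chart[OF at] by blast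
      obtain V' where V': "(V', \<lambda>z. \<phi> (p z)) \<in> pullback_atlas X M p A" "openin X V'" "x \<in> V'"
        "p ` V' \<subseteq> V" "inj_on p V'"
        by (rule covering_map_pullback_chart[OF at cov x V])
      then have "V' \<in> fst ` pullback_atlas X M p A" by force
      then show "x \<in> \<Union> (fst ` pullback_atlas X M p A)" using V'(3) by blast
    qed
  qed
  moreover have "\<exists>N g. openin X N \<and> x \<in> N \<and> N \<subseteq> V \<inter> W \<and> affine_fun g \<and> bij g \<and> (\<forall>z\<in>N. \<psi> z = g (\<phi> z))"
    if V: "(V, \<phi>) \<in> pullback_atlas X M p A" and W: "(W, \<psi>) \<in> pullback_atlas X M p A" and x: "x \<in> V \<inter> W"
    for V \<phi> W \<psi> x
  proof -
    obtain V0 \<phi>0 where V0: "\<phi> = (\<lambda>x. \<phi>0 (p x))" "(V0, \<phi>0) \<in> A" "openin X V" "p ` V \<subseteq> V0"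
      using V unfolding pullback_atlas_def by auto
    obtain W0 \<psi>0 where W0: "\<psi> = (\<lambda>x. \<psi>0 (p x))" "(W0, \<psi>0) \<in> A" "openin X W" "p ` W \<subseteq> W0"
      using W unfolding pullback_atlas_def by auto
    have px: "p x \<in> V0" "p x \<in> W0" using x V0(4) W0(4) by auto
    obtain N g where N: "openin M N" "p x \<in> N" "affine_fun g" "bij g" "\<forall>z\<in>N. \<psi>0 z = g (\<phi>0 z)"
      using affine_atlas_transition[OF at V0(2) W0(2) px] by blast
    have "openin X (V \<inter> W \<inter> {z \<in> topspace X. p z \<in> N})"
      using V0(3) W0(3) openin_continuous_map_preimage[OF pc N(1)] by (intro openin_Int)
    moreover have "x \<in> topspace X" using x openin_subset[OF V0(3)] by blast
    ultimately show ?thesis using x N V0(1) W0(1)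
      by (intro exI[of _ "V \<inter> W \<inter> {z \<in> topspace X. p z \<in> N}"] exI[of _ g]) auto
  qed
  ultimately show ?thesis unfolding affine_atlas_def by (intro conjI ballI case_prodI2) simp_all
qed

section \<open>The circle and its charts\<close>

lemma translation_orbit_self: "x \<in> translation_orbit \<tau> x"
  unfolding translation_orbit_def by (auto intro!: exI[of _ 0])

lemma translation_orbit_add: "translation_orbit \<tau> (x + of_int k * \<tau>) = translation_orbit \<tau> x"
proof
  show "translation_orbit \<tau> (x + of_int k * \<tau>) \<subseteq> translation_orbit \<tau> x"
    unfolding translation_orbit_def
  proof clarify
    fix j :: int
    have "x + of_int k * \<tau> + of_int j * \<tau> = x + of_int (k + j) * \<tau>" by (simp add: algebra_simps)
    then show "\<exists>i::int. x + of_int k * \<tau> + of_int j * \<tau> = x + of_int i * \<tau> \<and> True" by blast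
  qed
  show "translation_orbit \<tau> x \<subseteq> translation_orbit \<tau> (x + of_int k * \<tau>)"
    unfolding translation_orbit_def
  proof clarify
    fix j :: int
    have "x + of_int j * \<tau> = x + of_int k * \<tau> + of_int (j - k) * \<tau>" by (simp add: algebra_simps)
    then show "\<exists>i::int. x + of_int j * \<tau> = x + of_int k * \<tau> + of_int i * \<tau> \<and> True" by blast
  qed
qed

text \<open>A chart picks from each orbit the point \<open>s + k s * \<tau>\<close> with an integer
  \<open>k s\<close>. Keeping both \<open>s\<close> and the chart value within half a period of
  their values at \<open>t\<close> lets \<open>k\<close> vary by less than 1, so it is
  constant.\<close>

lemma circle_chart_translation:
  assumes W: "(W, \<psi>) \<in> circle_atlas \<tau>" and "\<tau> > 0" and t: "translation_orbit \<tau> t \<in> W"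
  obtains T k where "open T" "t \<in> T"
    "\<And>s. s \<in> T \<Longrightarrow> translation_orbit \<tau> s \<in> W \<and> \<psi> (translation_orbit \<tau> s) = s + of_int k * \<tau>"
proof -
  let ?o = "translation_orbit \<tau>"
  have W': "openin (circle \<tau>) W" "\<forall>c\<in>W. \<psi> c \<in> c"
    "homeomorphic_map (subtopology (circle \<tau>) W) (top_of_set (\<psi> ` W)) \<psi>"
    using W by (auto simp: circle_atlas_def)
  have oW: "open (?o -` W)" and Wr: "W \<subseteq> range ?o"
    using W'(1) by (auto simp: circle_def openin_quotient_topology vimage_def)
  have "\<exists>k::int. \<psi> (?o s) = s + of_int k * \<tau>" if "?o s \<in> W" for s
    using W'(2) that unfolding translation_orbit_def by fastforce
  then obtain k where k: "\<And>s. ?o s \<in> W \<Longrightarrow> \<psi> (?o s) = s + of_int (k s :: int) * \<tau>" by metis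
  define B where "B = {y. \<bar>y - \<psi> (?o t)\<bar> < \<tau> / 2}"
  have "B = ball (\<psi> (?o t)) (\<tau> / 2)" by (auto simp: B_def dist_real_def abs_minus_commute)
  then have "open B" by simp
  then have "openin (top_of_set (\<psi> ` W)) (\<psi> ` W \<inter> B)" by blast
  then have "openin (subtopology (circle \<tau>) W) {c \<in> topspace (subtopology (circle \<tau>) W). \<psi> c \<in> \<psi> ` W \<inter> B}"
    by (rule openin_continuous_map_preimage[OF homeomorphic_imp_continuous_map[OF W'(3)]])
  then have "openin (circle \<tau>) {c \<in> topspace (subtopology (circle \<tau>) W). \<psi> c \<in> \<psi> ` W \<inter> B}"
    using W'(1) openin_trans_full by blast
  moreover have "{c \<in> topspace (subtopology (circle \<tau>) W). \<psi> c \<in> \<psi> ` W \<inter> B} = {c \<in> W. \<psi> c \<in> B}"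
    using openin_subset[OF W'(1)] by auto
  ultimately have "openin (circle \<tau>) {c \<in> W. \<psi> c \<in> B}" by simp
  then have oB: "open (?o -` {c \<in> W. \<psi> c \<in> B})"
    by (simp add: circle_def openin_quotient_topology vimage_def)
  define T where "T = ?o -` {c \<in> W. \<psi> c \<in> B} \<inter> ball t (\<tau> / 2)"
  have "open T" unfolding T_def using oB by blast
  moreover have "t \<in> T" using t \<open>\<tau> > 0\<close> by (simp add: T_def B_def)
  moreover have "?o s \<in> W \<and> \<psi> (?o s) = s + of_int (k t) * \<tau>" if "s \<in> T" for s
  proof -
    have s: "?o s \<in> W" "\<bar>\<psi> (?o s) - \<psi> (?o t)\<bar> < \<tau> / 2" "\<bar>s - t\<bar> < \<tau> / 2"
      using that by (auto simp: T_def B_def dist_real_def abs_minus_commute)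
    have "of_int (k s - k t) * \<tau> = (\<psi> (?o s) - \<psi> (?o t)) - (s - t)"
      using k[OF s(1)] k[OF t] by (simp add: algebra_simps)
    then have "\<bar>of_int (k s - k t) * \<tau>\<bar> < \<tau>" using s(2,3) by linarith
    then have "\<bar>of_int (k s - k t)\<bar> * \<tau> < 1 * \<tau>" using \<open>\<tau> > 0\<close> by (simp add: abs_mult)
    then have "\<bar>of_int (k s - k t) :: real\<bar> < 1" using \<open>\<tau> > 0\<close> by (metis mult_less_cancel_right_pos)
    then have "k s = k t" by linarith
    then show ?thesis using k[OF s(1)] s(1) by simp
  qed
  ultimately show thesis using that by blast
qed

section \<open>The quotient by the translation subgroup and its map to the circle\<close>

text \<open>Any \<pi> whose fibres are the \<open>deck1\<close>-orbits will do; its target type is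
  left open, so that the points of the cover can be chosen later.\<close>

locale affine_foliation_cover = affine_foliation M A Q a
  for M :: "'a topology" and A :: "('a, 'e::euclidean_space) atlas" and Q :: "'e \<Rightarrow> 'a" and a :: 'e +
  fixes \<pi> :: "'e \<Rightarrow> 'c"
  assumes proj_eq: "\<pi> x = \<pi> y \<longleftrightarrow> (\<exists>g\<in>deck1. g x = y)"
    and unit: "\<And>g. g \<in> deck \<Longrightarrow> \<bar>lam g\<bar> = 1"
begin

lemma proj_deck1: "g \<in> deck1 \<Longrightarrow> \<pi> (g x) = \<pi> x"
  using proj_eq[of x "g x"] by auto

definition cover_space :: "'c topology" where
  "cover_space = quotient_topology euclidean \<pi>"

definition cover_proj :: "'c \<Rightarrow> 'a" where
  "cover_proj c = Q (SOME x. \<pi> x = c)"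

lemma cover_proj_proj [simp]: "cover_proj (\<pi> x) = Q x"
proof -
  have "\<pi> (SOME y. \<pi> y = \<pi> x) = \<pi> x" by (rule someI_ex) blast
  then obtain g where "g \<in> deck1" "g (SOME y. \<pi> y = \<pi> x) = x" using proj_eq by blast
  then show ?thesis unfolding cover_proj_def by (metis (mono_tags) deck1_def deckD(3) mem_Collect_eq)
qed

lemma openin_cover_space: "openin cover_space S \<longleftrightarrow> S \<subseteq> range \<pi> \<and> open (\<pi> -` S)"
  by (simp add: cover_space_def openin_quotient_topology vimage_def)

lemma topspace_cover_space: "topspace cover_space = range \<pi>"
proof
  show "topspace cover_space \<subseteq> range \<pi>" using openin_cover_space by blast
  have "openin cover_space (range \<pi>)" unfolding openin_cover_space by (simp add: vimage_def)
  then show "range \<pi> \<subseteq> topspace cover_space" by (rule openin_subset)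
qed

lemma continuous_proj: "continuous_map euclidean cover_space \<pi>"
  unfolding continuous_map_def topspace_cover_space by (auto simp: openin_cover_space vimage_def)

lemma open_proj:
  assumes "open S"
  shows "openin cover_space (\<pi> ` S)"
proof -
  have "\<pi> -` (\<pi> ` S) = (\<Union>g\<in>deck1. g -` S)"
  proof (intro equalityI subsetI)
    fix x assume "x \<in> \<pi> -` (\<pi> ` S)"
    then obtain y where "y \<in> S" "\<pi> x = \<pi> y" by auto
    then show "x \<in> (\<Union>g\<in>deck1. g -` S)" using proj_eq by auto
  next
    fix x assume "x \<in> (\<Union>g\<in>deck1. g -` S)"
    then obtain g where "g \<in> deck1" "g x \<in> S" by auto
    then show "x \<in> \<pi> -` (\<pi> ` S)" using proj_deck1[of g x] by (metis image_eqI vimageI)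
  qed
  moreover have "open (g -` S)" if "g \<in> deck1" for g
    using that assms deckD(1) by (auto simp: deck1_def intro!: open_vimage affine_fun_imp_continuous_on)
  ultimately show ?thesis unfolding openin_cover_space by auto
qed

lemma cover_proj_image: "W \<subseteq> range \<pi> \<Longrightarrow> cover_proj ` W = Q ` (\<pi> -` W)"
proof (intro equalityI subsetI)
  fix y assume W: "W \<subseteq> range \<pi>" and "y \<in> cover_proj ` W"
  then obtain x where "\<pi> x \<in> W" "y = Q x" by (auto simp: subset_iff image_iff)
  then show "y \<in> Q ` (\<pi> -` W)" by blast
next
  fix y assume "y \<in> Q ` (\<pi> -` W)"
  then obtain x where "\<pi> x \<in> W" "y = cover_proj (\<pi> x)" by auto
  then show "y \<in> cover_proj ` W" by blast
qed

lemma continuous_cover_proj: "continuous_map cover_space M cover_proj"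
  unfolding continuous_map_def topspace_cover_space
proof (intro conjI allI impI)
  show "cover_proj \<in> range \<pi> \<rightarrow> topspace M" by auto
  fix T assume T: "openin M T"
  have "open (Q -` T)" using openin_continuous_map_preimage[OF Q_cont T] by (simp add: vimage_def)
  moreover have "\<pi> -` {c \<in> range \<pi>. cover_proj c \<in> T} = Q -` T" by auto
  ultimately show "openin cover_space {c \<in> range \<pi>. cover_proj c \<in> T}"
    unfolding openin_cover_space by auto
qed

lemma open_cover_proj: "open_map cover_space M cover_proj"
  unfolding open_map_def using Q_open cover_proj_image openin_cover_space by metis

lemma covering_map_cover_proj: "covering_map cover_space M cover_proj"
  unfolding covering_map_def
proof (intro conjI ballI)
  show "continuous_map cover_space M cover_proj" by (rule continuous_cover_proj)
  show "cover_proj ` topspace cover_space = topspace M"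
    using Q_onto by (simp add: topspace_cover_space image_image)
  fix y assume "y \<in> topspace M"
  then obtain x where x: "y = Q x" using Q_onto by auto
  obtain N where N: "open N" "x \<in> N" "inj_on Q N" using Q_inj_local by blast
  define sheet where "sheet g = \<pi> ` g ` N" for g
  have sheet_open: "openin cover_space (sheet g)" if "g \<in> deck" for g
  proof -
    have "g ` N = inv g -` N" using deckD(4,5)[OF that] by (auto simp: image_iff) metis
    then have "open (g ` N)"
      using N(1) deckD(1)[OF deck_inv[OF that]] by (simp add: open_vimage affine_fun_imp_continuous_on)
    then show ?thesis unfolding sheet_def by (rule open_proj)
  qed
  have sheet_image: "cover_proj ` sheet g = Q ` N" if "g \<in> deck" for g
    using deckD(3)[OF that] by (simp add: sheet_def image_image)
  have sheet_union: "\<Union> (sheet ` deck) = {c \<in> topspace cover_space. cover_proj c \<in> Q ` N}"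
  proof (intro equalityI subsetI)
    fix c assume "c \<in> \<Union> (sheet ` deck)"
    then obtain g v where "g \<in> deck" "v \<in> N" "c = \<pi> (g v)" by (auto simp: sheet_def)
    then show "c \<in> {c \<in> topspace cover_space. cover_proj c \<in> Q ` N}"
      using deckD(3) by (auto simp: topspace_cover_space)
  next
    fix c assume "c \<in> {c \<in> topspace cover_space. cover_proj c \<in> Q ` N}"
    then obtain z v where zv: "c = \<pi> z" "v \<in> N" "Q v = Q z" by (auto simp: topspace_cover_space)
    obtain g where "g \<in> deck" "g v = z" using deck_transitive[OF zv(3)] by blast
    then show "c \<in> \<Union> (sheet ` deck)" using zv by (auto simp: sheet_def)
  qed
  \<comment> \<open>The sheets are indexed by \<open>deck\<close> with repetition: sheets that meet
    coincide, since by freeness their indices differ by an element of \<open>deck1\<close>.\<close>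
  have sheet_disjoint: "sheet g \<subseteq> sheet g'"
    if g: "g \<in> deck" "g' \<in> deck" "c \<in> sheet g" "c \<in> sheet g'" for g g' c
  proof -
    obtain v v' where v: "v \<in> N" "v' \<in> N" "c = \<pi> (g v)" "c = \<pi> (g' v')" using g by (auto simp: sheet_def)
    then have "Q v = Q v'" using deckD(3)[OF g(1)] deckD(3)[OF g(2)] by (metis cover_proj_proj)
    then have vv: "v = v'" using inj_onD[OF N(3)] v by blast
    obtain h where h: "h \<in> deck1" "h (g v) = g' v" using v(3,4) vv proj_eq by metis
    have "(\<lambda>x. h (g x)) = g'"
      using deck_free[OF deck_compose g(2), of h g v] h g(1) by (auto simp: deck1_def)
    then have "\<pi> (g u) = \<pi> (g' u)" for u using proj_deck1[OF h(1), of "g u"] by auto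
    then show ?thesis by (auto simp: sheet_def)
  qed
  show "\<exists>T. y \<in> T \<and> openin M T \<and> (\<exists>\<V>. \<Union> \<V> = {x \<in> topspace cover_space. cover_proj x \<in> T} \<and>
      (\<forall>V\<in>\<V>. openin cover_space V) \<and> pairwise disjnt \<V> \<and>
      (\<forall>V\<in>\<V>. homeomorphic_map (subtopology cover_space V) (subtopology M T) cover_proj))"
  proof (intro exI[of _ "Q ` N"] conjI exI[of _ "sheet ` deck"] ballI)
    show "y \<in> Q ` N" using x N(2) by blast
    show "openin M (Q ` N)" using Q_open N(1) by blast
    show "pairwise disjnt (sheet ` deck)"
    proof (rule pairwiseI)
      fix S S' assume S: "S \<in> sheet ` deck" "S' \<in> sheet ` deck" "S \<noteq> S'"
      show "disjnt S S'"
      proof (rule ccontr)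
        assume "\<not> disjnt S S'"
        then obtain c where "c \<in> S" "c \<in> S'" by (auto simp: disjnt_iff)
        then have "S \<subseteq> S'" "S' \<subseteq> S" using sheet_disjoint S(1,2) by blast+
        then show False using S(3) by blast
      qed
    qed
  next
    fix S assume "S \<in> sheet ` deck"
    then obtain g where g: "g \<in> deck" "S = sheet g" by blast
    show So: "openin cover_space S" using sheet_open g by blast
    show "homeomorphic_map (subtopology cover_space S) (subtopology M (Q ` N)) cover_proj"
    proof (rule bijective_open_imp_homeomorphic_map)
      have St: "topspace (subtopology cover_space S) = S" using openin_subset[OF So] by auto
      have im: "cover_proj ` S = Q ` N" using sheet_image g by blast
      show "continuous_map (subtopology cover_space S) (subtopology M (Q ` N)) cover_proj"
        using continuous_map_from_subtopology[OF continuous_cover_proj, of S] im St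
        by (auto simp: continuous_map_in_subtopology)
      show "open_map (subtopology cover_space S) (subtopology M (Q ` N)) cover_proj"
        using open_map_from_subtopology[OF open_cover_proj So] im St
        by (intro open_map_into_subtopology) auto
      show "cover_proj ` topspace (subtopology cover_space S) = topspace (subtopology M (Q ` N))"
        unfolding St im by auto
      show "inj_on cover_proj (topspace (subtopology cover_space S))"
        unfolding St
      proof (rule inj_onI)
        fix c c' assume c: "c \<in> S" "c' \<in> S" "cover_proj c = cover_proj c'"
        obtain v v' where v: "v \<in> N" "v' \<in> N" "c = \<pi> (g v)" "c' = \<pi> (g v')"
          using c(1,2) g by (auto simp: sheet_def)
        then have "Q v = Q v'" using c(3) deckD(3)[OF g(1)] by simp
        then show "c = c'" using inj_onD[OF N(3)] v by blast
      qed
    qed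
  qed (use sheet_union in auto)
qed

text \<open>The fibre consists of the points \<open>\<pi> (g x)\<close>, each determined by the
  coset of \<open>g\<close>; as \<open>lam\<close> takes only the values 1 and -1, there are at most
  two cosets.\<close>

lemma finite_cover_fibre: "finite {c \<in> topspace cover_space. cover_proj c = y}"
proof (cases "{c \<in> topspace cover_space. cover_proj c = y} = {}")
  case False
  then obtain x where x: "Q x = y" by (auto simp: topspace_cover_space)
  have minus: "lam g = -1" if "g \<in> deck" "g \<notin> deck1" for g
    using unit[OF that(1)] that by (auto simp: deck1_def abs_if split: if_splits)
  have "\<exists>s. \<forall>g\<in>deck. \<pi> (g x) \<in> {\<pi> x, \<pi> (s x)}"
  proof (cases "deck \<subseteq> deck1")
    case True
    then have "\<forall>g\<in>deck. \<pi> (g x) = \<pi> x" using proj_deck1 by blast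
    then show ?thesis by auto
  next
    case False
    then obtain s where s: "s \<in> deck" "s \<notin> deck1" by blast
    have si: "inv s \<in> deck" "lam (inv s) = -1" using deck_inv[OF s(1)] lam_inv[OF s(1)] minus[OF s] by auto
    have "\<pi> (g x) \<in> {\<pi> x, \<pi> (s x)}" if g: "g \<in> deck" for g
    proof (cases "g \<in> deck1")
      case False
      have "(\<lambda>x. g (inv s x)) \<in> deck1"
        using deck_compose[OF g si(1)] lam_compose[OF g si(1)] minus[OF g False] si(2) by (simp add: deck1_def)
      moreover have "g (inv s (s x)) = g x" using deckD(4)[OF s(1)] by simp
      ultimately have "\<pi> (s x) = \<pi> (g x)" using proj_deck1 by metis
      then show ?thesis by simp
    qed (simp add: proj_deck1)
    then show ?thesis by blast
  qed
  then obtain s where s: "\<And>g. g \<in> deck \<Longrightarrow> \<pi> (g x) \<in> {\<pi> x, \<pi> (s x)}" by blast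
  have "{c \<in> topspace cover_space. cover_proj c = y} \<subseteq> {\<pi> x, \<pi> (s x)}"
  proof
    fix c assume "c \<in> {c \<in> topspace cover_space. cover_proj c = y}"
    then obtain z where z: "c = \<pi> z" "Q x = Q z" using x by (auto simp: topspace_cover_space)
    then show "c \<in> {\<pi> x, \<pi> (s x)}" using s deck_transitive[OF z(2)] by metis
  qed
  then show ?thesis by (rule finite_subset) simp
next
  case True
  show ?thesis unfolding True by simp
qed

lemma finite_affine_cover_cover_space: "finite_affine_cover cover_space cover_proj M A"
  unfolding finite_affine_cover_def affine_manifold_def
proof (intro conjI ballI)
  show "covering_map cover_space M cover_proj" by (rule covering_map_cover_proj)
  show "finite {c \<in> topspace cover_space. cover_proj c = y}" for y by (rule finite_cover_fibre)
  show "Hausdorff_space cover_space" using covering_map_cover_proj haus by (rule covering_map_Hausdorff)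
  have "second_countable (euclidean :: 'e topology)"
  proof -
    obtain \<B> :: "'e set set" where "countable \<B>" "topological_basis \<B>"
      using ex_countable_basis by blast
    then show ?thesis unfolding second_countable_def
      by (intro exI[of _ \<B>]) (auto simp: topological_basis_open elim!: topological_basisE)
  qed
  then show "second_countable cover_space"
    using open_proj by (intro second_countable_open_map_image[OF continuous_proj])
      (auto simp: open_map_def topspace_cover_space)
  have "connectedin cover_space (\<pi> ` UNIV)"
    using connectedin_continuous_map_image[OF continuous_proj, of UNIV] connected_UNIV
    by (simp only: connectedin_iff_connected)
  then show "connected_space cover_space"
    using connectedin_topspace[of cover_space] by (simp add: topspace_cover_space)
  show "affine_atlas cover_space (pullback_atlas cover_space M cover_proj A)"
    using atlas covering_map_cover_proj by (rule affine_atlas_pullback)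
qed

definition circle_map :: "real \<Rightarrow> 'c \<Rightarrow> real set" where
  "circle_map \<tau> c = translation_orbit \<tau> (a \<bullet> (SOME x. \<pi> x = c))"

context
  fixes \<tau> :: real
  assumes \<tau>: "\<tau> > 0" "mu ` deck1 = {of_int k * \<tau> | k :: int. True}"
begin

text \<open>Independence of the chosen representative: an element \<open>g\<close> of
  \<open>deck1\<close> changes \<open>a \<bullet> x\<close> by \<open>mu g\<close>, a multiple of
  \<tau>.\<close>

lemma circle_map_proj [simp]: "circle_map \<tau> (\<pi> x) = translation_orbit \<tau> (a \<bullet> x)"
proof -
  define y where "y = (SOME y. \<pi> y = \<pi> x)"
  have "\<pi> y = \<pi> x" unfolding y_def by (rule someI_ex) blast
  then obtain g where g: "g \<in> deck1" "g y = x" using proj_eq by blast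
  have "mu g \<in> mu ` deck1" using g(1) by blast
  then obtain k :: int where k: "mu g = of_int k * \<tau>" unfolding \<tau>(2) by blast
  have "a \<bullet> x = rho g (a \<bullet> y)" using inner_deck[of g y] g by (simp add: deck1_def)
  also have "\<dots> = a \<bullet> y + of_int k * \<tau>" using g(1) k by (simp add: rho_def deck1_def)
  finally show ?thesis unfolding circle_map_def y_def[symmetric] by (simp add: translation_orbit_add)
qed

lemma affine_map_circle_map:
  "affine_map cover_space (pullback_atlas cover_space M cover_proj A) (circle \<tau>) (circle_atlas \<tau>) (circle_map \<tau>)"
  unfolding affine_map_def
proof (intro conjI)
  have top: "topspace (circle \<tau>) = range (translation_orbit \<tau>)"
  proof
    show "topspace (circle \<tau>) \<subseteq> range (translation_orbit \<tau>)"
      using openin_topspace[of "circle \<tau>"] unfolding circle_def openin_quotient_topology by simp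
    have "openin (circle \<tau>) (range (translation_orbit \<tau>))"
      unfolding circle_def openin_quotient_topology by simp
    then show "range (translation_orbit \<tau>) \<subseteq> topspace (circle \<tau>)" by (rule openin_subset)
  qed
  show "continuous_map cover_space (circle \<tau>) (circle_map \<tau>)"
    unfolding continuous_map_def topspace_cover_space top
  proof (intro conjI allI impI)
    show "circle_map \<tau> \<in> range \<pi> \<rightarrow> range (translation_orbit \<tau>)" by auto
    fix S assume "openin (circle \<tau>) S"
    then have "open (translation_orbit \<tau> -` S)"
      by (simp add: circle_def openin_quotient_topology vimage_def)
    then have "open ((\<lambda>x. a \<bullet> x) -` (translation_orbit \<tau> -` S))"
      by (intro open_vimage continuous_intros)
    moreover have "\<pi> -` {c \<in> range \<pi>. circle_map \<tau> c \<in> S} = (\<lambda>x. a \<bullet> x) -` (translation_orbit \<tau> -` S)"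
      by auto
    ultimately show "openin cover_space {c \<in> range \<pi>. circle_map \<tau> c \<in> S}"
      unfolding openin_cover_space by auto
  qed
  have "\<exists>N' g. openin cover_space N' \<and> c \<in> N' \<and> N' \<subseteq> V' \<and> circle_map \<tau> ` N' \<subseteq> W \<and> affine_fun g \<and>
        (\<forall>z\<in>N'. \<psi> (circle_map \<tau> z) = g (\<phi>' z))"
    if V': "(V', \<phi>') \<in> pullback_atlas cover_space M cover_proj A" and W: "(W, \<psi>) \<in> circle_atlas \<tau>"
      and c: "c \<in> V'" "circle_map \<tau> c \<in> W" for V' \<phi>' W \<psi> c
  proof -
    obtain V \<phi> where V: "\<phi>' = (\<lambda>x. \<phi> (cover_proj x))" "(V, \<phi>) \<in> A" "openin cover_space V'"
      "cover_proj ` V' \<subseteq> V"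
      using V' unfolding pullback_atlas_def by auto
    have V'o: "V' \<subseteq> range \<pi>" "open (\<pi> -` V')" using V(3) by (auto simp: openin_cover_space)
    obtain x where x: "c = \<pi> x" using c(1) V'o(1) by blast
    have "Q x \<in> V" using V(4) c(1) x by (metis cover_proj_proj image_subset_iff)
    then obtain N g where N: "open N" "x \<in> N" "affine_fun g" "bij g" "\<forall>z\<in>N. \<phi> (Q z) = g z"
      using Q_chart[OF V(2)] by blast
    have "translation_orbit \<tau> (a \<bullet> x) \<in> W" using c(2) x by simp
    then obtain T k where T: "open T" "a \<bullet> x \<in> T" "\<And>s. s \<in> T \<Longrightarrow> translation_orbit \<tau> s \<in> W \<and>
        \<psi> (translation_orbit \<tau> s) = s + of_int k * \<tau>"
      using circle_chart_translation[OF W \<tau>(1)] by metis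
    define N2 where "N2 = N \<inter> \<pi> -` V' \<inter> (\<lambda>z. a \<bullet> z) -` T"
    have "open N2" unfolding N2_def
      using N(1) V'o(2) T(1) by (intro open_Int open_vimage[of T] continuous_intros)
    then have "openin cover_space (\<pi> ` N2)" by (rule open_proj)
    moreover have "c \<in> \<pi> ` N2" using x c(1) N(2) T(2) by (auto simp: N2_def)
    moreover have "\<pi> ` N2 \<subseteq> V'" by (auto simp: N2_def)
    moreover have "circle_map \<tau> ` \<pi> ` N2 \<subseteq> W" using T(3) by (auto simp: N2_def)
    \<comment> \<open>The local expression: \<open>inv g\<close> turns the chart of the cover into
      the Euclidean coordinate, \<open>a\<close> measures the level, and the circle chart adds a
      fixed multiple of \<tau>.\<close>
    moreover have "affine_fun (\<lambda>y. a \<bullet> inv g y + of_int k * \<tau>)"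
    proof -
      have "affine_fun (\<lambda>x. a \<bullet> x + of_int k * \<tau>)"
        unfolding affine_fun_def
        by (intro exI[of _ "\<lambda>x. a \<bullet> x"] exI[of _ "of_int k * \<tau>"])
          (auto intro!: linearI simp: inner_add_right)
      then show ?thesis using affine_fun_inv[OF N(3,4)] by (rule affine_fun_compose)
    qed
    moreover have "\<forall>z\<in>\<pi> ` N2. \<psi> (circle_map \<tau> z) = a \<bullet> inv g (\<phi>' z) + of_int k * \<tau>"
    proof clarify
      fix z assume z: "z \<in> N2"
      have "inv g (\<phi>' (\<pi> z)) = z" using N(4,5) z by (simp add: V(1) N2_def bij_is_inj)
      moreover have "\<psi> (circle_map \<tau> (\<pi> z)) = a \<bullet> z + of_int k * \<tau>" using T(3) z by (simp add: N2_def)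
      ultimately show "\<psi> (circle_map \<tau> (\<pi> z)) = a \<bullet> inv g (\<phi>' (\<pi> z)) + of_int k * \<tau>" by simp
    qed
    ultimately show ?thesis by blast
  qed
  then show "\<forall>(V, \<phi>)\<in>pullback_atlas cover_space M cover_proj A. \<forall>(W, \<psi>)\<in>circle_atlas \<tau>.
       \<forall>x\<in>V. circle_map \<tau> x \<in> W \<longrightarrow>
         (\<exists>N' g. openin cover_space N' \<and> x \<in> N' \<and> N' \<subseteq> V \<and> circle_map \<tau> ` N' \<subseteq> W \<and>
           affine_fun g \<and> (\<forall>z\<in>N'. \<psi> (circle_map \<tau> z) = g (\<phi> z)))" by blast
qed

text \<open>Constant maps are affine too, so this is what gives the map to the circle its content:
  levels half a period apart have different images.\<close>

lemma circle_map_not_constant: "\<not> (\<exists>c. \<forall>x\<in>topspace cover_space. circle_map \<tau> x = c)"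
proof
  assume "\<exists>c. \<forall>x\<in>topspace cover_space. circle_map \<tau> x = c"
  then have "circle_map \<tau> (\<pi> 0) = circle_map \<tau> (\<pi> ((\<tau> / 2) *\<^sub>R a))"
    unfolding topspace_cover_space by (metis rangeI)
  then have "translation_orbit \<tau> 0 = translation_orbit \<tau> (\<tau> / 2)" by simp
  then have "\<tau> / 2 \<in> translation_orbit \<tau> 0" using translation_orbit_self by simp
  then obtain k :: int where "\<tau> / 2 = of_int k * \<tau>" by (auto simp: translation_orbit_def)
  then have "of_int (2 * k) = (1 :: real)" using \<tau>(1) by (simp add: field_simps)
  then have "2 * k = 1" by linarith
  then show False by presburger
qed

end

end

section \<open>The developed manifold as an affine quotient\<close>

lemma hyperplane_unit_normal:
  fixes U :: "'e::euclidean_space set"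
  assumes "subspace U" "DIM('e) - dim U = 1"
  obtains a where "norm a = 1" "U = {x. a \<bullet> x = 0}"
proof -
  have "dim U < DIM('e)" using assms(2) by linarith
  then obtain b where b: "b \<noteq> 0" "span U \<subseteq> {x. b \<bullet> x = 0}"
    using lowdim_subset_hyperplane by blast
  have "U = {x. b \<bullet> x = 0}"
  proof (rule subspace_dim_equal[OF assms(1) subspace_hyperplane])
    show "U \<subseteq> {x. b \<bullet> x = 0}" using b(2) span_superset by blast
    show "dim {x. b \<bullet> x = 0} \<le> dim U" using dim_hyperplane[OF b(1)] assms(2) by linarith
  qed
  moreover have "{x. b \<bullet> x = 0} = {x. sgn b \<bullet> x = 0}" using b(1) by (auto simp: sgn_div_norm)
  moreover have "norm (sgn b) = 1" using b(1) by (simp add: norm_sgn)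
  ultimately show thesis using that by blast
qed

text \<open>The bridge from universal cover and development to Euclidean space: with
  \<open>s\<close> inverse to \<open>D\<close>, the quotient map is
  \<open>p \<circ> s\<close>.\<close>

locale developed_affine_manifold =
  fixes M :: "'a topology" and A :: "('a, 'e::euclidean_space) atlas"
    and Mh :: "'b topology" and p :: "'b \<Rightarrow> 'a" and D :: "'b \<Rightarrow> 'e" and s :: "'e \<Rightarrow> 'b"
  assumes at: "affine_atlas M A" and hausM: "Hausdorff_space M" and compM: "compact_space M"
    and cov: "covering_map Mh M p"
    and dev: "developing_map Mh (pullback_atlas Mh M p A) D"
    and Ds: "homeomorphic_maps Mh euclidean D s"
begin

lemma s_mem [simp]: "s y \<in> topspace Mh" and D_s [simp]: "D (s y) = y"
  and s_D: "x \<in> topspace Mh \<Longrightarrow> s (D x) = x"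
  and D_continuous: "continuous_map Mh euclidean D" and s_continuous: "continuous_map euclidean Mh s"
  using Ds by (auto simp: homeomorphic_maps_def continuous_map_def)

lemma open_vimage_s: "openin Mh W \<Longrightarrow> open (s -` W)"
  using openin_continuous_map_preimage[OF s_continuous] by (auto simp: vimage_def)

sublocale affine_quotient M A "\<lambda>y. p (s y)"
proof
  have pc: "continuous_map Mh M p" and pim: "p ` topspace Mh = topspace M"
    using cov by (auto simp: covering_map_def)
  show "continuous_map euclidean M (\<lambda>y. p (s y))"
    using continuous_map_compose[OF s_continuous pc] by (simp add: o_def)
  have "range s = topspace Mh"
  proof
    show "topspace Mh \<subseteq> range s" using s_D by (metis rangeI subsetI)
  qed auto
  then show "range (\<lambda>y. p (s y)) = topspace M" using pim by (metis image_image)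
  show "openin M ((\<lambda>y. p (s y)) ` S)" if "open S" for S
  proof -
    have "homeomorphic_map euclidean Mh s" using Ds homeomorphic_maps_map by blast
    then have "openin Mh (s ` S)"
      using homeomorphic_imp_open_map that by (metis open_map_def open_openin)
    then have "openin M (p ` s ` S)" using covering_map_open[OF cov] by (auto simp: open_map_def)
    then show ?thesis by (simp add: image_image)
  qed
  show "\<exists>N g. open N \<and> x \<in> N \<and> (\<lambda>y. p (s y)) ` N \<subseteq> V \<and> affine_fun g \<and> bij g \<and>
      (\<forall>z\<in>N. \<phi> (p (s z)) = g z)" if V: "(V, \<phi>) \<in> A" "p (s x) \<in> V" for V \<phi> x
  proof -
    obtain N g where N: "openin Mh N" "s x \<in> N" "p ` N \<subseteq> V" "affine_fun g" "bij g"
      "\<And>z. z \<in> N \<Longrightarrow> \<phi> (p z) = g (D z)"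
      by (rule developing_map_in_chart[OF at cov dev s_mem V]) blast
    then show ?thesis using open_vimage_s[OF N(1)]
      by (intro exI[of _ "s -` N"] exI[of _ g]) auto
  qed
qed (fact at hausM compM)+

lemma deck_transformation:
  assumes g: "g \<in> deck"
  shows "(\<lambda>x. s (g (D x))) \<in> deck_transformations Mh p"
proof -
  have "homeomorphic_maps euclidean euclidean g (inv g)"
    using deckD[OF g] deckD(1)[OF deck_inv[OF g]]
    by (auto simp: homeomorphic_maps_def intro: affine_fun_imp_continuous_on)
  then have "homeomorphic_map euclidean euclidean g" by (rule homeomorphic_maps_map[THEN iffD1, THEN conjunct1])
  moreover have "homeomorphic_map Mh euclidean D" "homeomorphic_map euclidean Mh s"
    using Ds homeomorphic_maps_map by blast+
  ultimately have "homeomorphic_map Mh Mh (s \<circ> (g \<circ> D))" by (blast intro: homeomorphic_map_compose)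
  then show ?thesis
    unfolding deck_transformations_def using deckD(3)[OF g] s_D by (simp add: o_def)
qed

text \<open>Conjugating \<open>g\<close> by the development gives a deck transformation of
  \<open>Mh\<close>. Its holonomy is \<open>g\<close> itself, because \<open>D\<close> is onto, so
  invariance of \<open>U\<close> under the holonomy passes to \<open>deck\<close>.\<close>

lemma linear_part_deck:
  assumes hol: "holonomy Mh p D h" and g: "g \<in> deck"
    and inv: "\<forall>\<gamma> \<in> deck_transformations Mh p. linear_part (h \<gamma>) ` U = U"
  shows "linear_part g ` U = U"
proof -
  let ?\<gamma> = "\<lambda>x. s (g (D x))"
  have "h ?\<gamma> (D x) = D (?\<gamma> x)" if "x \<in> topspace Mh" for x
    using hol deck_transformation[OF g] that unfolding holonomy_def by metis
  from this[OF s_mem] have "h ?\<gamma> = g" by auto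
  then show ?thesis using inv deck_transformation[OF g] by metis
qed

text \<open>The homeomorphism \<open>D\<close> exchanges neighbourhoods in \<open>Mh\<close> with
  balls, and two points differ by an element of \<open>U\<close> iff they lie on one level.\<close>

lemma openin_leaf_topology:
  assumes U: "U = {x. a \<bullet> x = 0}"
  shows "openin (leaf_topology Mh p D U) S \<longleftrightarrow> S \<subseteq> topspace M \<and>
    (\<forall>x. p (s x) \<in> S \<longrightarrow> (\<exists>e>0. \<forall>z\<in>ball x e. a \<bullet> z = a \<bullet> x \<longrightarrow> p (s z) \<in> S))"
    (is "_ \<longleftrightarrow> _ \<and> ?R")
proof -
  let ?C = "cover_leaf_topology Mh D U"
  have "openin ?C (topspace Mh)"
    unfolding openin_cover_leaf_topology by (auto intro!: exI[of _ "topspace Mh"])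
  then have "topspace Mh \<subseteq> topspace ?C" by (rule openin_subset)
  moreover have "topspace ?C \<subseteq> topspace Mh"
    by (rule openin_topspace[of ?C, unfolded openin_cover_leaf_topology, THEN conjunct1])
  ultimately have top: "topspace ?C = topspace Mh" by blast
  have pim: "p ` topspace Mh = topspace M" using cov by (simp add: covering_map_def)
  have Uiff: "z - x \<in> U \<longleftrightarrow> a \<bullet> z = a \<bullet> x" for z x by (simp add: U inner_diff_right)
  let ?P = "{x \<in> topspace Mh. p x \<in> S}"
  have "(\<forall>x\<in>?P. \<exists>W. openin Mh W \<and> x \<in> W \<and> {z \<in> W. D z - D x \<in> U} \<subseteq> ?P) \<longleftrightarrow> ?R"
  proof
    assume L: "\<forall>x\<in>?P. \<exists>W. openin Mh W \<and> x \<in> W \<and> {z \<in> W. D z - D x \<in> U} \<subseteq> ?P"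
    show ?R
    proof (intro allI impI)
      fix x assume "p (s x) \<in> S"
      then have "s x \<in> ?P" by simp
      from bspec[OF L this] obtain W where W: "openin Mh W" "s x \<in> W" "{z \<in> W. D z - D (s x) \<in> U} \<subseteq> ?P"
        by blast
      obtain e where "e > 0" "ball x e \<subseteq> s -` W" using openE[OF open_vimage_s[OF W(1)]] W(2) by blast
      moreover have "p (s z) \<in> S" if "s z \<in> W" "a \<bullet> z = a \<bullet> x" for z
      proof -
        have "s z \<in> {z \<in> W. D z - D (s x) \<in> U}" using that by (simp add: Uiff)
        then show ?thesis using W(3) by blast
      qed
      ultimately show "\<exists>e>0. \<forall>z\<in>ball x e. a \<bullet> z = a \<bullet> x \<longrightarrow> p (s z) \<in> S"
        by (intro exI[of _ e]) (auto simp: subset_iff)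
    qed
  next
    assume R: ?R
    show "\<forall>x\<in>?P. \<exists>W. openin Mh W \<and> x \<in> W \<and> {z \<in> W. D z - D x \<in> U} \<subseteq> ?P"
    proof
      fix x assume x: "x \<in> ?P"
      then have "p (s (D x)) \<in> S" by (simp add: s_D)
      then obtain e where e: "e > 0" "\<forall>z\<in>ball (D x) e. a \<bullet> z = a \<bullet> D x \<longrightarrow> p (s z) \<in> S" using R by blast
      have "openin Mh {z \<in> topspace Mh. D z \<in> ball (D x) e}"
        using openin_continuous_map_preimage[OF D_continuous, of "ball (D x) e"] by simp
      moreover have "p z \<in> S" if "z \<in> topspace Mh" "D z \<in> ball (D x) e" "D z - D x \<in> U" for z
        using e(2) that s_D[OF that(1)] Uiff by metis
      ultimately show "\<exists>W. openin Mh W \<and> x \<in> W \<and> {z \<in> W. D z - D x \<in> U} \<subseteq> ?P"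
        using x e(1) by (intro exI[of _ "{z \<in> topspace Mh. D z \<in> ball (D x) e}"]) auto
    qed
  qed
  then show ?thesis
    unfolding leaf_topology_def openin_quotient_topology top pim openin_cover_leaf_topology by blast
qed

end

theorem proposition4p8:
  fixes M :: "'a topology" and A :: "('a, real ^ 'n) atlas"
    and Mh :: "'b topology" and p :: "'b \<Rightarrow> 'a"
    and D :: "'b \<Rightarrow> real ^ 'n" and h :: "('b \<Rightarrow> 'b) \<Rightarrow> real ^ 'n \<Rightarrow> real ^ 'n"
    and U :: "(real ^ 'n) set"
  assumes "affine_manifold M A"
    and "compact_space M"
    and "geodesically_complete M A"
    and "universal_cover Mh M p"
    and "developing_map Mh (pullback_atlas Mh M p A) D"
    and "holonomy Mh p D h"
    and "subspace U"
    and "\<forall>\<gamma> \<in> deck_transformations Mh p. linear_part (h \<gamma>) ` U = U"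
    and "CARD('n) - dim U = 1"
    and "\<exists>F. compact_leaf Mh p D U F"
  shows "(\<forall>F \<in> leaves Mh p D U. compact_leaf Mh p D U F) \<and>
    (\<exists>(M' :: 'b set topology) q (\<tau> :: real) f.
        finite_affine_cover M' q M A \<and> \<tau> > 0 \<and>
        affine_map M' (pullback_atlas M' M q A) (circle \<tau>) (circle_atlas \<tau>) f \<and>
        \<not> (\<exists>c. \<forall>x \<in> topspace M'. f x = c))"
proof -
  have at: "affine_atlas M A" "Hausdorff_space M" using assms(1) by (auto simp: affine_manifold_def)
  have cov: "covering_map Mh M p" and sc: "simply_connected_space Mh"
    using assms(4) by (auto simp: universal_cover_def)
  obtain F0 where F0: "compact_leaf Mh p D U F0" using assms(10) by blast
  \<comment> \<open>The definitions admit an empty space; the given leaf excludes it, since an empty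
    leaf topology has no components.\<close>
  have "topspace Mh \<noteq> {}"
  proof
    assume empty: "topspace Mh = {}"
    have "openin (leaf_topology Mh p D U) (topspace (leaf_topology Mh p D U))" by blast
    then have "topspace (leaf_topology Mh p D U) \<subseteq> p ` topspace (cover_leaf_topology Mh D U)"
      unfolding leaf_topology_def openin_quotient_topology by blast
    moreover have "topspace (cover_leaf_topology Mh D U) \<subseteq> topspace Mh"
      using openin_topspace[of "cover_leaf_topology Mh D U"] unfolding openin_cover_leaf_topology by blast
    ultimately have "topspace (leaf_topology Mh p D U) = {}" using empty by auto
    then show False using F0 by (simp add: compact_leaf_def leaves_def connected_components_of_def)
  qed
  then obtain s where s: "homeomorphic_maps Mh euclidean D s"
    using developing_map_homeomorphism[OF at assms(3) cov simply_connected_imp_connected_space[OF sc] _ assms(5)]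
    by blast
  interpret developed_affine_manifold M A Mh p D s
    by unfold_locales (fact at assms(2,5) cov s)+
  obtain a where a: "norm a = 1" "U = {x. a \<bullet> x = 0}"
    using hyperplane_unit_normal[OF assms(7)] assms(9) by auto
  interpret affine_foliation M A "\<lambda>y. p (s y)" a
  proof
    show "a \<bullet> linear_part g x = 0" if "g \<in> deck" "a \<bullet> x = 0" for g x
      using linear_part_deck[OF assms(6) that(1) assms(8)] that(2) a(2) by blast
  qed (rule a(1))
  note leaf = openin_leaf_topology[OF a(2)]
  have leaves: "leaves Mh p D U = range (\<lambda>t. (\<lambda>y. p (s y)) ` {z. a \<bullet> z = t})"
    unfolding leaves_def by (rule connected_components_L[OF leaf])
  obtain t0 where "F0 = (\<lambda>y. p (s y)) ` {z. a \<bullet> z = t0}"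
    using F0 leaves unfolding compact_leaf_def by blast
  then have "cocompact_level t0"
    using F0 compactin_L_leaf[OF leaf, of t0] by (simp add: compact_leaf_def)
  then have fin: "finite (orbit t0 \<inter> {-r..r})" for r by (rule cocompact_level_orbit_finite)
  have "cocompact_level t" for t
    using orbit_finite_all[OF fin] by (rule orbit_finite_cocompact_level)
  then have "\<forall>F \<in> leaves Mh p D U. compact_leaf Mh p D U F"
    using compactin_L_leaf[OF leaf] leaves by (auto simp: compact_leaf_def)
  moreover obtain \<tau> where \<tau>: "\<tau> > 0" "mu ` deck1 = {of_int k * \<tau> | k :: int. True}"
    using mu_deck1_cyclic[OF fin] by blast
  \<comment> \<open>The points of the cover are the \<open>deck1\<close>-orbits, transported to
    \<open>Mh\<close> by the injective \<open>s\<close> to make them sets of type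
    \<open>'b set\<close>.\<close>
  define \<pi> where "\<pi> x = s ` (\<lambda>g. g x) ` deck1" for x
  interpret affine_foliation_cover M A "\<lambda>y. p (s y)" a \<pi>
  proof
    have "inj s" by (metis D_s injI)
    then have \<pi>: "\<pi> x = \<pi> y \<longleftrightarrow> (\<lambda>g. g x) ` deck1 = (\<lambda>g. g y) ` deck1" for x y
      unfolding \<pi>_def by (simp add: inj_image_eq_iff)
    have sub: "(\<lambda>g. g y) ` deck1 \<subseteq> (\<lambda>g. g x) ` deck1" if "g \<in> deck1" "g x = y" for g x y
    proof clarify
      fix k assume "k \<in> deck1"
      then have "(\<lambda>x. k (g x)) \<in> deck1" using that(1) by (rule deck1_compose)
      then show "k y \<in> (\<lambda>g. g x) ` deck1" using that(2) by (auto intro!: rev_image_eqI)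
    qed
    show "\<pi> x = \<pi> y \<longleftrightarrow> (\<exists>g\<in>deck1. g x = y)" for x y
    proof
      assume "\<pi> x = \<pi> y"
      then have "(\<lambda>g. g x) ` deck1 = (\<lambda>g. g y) ` deck1" using \<pi> by blast
      moreover have "y \<in> (\<lambda>g. g y) ` deck1" using deck1_id by (force intro!: image_eqI)
      ultimately have "y \<in> (\<lambda>g. g x) ` deck1" by (simp only:)
      then show "\<exists>g\<in>deck1. g x = y" by blast
    next
      assume "\<exists>g\<in>deck1. g x = y"
      then obtain g where g: "g \<in> deck1" "g x = y" by blast
      then have "inv g y = x" using deckD(4)[of g x] by (auto simp: deck1_def)
      then show "\<pi> x = \<pi> y"
        unfolding \<pi> using sub[OF g] sub[OF deck1_inv[OF g(1)], of y x] by (intro equalityI) simp_all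
    qed
    show "\<bar>lam g\<bar> = 1" if "g \<in> deck" for g using lam_unit[OF fin that] .
  qed
  have "finite_affine_cover cover_space cover_proj M A \<and> \<tau> > 0 \<and>
      affine_map cover_space (pullback_atlas cover_space M cover_proj A) (circle \<tau>) (circle_atlas \<tau>) (circle_map \<tau>) \<and>
      \<not> (\<exists>c. \<forall>x \<in> topspace cover_space. circle_map \<tau> x = c)"
    using finite_affine_cover_cover_space affine_map_circle_map[OF \<tau>] circle_map_not_constant[OF \<tau>] \<tau>(1)
    by blast
  ultimately show ?thesis by blast
qed

end
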